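(* Every Artemis graph that is not a clique has a special even pair. Every Artemis graph is perfectly contractile.
   Context: Graphs are finite, simple, undirected. "Contains" refers to induced subgraphs. A path of $G$ is an induced chordless path; its length is its number of edges. A hole is a chordless cycle with at least 4 vertices; an antihole is the complement of a hole; it is long if it has at least 5 vertices. A clique is a complete graph. A prism is a graph whose vertex set is partitioned into three sets inducing paths $P_1,P_2,P_3$, each of length at least 1, $P_i$ having ends $a_i,b_i$, such that $\{a_1,a_2,a_3\}$ and $\{b_1,b_2,b_3\}$ are triangles and there are no edges between different $P_i$'s other than those of these two triangles. An Artemis graph is a graph that contains no odd hole, no long antihole and no prism. An even pair of $G$ is a pair $\{x,y\}$ of vertices such that every path of $G$ joining $x$ to $y$ has even length. A quasi-prism with ends $a,b$ is a graph $S$ whose vertex set is partitioned into four sets inducing paths $S_1$ from $a$ to $a'$, $S_2$ from $b$ to $b'$, $S_3$ from $c$ to $c'$, $S_4$ from $d$ to $d'$, where $S_1,S_2$ may have length 0 but $S_3,S_4$ have length at least 1, and with $E(S)=E(S_1)\cup E(S_2)\cup E(S_3)\cup E(S_4)\cup\{a'c,a'd,cd,b'c',b'd',c'd'\}$. It is strict if at least one of $S_1,S_2$ has length at least 1. An even pair $\{a,b\}$ of $G$ is special if $G$ contains no strict quasi-prism with ends $a$ and $b$ as an induced subgraph. For non-adjacent vertices $x,y$ of $G$, the contraction $G/xy$ is obtained by deleting $x$ and $y$ and adding a new vertex adjacent to exactly those vertices of $V(G)\setminus\{x,y\}$ that are adjacent to at least one of $x,y$. A graph $G$ is contractile if it is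 a clique or if there is a sequence of graphs $G=G_0,\dots,G_k$ such that for $i=0,\dots,k-1$ the graph $G_i$ has an even pair $\{x_i,y_i\}$ with $G_{i+1}=G_i/x_iy_i$, and $G_k$ is a clique. A graph is perfectly contractile if all its induced subgraphs are contractile. *)

theory Defs
  imports "Graph_Theory.Graph_Theory"
begin

text \<open>Finite simple undirected graphs are the symmetric loopless finite digraphs of
  \<^locale>\<open>pair_graph\<close>: every undirected edge is represented by its two arcs.
  Induced subgraphs are those of \<^const>\<open>induced_subgraph\<close>.\<close>

definition contains ::
  "'a pair_pre_digraph \<Rightarrow> ('a pair_pre_digraph \<Rightarrow> bool) \<Rightarrow> bool" where
  "contains G P \<longleftrightarrow> (\<exists>H. induced_subgraph (with_proj H) (with_proj G) \<and> P H)"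

text \<open>The graph without vertices counts as a clique.\<close>

definition is_clique :: "'a pair_pre_digraph \<Rightarrow> bool" where
  "is_clique G \<longleftrightarrow> (\<exists>n. complete_digraph n (with_proj G))"

definition complement :: "'a pair_pre_digraph \<Rightarrow> 'a pair_pre_digraph" where
  "complement G =
     \<lparr> pverts = pverts G,
       parcs = {(u, v). u \<in> pverts G \<and> v \<in> pverts G \<and> u \<noteq> v \<and> (u, v) \<notin> parcs G} \<rparr>"

text \<open>A path is given by the list of its vertices in order; its ends are the \<^const>\<open>hd\<close> and
  the \<^const>\<open>last\<close> of the list, which coincide for a path of length 0.\<close>

definition path_edges :: "'a list \<Rightarrow> ('a \<times> 'a) set" where
  "path_edges xs = symcl (set (zip xs (tl xs)))"

definition is_path :: "'a pair_pre_digraph \<Rightarrow> 'a list \<Rightarrow> bool" where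
  "is_path G xs \<longleftrightarrow> xs \<noteq> [] \<and> distinct xs \<and> set xs \<subseteq> pverts G \<and>
     parcs G \<inter> (set xs \<times> set xs) = path_edges xs"

definition path_length :: "'a list \<Rightarrow> nat" where
  "path_length xs = length xs - 1"

definition is_hole :: "'a pair_pre_digraph \<Rightarrow> bool" where
  "is_hole H \<longleftrightarrow> (\<exists>xs. distinct xs \<and> 4 \<le> length xs \<and> pverts H = set xs \<and>
     parcs H = symcl (set (zip xs (rotate1 xs))))"

definition is_odd_hole :: "'a pair_pre_digraph \<Rightarrow> bool" where
  "is_odd_hole H \<longleftrightarrow> is_hole H \<and> odd (card (pverts H))"

definition is_antihole :: "'a pair_pre_digraph \<Rightarrow> bool" where
  "is_antihole H \<longleftrightarrow> (\<exists>C. is_hole C \<and> H = complement C)"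

definition is_long_antihole :: "'a pair_pre_digraph \<Rightarrow> bool" where
  "is_long_antihole H \<longleftrightarrow> is_antihole H \<and> 5 \<le> card (pverts H)"

definition triangle_edges :: "'a \<Rightarrow> 'a \<Rightarrow> 'a \<Rightarrow> ('a \<times> 'a) set" where
  "triangle_edges x y z = symcl {(x, y), (x, z), (y, z)}"

definition is_prism :: "'a pair_pre_digraph \<Rightarrow> bool" where
  "is_prism H \<longleftrightarrow> (\<exists>P1 P2 P3.
     distinct (P1 @ P2 @ P3) \<and> pverts H = set (P1 @ P2 @ P3) \<and>
     is_path H P1 \<and> is_path H P2 \<and> is_path H P3 \<and>
     1 \<le> path_length P1 \<and> 1 \<le> path_length P2 \<and> 1 \<le> path_length P3 \<and>
     parcs H = path_edges P1 \<union> path_edges P2 \<union> path_edges P3 \<union>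
       triangle_edges (hd P1) (hd P2) (hd P3) \<union>
       triangle_edges (last P1) (last P2) (last P3))"

definition artemis :: "'a pair_pre_digraph \<Rightarrow> bool" where
  "artemis G \<longleftrightarrow> pair_graph G \<and>
     \<not> contains G is_odd_hole \<and> \<not> contains G is_long_antihole \<and> \<not> contains G is_prism"

text \<open>The two vertices of an even pair are distinct; they are then non-adjacent, because an edge
  is a path of length 1.\<close>

definition even_pair :: "'a pair_pre_digraph \<Rightarrow> 'a \<Rightarrow> 'a \<Rightarrow> bool" where
  "even_pair G x y \<longleftrightarrow> x \<in> pverts G \<and> y \<in> pverts G \<and> x \<noteq> y \<and>
     (\<forall>p. is_path G p \<and> hd p = x \<and> last p = y \<longrightarrow> even (path_length p))"

definition is_strict_quasi_prism :: "'a \<Rightarrow> 'a \<Rightarrow> 'a pair_pre_digraph \<Rightarrow> bool" where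
  "is_strict_quasi_prism a b S \<longleftrightarrow> (\<exists>S1 S2 S3 S4 a' b' c c' d d'.
     distinct (S1 @ S2 @ S3 @ S4) \<and> pverts S = set (S1 @ S2 @ S3 @ S4) \<and>
     is_path S S1 \<and> hd S1 = a \<and> last S1 = a' \<and>
     is_path S S2 \<and> hd S2 = b \<and> last S2 = b' \<and>
     is_path S S3 \<and> hd S3 = c \<and> last S3 = c' \<and> 1 \<le> path_length S3 \<and>
     is_path S S4 \<and> hd S4 = d \<and> last S4 = d' \<and> 1 \<le> path_length S4 \<and>
     parcs S = path_edges S1 \<union> path_edges S2 \<union> path_edges S3 \<union> path_edges S4 \<union>
       symcl {(a', c), (a', d), (c, d), (b', c'), (b', d'), (c', d')} \<and>
     (1 \<le> path_length S1 \<or> 1 \<le> path_length S2))"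

definition special_even_pair :: "'a pair_pre_digraph \<Rightarrow> 'a \<Rightarrow> 'a \<Rightarrow> bool" where
  "special_even_pair G a b \<longleftrightarrow> even_pair G a b \<and> \<not> contains G (is_strict_quasi_prism a b)"

text \<open>After \<open>x\<close> and \<open>y\<close> have been deleted the name \<open>x\<close> is free again, and it is given to the
  new vertex.  The contraction is thus defined over the same vertex type, finite or not.\<close>

definition contract :: "'a pair_pre_digraph \<Rightarrow> 'a \<Rightarrow> 'a \<Rightarrow> 'a pair_pre_digraph" where
  "contract G x y =
     (let W = pverts G - {x, y};
          N = {w \<in> W. (x, w) \<in> parcs G \<or> (y, w) \<in> parcs G}
      in \<lparr> pverts = insert x W,
           parcs = (parcs G \<inter> (W \<times> W)) \<union> symcl ({x} \<times> N) \<rparr>)"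

definition contractile :: "'a pair_pre_digraph \<Rightarrow> bool" where
  "contractile G \<longleftrightarrow> is_clique G \<or>
     (\<exists>(k :: nat) Gs. Gs 0 = G \<and>
        (\<forall>i<k. \<exists>x y. even_pair (Gs i) x y \<and> Gs (Suc i) = contract (Gs i) x y) \<and>
        is_clique (Gs k))"

definition perfectly_contractile :: "'a pair_pre_digraph \<Rightarrow> bool" where
  "perfectly_contractile G \<longleftrightarrow>
     (\<forall>H. induced_subgraph (with_proj H) (with_proj G) \<longrightarrow> contractile H)"

end

theory Submission
  imports Defs
begin

text \<open>Let \<open>T\<close> be a largest co-connected vertex set whose set \<open>C\<close> of complete vertices is not a clique.
  By the Roussel--Rubio lemma, every path with both ends in \<open>C\<close> and no inner vertex in \<open>T \<union> C\<close> (an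
  outer path) is even, and by maximality it has length at least 4.  If there is no outer path, then
  a special even pair of the graph induced on \<open>C\<close>, which exists by induction, is one of the whole
  graph.  Otherwise take a shortest outer path with interior \<open>z\<close>, and let \<open>A\<close> and \<open>B\<close> be the sets of
  vertices of \<open>C\<close> whose only neighbour in \<open>z\<close> is the first, respectively the last vertex of \<open>z\<close>;
  these are cliques without edges between them.  An odd path from \<open>A\<close> to \<open>B\<close> has its second vertex in
  \<open>A\<close> or its penultimate one in \<open>B\<close>.  Directing \<open>a\<close> to \<open>a'\<close> in \<open>A\<close> when some path to \<open>B\<close> starts with
  \<open>a\<close>, \<open>a'\<close> gives a strict order, and likewise for \<open>B\<close>; a maximal \<open>a\<close> and a maximal \<open>b\<close> form a special
  even pair.  Contracting a special even pair creates no odd hole, long antihole or prism, which gives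
  perfect contractibility by induction.\<close>

section \<open>Induced paths, holes and connected sets\<close>

text \<open>An arbitrary even pair is not enough for the induction behind contractility: contracting
  it can create a prism, for instance the antihole with 6 vertices. Undoing a contraction whose new
  vertex lies inside a leg of a prism splits this leg and leaves a strict quasi-prism with the two
  old vertices as ends; hence the condition in the word special. The forbidden subgraphs share the
  work: holes give parities, prisms forbid a triangle linked to a path in two ways (the hat below),
  long antiholes control the co-connected sets. The bound 4 comes from \<open>T\<close>: the middle
  vertex of an outer path of length 2 could be added to \<open>T\<close>. It makes the ends of
  \<open>z\<close> distinct, which keeps \<open>A\<close> and \<open>B\<close> apart. Without outer
  paths a path between two vertices of \<open>C\<close> stays in \<open>C\<close> or meets
  \<open>T\<close>; in the second case it has length 2, because a vertex of \<open>T\<close> sees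
  both ends. So parity and the absence of strict quasi-prisms carry over from \<open>C\<close>. If
  no vertex has two nonadjacent neighbours, then no \<open>T\<close> exists, but all components are
  cliques and every nonadjacent pair is special.\<close>

text \<open>Graphs are handled as a symmetric irreflexive relation \<open>E\<close> and a vertex set.  A hole is given by
  one of its vertices \<open>d\<close> and the induced path \<open>f\<close> formed by the others, so it is odd if and only if
  \<open>f\<close> has an even number of vertices; an antihole is a hole of \<open>co E\<close>.\<close>

fun ipath :: "('a \<Rightarrow> 'a \<Rightarrow> bool) \<Rightarrow> 'a list \<Rightarrow> bool" where
  "ipath E [] \<longleftrightarrow> False"
| "ipath E [x] \<longleftrightarrow> True"
| "ipath E (x # y # ys) \<longleftrightarrow>
     x \<noteq> y \<and> E x y \<and> (\<forall>z\<in>set ys. z \<noteq> x \<and> \<not> E x z) \<and> ipath E (y # ys)"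

definition hole :: "('a \<Rightarrow> 'a \<Rightarrow> bool) \<Rightarrow> 'a \<Rightarrow> 'a list \<Rightarrow> bool" where
  "hole E d f \<longleftrightarrow> ipath E f \<and> 3 \<le> length f \<and> d \<notin> set f \<and>
     (\<forall>v\<in>set f. E d v \<longleftrightarrow> v = hd f \<or> v = last f)"

definition co :: "('a \<Rightarrow> 'a \<Rightarrow> bool) \<Rightarrow> 'a \<Rightarrow> 'a \<Rightarrow> bool" where
  "co E u v \<longleftrightarrow> u \<noteq> v \<and> \<not> E u v"

definition rungs :: "('a \<Rightarrow> 'a \<Rightarrow> bool) \<Rightarrow> 'a list \<Rightarrow> 'a list \<Rightarrow> bool" where
  "rungs E P Q \<longleftrightarrow> (\<forall>u\<in>set P. \<forall>v\<in>set Q. u \<noteq> v \<and>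
     (E u v \<longleftrightarrow> u = hd P \<and> v = hd Q \<or> u = last P \<and> v = last Q))"

definition prism :: "('a \<Rightarrow> 'a \<Rightarrow> bool) \<Rightarrow> 'a list \<Rightarrow> 'a list \<Rightarrow> 'a list \<Rightarrow> bool" where
  "prism E P Q R \<longleftrightarrow> ipath E P \<and> ipath E Q \<and> ipath E R \<and>
     2 \<le> length P \<and> 2 \<le> length Q \<and> 2 \<le> length R \<and> rungs E P Q \<and> rungs E P R \<and> rungs E Q R"

definition conn :: "('a \<Rightarrow> 'a \<Rightarrow> bool) \<Rightarrow> 'a set \<Rightarrow> bool" where
  "conn E K \<longleftrightarrow> (\<forall>u\<in>K. \<forall>v\<in>K. (\<lambda>x y. E x y \<and> x \<in> K \<and> y \<in> K)\<^sup>*\<^sup>* u v)"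

definition complete_to :: "('a \<Rightarrow> 'a \<Rightarrow> bool) \<Rightarrow> 'a set \<Rightarrow> 'a set \<Rightarrow> 'a set" where
  "complete_to E V T = {v \<in> V. \<forall>t\<in>T. E v t}"

locale ugraph =
  fixes E :: "'a \<Rightarrow> 'a \<Rightarrow> bool"
  assumes sym: "E u v \<Longrightarrow> E v u" and irrefl [simp]: "\<not> E u u"
begin

lemma E_commute: "E u v \<longleftrightarrow> E v u"
  using sym by blast

lemma ugraph_co: "ugraph (co E)"
  by unfold_locales (auto simp: co_def E_commute)

lemma ipath_ne [simp]: "ipath R p \<Longrightarrow> p \<noteq> []"
  by auto

lemma ipath_distinct: "ipath R p \<Longrightarrow> distinct p"
  by (induction R p rule: ipath.induct) auto

lemma ipath_Cons:
  "ipath R (x # ys) \<longleftrightarrow> ys = [] \<or>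
     ipath R ys \<and> x \<notin> set ys \<and> (\<forall>v\<in>set ys. R x v \<longleftrightarrow> v = hd ys)"
  using ipath_distinct[of R ys] by (cases ys) auto

lemma ipath_append:
  "ipath R (xs @ ys) \<longleftrightarrow> xs = [] \<and> ipath R ys \<or> ys = [] \<and> ipath R xs \<or>
     ipath R xs \<and> ipath R ys \<and>
     (\<forall>u\<in>set xs. \<forall>v\<in>set ys. u \<noteq> v \<and> (R u v \<longleftrightarrow> u = last xs \<and> v = hd ys))"
proof (cases "ys = []")
  case True
  then show ?thesis by auto
next
  case ys: False
  show ?thesis
  proof (induction xs)
    case Nil
    then show ?case by auto
  next
    case (Cons x xs)
    show ?case
    proof (cases "xs = []")
      case True
      then show ?thesis using ys by (auto simp: ipath_Cons)
    next
      case False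
      have hd: "hd (xs @ ys) = hd xs" "hd xs \<in> set xs" "hd ys \<in> set ys" "last xs \<in> set xs"
        using False ys by auto
      show ?thesis
        using Cons.IH False ys hd by (simp add: ipath_Cons) (auto; metis)
    qed
  qed
qed

lemma ipath_rev [simp]: "ipath E (rev p) \<longleftrightarrow> ipath E p"
proof (induction p)
  case Nil
  then show ?case by simp
next
  case (Cons x p)
  show ?case
    using Cons by (cases "p = []") (auto simp: ipath_append ipath_Cons last_rev E_commute)
qed

lemma ipath_snoc:
  "ipath E (xs @ [y]) \<longleftrightarrow> xs = [] \<or>
     ipath E xs \<and> y \<notin> set xs \<and> (\<forall>v\<in>set xs. E y v \<longleftrightarrow> v = last xs)"
  by (auto simp: ipath_append E_commute)

lemma ipath_appendD1: "ipath R (xs @ ys) \<Longrightarrow> xs \<noteq> [] \<Longrightarrow> ipath R xs"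
  and ipath_appendD2: "ipath R (xs @ ys) \<Longrightarrow> ys \<noteq> [] \<Longrightarrow> ipath R ys"
  by (auto simp: ipath_append)

lemma ipath_neighbour:
  assumes "ipath E p" "2 \<le> length p" "v \<in> set p"
  shows "\<exists>w\<in>set p. E v w"
proof -
  obtain xs ys where p: "p = xs @ v # ys" using assms(3) by (meson split_list)
  show ?thesis
  proof (cases "ys = []")
    case False
    then have "E v (hd ys)" "hd ys \<in> set ys"
      using assms p by (auto simp: ipath_append ipath_Cons)
    then show ?thesis using p by auto
  next
    case True
    then have "xs \<noteq> []" using assms p by auto
    then have "E (last xs) v" "last xs \<in> set xs"
      using assms p by (auto simp: ipath_append)
    then show ?thesis using p sym by auto
  qed
qed

lemma conn_single [simp]: "conn E {u}"
  by (auto simp: conn_def)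

lemma connD: "conn E K \<Longrightarrow> u \<in> K \<Longrightarrow> v \<in> K \<Longrightarrow> (\<lambda>x y. E x y \<and> x \<in> K \<and> y \<in> K)\<^sup>*\<^sup>* u v"
  by (auto simp: conn_def)

lemma walk_mono:
  "(\<lambda>x y. E x y \<and> x \<in> K \<and> y \<in> K)\<^sup>*\<^sup>* u v \<Longrightarrow> K \<subseteq> L \<Longrightarrow> (\<lambda>x y. E x y \<and> x \<in> L \<and> y \<in> L)\<^sup>*\<^sup>* u v"
  by (erule rtranclp_mono[THEN predicate2D, rotated]) auto

lemma walk_sym:
  "(\<lambda>x y. E x y \<and> x \<in> K \<and> y \<in> K)\<^sup>*\<^sup>* u v \<Longrightarrow> (\<lambda>x y. E x y \<and> x \<in> K \<and> y \<in> K)\<^sup>*\<^sup>* v u"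
proof (induction rule: rtranclp_induct)
  case (step y z)
  then show ?case
    using sym[of y z] by (auto intro: converse_rtranclp_into_rtranclp[where b = y])
qed auto

lemma connI_root:
  assumes "\<And>v. v \<in> K \<Longrightarrow> (\<lambda>x y. E x y \<and> x \<in> K \<and> y \<in> K)\<^sup>*\<^sup>* v r"
  shows "conn E K"
  unfolding conn_def using assms walk_sym by (meson rtranclp_trans)

lemma conn_Un:
  assumes "conn E A" "conn E B" "a \<in> A" "b \<in> B" "a = b \<or> E a b"
  shows "conn E (A \<union> B)"
proof (rule connI_root[where r = a])
  fix v assume "v \<in> A \<union> B"
  have ba: "(\<lambda>x y. E x y \<and> x \<in> A \<union> B \<and> y \<in> A \<union> B)\<^sup>*\<^sup>* b a"
    using assms(3-5) sym by auto
  consider "v \<in> A" | "v \<in> B" using \<open>v \<in> A \<union> B\<close> by auto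
  then show "(\<lambda>x y. E x y \<and> x \<in> A \<union> B \<and> y \<in> A \<union> B)\<^sup>*\<^sup>* v a"
  proof cases
    case 1
    show ?thesis by (rule walk_mono[OF connD[OF assms(1) 1 assms(3)]]) simp
  next
    case 2
    have "(\<lambda>x y. E x y \<and> x \<in> A \<union> B \<and> y \<in> A \<union> B)\<^sup>*\<^sup>* v b"
      by (rule walk_mono[OF connD[OF assms(2) 2 assms(4)]]) simp
    then show ?thesis using ba by (meson rtranclp_trans)
  qed
qed

lemma conn_insert: "conn E A \<Longrightarrow> b \<in> A \<Longrightarrow> E a b \<Longrightarrow> conn E (insert a A)"
  using conn_Un[of "{a}" A a b] by simp

lemma conn_path: "ipath E p \<Longrightarrow> conn E (set p)"
proof (induction p)
  case (Cons x p)
  then show ?case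
    by (cases "p = []") (auto simp: ipath_Cons intro!: conn_insert[where b = "hd p"])
qed auto

lemma walk_ipath:
  assumes "(\<lambda>x y. E x y \<and> x \<in> K \<and> y \<in> K)\<^sup>*\<^sup>* u v" "u \<in> K"
  shows "\<exists>p. ipath E p \<and> set p \<subseteq> K \<and> hd p = u \<and> last p = v"
  using assms
proof (induction rule: rtranclp_induct)
  case base
  then show ?case by (intro exI[of _ "[u]"]) auto
next
  case (step y z)
  then obtain p where p: "ipath E p" "set p \<subseteq> K" "hd p = u" "last p = y" by auto
  have yz: "E y z" "z \<in> K" using step by auto
  show ?case
  proof (cases "z \<in> set p")
    case True
    then obtain xs ys where s: "p = xs @ z # ys" by (meson split_list)
    have "ipath E (xs @ [z])" using p(1) s by (auto simp: ipath_append ipath_Cons)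
    moreover have "hd (xs @ [z]) = u" using p(3) s by (cases xs) auto
    ultimately show ?thesis using p s by (intro exI[of _ "xs @ [z]"]) auto
  next
    case False
    have "\<exists>x\<in>set p. E x z" using p yz by (metis ipath_ne last_in_set)
    \<comment> \<open>Turning to \<open>z\<close> at its first neighbour on \<open>p\<close> keeps
      the path induced.\<close>
    then obtain xs x ys where s: "p = xs @ x # ys" "E x z" "\<forall>w\<in>set xs. \<not> E w z"
      using split_list_first_prop[of p "\<lambda>x. E x z"] by blast
    have "ipath E (xs @ [x])" using p(1) s by (auto simp: ipath_append ipath_Cons)
    then have "ipath E ((xs @ [x]) @ [z])"
      using s False by (subst ipath_append) auto
    moreover have "hd (xs @ [x, z]) = u" using p(3) s by (cases xs) auto
    ultimately show ?thesis using p s yz by (intro exI[of _ "xs @ [x, z]"]) auto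
  qed
qed

text \<open>Minimal length forces each predicate to hold only at its end. With \<open>Q\<close> and
  \<open>P\<close> of the form \<open>E u\<close> this gives induced paths that are attached to two
  given vertices exactly at their ends.\<close>

lemma shortest_path:
  assumes "conn E K" "u \<in> K" "Q u" "v \<in> K" "P v"
  obtains p where "ipath E p" "set p \<subseteq> K" "Q (hd p)" "P (last p)"
    "\<And>w. w \<in> set p \<Longrightarrow> Q w \<Longrightarrow> w = hd p" "\<And>w. w \<in> set p \<Longrightarrow> P w \<Longrightarrow> w = last p"
proof -
  let ?good = "\<lambda>p. ipath E p \<and> set p \<subseteq> K \<and> Q (hd p) \<and> P (last p)"
  have "\<exists>p. ?good p" using walk_ipath[OF connD[OF assms(1,2,4)] assms(2)] assms by metis
  then obtain p where p: "?good p" and min: "\<And>q. ?good q \<Longrightarrow> length p \<le> length q"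
    using arg_min_natI[of ?good _ length] arg_min_nat_le[of ?good _ length] by meson
  show thesis
  proof (rule that[of p])
    fix w assume w: "w \<in> set p"
    obtain xs ys where s: "p = xs @ w # ys" using w by (meson split_list)
    show "w = hd p" if "Q w"
    proof (rule ccontr)
      assume "w \<noteq> hd p"
      then have "xs \<noteq> []" using s by auto
      moreover have "?good (w # ys)" using p s that by (auto simp: ipath_append split: if_splits)
      ultimately show False using min[of "w # ys"] s by auto
    qed
    show "w = last p" if "P w"
    proof (rule ccontr)
      assume "w \<noteq> last p"
      then have "ys \<noteq> []" using s by auto
      moreover have "?good (xs @ [w])"
        using p s that by (auto simp: ipath_append ipath_Cons hd_append)
      ultimately show False using min[of "xs @ [w]"] s by auto
    qed
  qed (use p in auto)
qed

end

section \<open>Hats and leaps\<close>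

locale artemis_graph = ugraph E for E :: "'a \<Rightarrow> 'a \<Rightarrow> bool" +
  fixes V :: "'a set"
  assumes finite_V: "finite V"
    and hole_odd: "hole E d f \<Longrightarrow> d \<in> V \<Longrightarrow> set f \<subseteq> V \<Longrightarrow> odd (length f)"
    and antihole_short: "hole (co E) d f \<Longrightarrow> d \<in> V \<Longrightarrow> set f \<subseteq> V \<Longrightarrow> length f \<le> 3"
    and no_prism: "prism E P Q R \<Longrightarrow> set P \<subseteq> V \<Longrightarrow> set Q \<subseteq> V \<Longrightarrow> set R \<subseteq> V \<Longrightarrow> False"
begin

text \<open>A vertex of \<open>K\<close> nearest to \<open>t\<close> with a neighbour in \<open>f\<close> links the triangle \<open>t\<close>, \<open>d\<close>, \<open>d'\<close> to the path
  \<open>f\<close>: this is a prism if the vertex has exactly two neighbours in \<open>f\<close> and they are adjacent, and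
  otherwise the parities of three holes are contradictory.\<close>

lemma hat_connected:
  assumes tri: "E t d" "E t d'" "E d d'"
    and V: "d \<in> V" "d' \<in> V" "set f \<subseteq> V" "K \<subseteq> V"
    and f: "ipath E f" "2 \<le> length f"
    and df: "\<And>v. v \<in> set f \<Longrightarrow> E d v \<longleftrightarrow> v = hd f" "\<And>v. v \<in> set f \<Longrightarrow> E d' v \<longleftrightarrow> v = last f"
    and tf: "\<And>v. v \<in> set f \<Longrightarrow> \<not> E t v"
    and K: "conn E K" "t \<in> K" "\<And>k. k \<in> K \<Longrightarrow> k \<noteq> t \<Longrightarrow> \<not> E k d \<and> \<not> E k d'"
    and touch: "k \<in> K" "v \<in> set f" "E k v"
  shows False
proof -
  define P where "P w \<longleftrightarrow> (\<exists>v\<in>set f. E w v)" for w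
  have nf: "d \<notin> set f" "d' \<notin> set f" "d \<noteq> d'" using tf tri by auto
  have nt: "\<not> P t" using tf by (auto simp: P_def)
  have Pf: "P w" if "w \<in> set f" for w using ipath_neighbour[OF f that] by (auto simp: P_def)
  have "P k" using touch by (auto simp: P_def)
  then obtain g where g: "ipath E g" "set g \<subseteq> K" "hd g = t" "P (last g)"
    and gP: "\<And>w. w \<in> set g \<Longrightarrow> P w \<Longrightarrow> w = last g"
    using shortest_path[OF K(1,2), of "\<lambda>w. w = t" k P] touch by metis
  have gt: "last g \<noteq> t" using g(4) nt by auto
  then obtain g0 y0 where gs: "g = g0 @ [y0]" "g0 \<noteq> []"
    using g(1,3) by (metis append_butlast_last_id append_Nil ipath_ne list.sel(1) last.simps)
  \<comment> \<open>Every vertex of \<open>f\<close> has a neighbour in \<open>f\<close>. So a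
    vertex of \<open>g\<close> on \<open>f\<close> could only be the last one, and its predecessor
    would then already touch \<open>f\<close>.\<close>
  have disj: "w \<notin> set f" if "w \<in> set g" for w
  proof
    assume "w \<in> set f"
    then have w: "w = y0" using gP[OF that Pf] gs by auto
    have "E (last g0) y0" using g(1) gs by (auto simp: ipath_append)
    then have "P (last g0)" using w \<open>w \<in> set f\<close> by (auto simp: P_def)
    then have "last g0 = y0" using gP[of "last g0"] gs by auto
    then show False using \<open>E (last g0) y0\<close> by simp
  qed
  have gf: "\<not> E u v" if "u \<in> set g0" "v \<in> set f" for u v
  proof
    assume "E u v"
    then have "P u" using that by (auto simp: P_def)
    then have "u = y0" using gP[of u] gs that by auto
    then show False using that g(1) gs ipath_distinct by fastforce
  qed
  have y0n: "y0 \<notin> set g0" using ipath_distinct[OF g(1)] gs by auto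
  have hd0: "hd g0 = t" using g(3) gs by auto
  have gV: "set g \<subseteq> V" using g(2) V(4) by auto
  have dg: "E d u \<longleftrightarrow> u = t" "E d' u \<longleftrightarrow> u = t" "u \<noteq> d" "u \<noteq> d'" if "u \<in> set g" for u
  proof -
    have "u \<in> K" using that g(2) by auto
    from K(3)[OF this] show "E d u \<longleftrightarrow> u = t" "E d' u \<longleftrightarrow> u = t" "u \<noteq> d" "u \<noteq> d'"
      using tri sym irrefl by metis+
  qed
  \<comment> \<open>\<open>x\<close> and \<open>y\<close> are the first and the last neighbour of
    \<open>y0\<close> on \<open>f\<close>; \<open>m\<close> is empty if they coincide and is
    \<open>[x]\<close> if they are consecutive.\<close>
  obtain f1 x f2 where s1: "f = f1 @ x # f2" "E y0 x" "\<forall>v\<in>set f1. \<not> E y0 v"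
    using split_list_first_prop[of f "E y0"] g(4) gs by (auto simp: P_def)
  obtain m y f4 where s2: "x # f2 = m @ y # f4" "E y0 y" "\<forall>v\<in>set f4. \<not> E y0 v"
    using split_list_last_prop[of "x # f2" "E y0"] s1 by auto
  have ft: "ipath E (f1 @ [x])" using f(1) s1 by (auto simp: ipath_append ipath_Cons)
  have fb: "ipath E (y # f4)" using f(1) unfolding s1 s2 by (auto simp: ipath_append)
  have hdf: "hd (f1 @ [x]) = hd f" using s1 by (cases f1) auto
  have lf: "last (y # f4) = last f" unfolding s1 s2 by auto
  have sub1: "set (f1 @ [x]) \<subseteq> set f" using s1 by auto
  have sub2: "set (y # f4) \<subseteq> set f" unfolding s1 s2 by auto
  have f1d: "\<forall>v\<in>set f1. v \<noteq> x" using ipath_distinct[OF f(1)] s1 by auto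
  have f4d: "\<forall>v\<in>set f4. v \<noteq> y" using ipath_distinct[OF f(1)] unfolding s1 s2 by auto
  \<comment> \<open>Three holes are used: \<open>d\<close> with \<open>g\<close> and
    \<open>f\<close> up to \<open>x\<close>, \<open>d'\<close> with \<open>g\<close> and
    \<open>f\<close> from \<open>y\<close> on, and \<open>d\<close>, \<open>d'\<close> with the
    whole of \<open>f\<close>.\<close>
  have H1: "ipath E (g @ rev (f1 @ [x]))"
    using g(1) ft disj gf sub1 s1 gs f1d
    by (subst ipath_append) (auto simp del: rev_append simp: hd_rev)
  have "hole E d (g @ rev (f1 @ [x]))"
    unfolding hole_def
  proof (intro conjI ballI)
    show "3 \<le> length (g @ rev (f1 @ [x]))" using gs by (cases g0) auto
    show "d \<notin> set (g @ rev (f1 @ [x]))" using nf sub1 dg by auto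
    fix v assume "v \<in> set (g @ rev (f1 @ [x]))"
    then have "v \<in> set g \<or> v \<in> set (f1 @ [x])" by auto
    moreover have "hd (g @ rev (f1 @ [x])) = t" "last (g @ rev (f1 @ [x])) = hd f"
      using g(1,3) hdf by (auto simp: last_append last_rev hd_append simp del: rev_append)
    moreover have "t \<notin> set f" "hd f \<notin> set g"
      using disj g f(1) by (metis hd_in_set ipath_ne)+
    ultimately show "E d v \<longleftrightarrow> v = hd (g @ rev (f1 @ [x])) \<or> v = last (g @ rev (f1 @ [x]))"
      using dg df sub1 by (metis subsetD)
  qed (rule H1)
  then have par1: "odd (length g + length f1 + 1)"
    using hole_odd[of d] V gV sub1 by fastforce
  have H2: "ipath E (g @ (y # f4))"
    using g(1) fb disj gf sub2 s2 gs f4d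
    by (subst ipath_append) auto
  have "hole E d' (g @ (y # f4))"
    unfolding hole_def
  proof (intro conjI ballI)
    show "3 \<le> length (g @ (y # f4))" using gs by (cases g0) auto
    show "d' \<notin> set (g @ (y # f4))" using nf sub2 dg by auto
    fix v assume "v \<in> set (g @ (y # f4))"
    then have "v \<in> set g \<or> v \<in> set (y # f4)" by auto
    moreover have "hd (g @ (y # f4)) = t" "last (g @ (y # f4)) = last f"
      using g(1,3) lf by (auto simp: hd_append)
    moreover have "t \<notin> set f" "last f \<notin> set g"
      using disj g f(1) by (metis hd_in_set last_in_set ipath_ne)+
    ultimately show "E d' v \<longleftrightarrow> v = hd (g @ (y # f4)) \<or> v = last (g @ (y # f4))"
      using dg df sub2 by (metis subsetD)
  qed (rule H2)
  then have par2: "odd (length g + length f4 + 1)"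
    using hole_odd[of d'] V gV sub2 by fastforce
  have fd': "ipath E (f @ [d'])" using f(1) df nf by (subst ipath_snoc) auto
  have "hole E d (f @ [d'])"
    using fd' f nf df tri by (auto simp: hole_def hd_append)
  then have par3: "odd (length f + 1)"
    using hole_odd[of d] V by fastforce
  show False
  proof (cases m)
    case Nil
    \<comment> \<open>With one neighbour, \<open>length f = length f1 + length f4 + 1\<close> is odd
      by the first two holes and even by the third.\<close>
    then show False using par1 par2 par3 s1 s2 by auto
  next
    case (Cons x' m')
    then have m: "m = x # m'" using s2 by auto
    then have f2: "f2 = m' @ y # f4" using s2 by auto
    show False
    proof (cases "m' = []")
      case True
      have fxy: "f = (f1 @ [x]) @ (y # f4)" using s1 f2 True by simp
      have x1: "ipath E (d # f1 @ [x])" using ft df nf sub1 hdf by (subst ipath_Cons) auto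
      have x2: "ipath E (d' # rev (y # f4))"
        using fb df nf sub2 lf
        by (subst ipath_Cons) (auto simp: ipath_rev hd_rev simp del: rev.simps)
      have cross: "\<forall>u\<in>set (f1 @ [x]). \<forall>v\<in>set (y # f4). u \<noteq> v \<and> (E u v \<longleftrightarrow> u = x \<and> v = y)"
        using f(1) unfolding fxy by (subst (asm) ipath_append) auto
      have "prism E g (d # f1 @ [x]) (d' # rev (y # f4))"
        unfolding prism_def
      proof (intro conjI)
        show "rungs E g (d # f1 @ [x])"
          using dg disj gf sub1 s1 gs hd0 E_commute nf f1d g(3) y0n
          unfolding rungs_def by auto
        show "rungs E g (d' # rev (y # f4))"
          using dg disj gf sub2 s2 gs hd0 E_commute nf f4d g(3) y0n
          unfolding rungs_def by auto
        show "rungs E (d # f1 @ [x]) (d' # rev (y # f4))"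
        proof -
          have "x \<in> set f" "y \<in> set f" using fxy by auto
          moreover have "v \<noteq> hd f" if "v \<in> set (y # f4)" for v
            using cross that hdf by (metis hd_in_set append_is_Nil_conv list.discI)
          moreover have "v \<noteq> last f" if "v \<in> set (f1 @ [x])" for v
            using cross that lf by (metis last_in_set list.discI)
          moreover have "E u d' \<longleftrightarrow> u = last f" if "u \<in> set f" for u
            using df(2)[OF that] E_commute by metis
          ultimately show ?thesis
            using cross df(1) nf tri(3) sub1 sub2
            unfolding rungs_def
            by (auto simp: subset_iff)
        qed
        show "2 \<le> length g" using gs by (cases g0) auto
      qed (use g x1 x2 in auto)
      then show False using no_prism[of g "d # f1 @ [x]" "d' # rev (y # f4)"] V gV sub1 sub2 by fastforce
    next
      case False
      have fxy: "f = (f1 @ [x]) @ m' @ (y # f4)" using s1 f2 by simp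
      have fi: "ipath E ((f1 @ [x]) @ (m' @ (y # f4)))" using f(1) fxy by simp
      have hm: "hd (m' @ (y # f4)) \<in> set m'" using False by simp
      have mf: "v \<notin> set m'" if "v \<in> set (y # f4)" for v
        using ipath_distinct[OF fi] that by auto
      have cross: "\<forall>u\<in>set (f1 @ [x]). \<forall>v\<in>set (y # f4). u \<noteq> v \<and> \<not> E u v"
      proof (intro ballI)
        fix u v assume u: "u \<in> set (f1 @ [x])" and v: "v \<in> set (y # f4)"
        then have "v \<in> set (m' @ (y # f4))" "v \<noteq> hd (m' @ (y # f4))"
          using hm mf by (auto simp del: hd_append2)
        then show "u \<noteq> v \<and> \<not> E u v"
          using fi[unfolded ipath_append[of E "f1 @ [x]"]] u by blast
      qed
      have "ipath E (d' # rev (y # f4))"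
        using fb df nf sub2 lf
        by (subst ipath_Cons) (auto simp: ipath_rev hd_rev simp del: rev.simps)
      moreover have "v \<noteq> hd f" if "v \<in> set (y # f4)" for v
        using cross that hdf by (metis hd_in_set append_is_Nil_conv list.discI)
      ultimately have x2: "ipath E (d # d' # rev (y # f4))"
        using df(1) nf sub2 tri(3) by (subst ipath_Cons) auto
      have nl: "v \<noteq> last f" if "v \<in> set (f1 @ [x])" for v
        using cross that lf by (metis last_in_set list.discI)
      have x3: "ipath E (rev (f1 @ [x]) @ (d # d' # rev (y # f4)))"
      proof (subst ipath_append, intro disjI2 conjI ballI)
        fix u v assume u: "u \<in> set (rev (f1 @ [x]))" and v: "v \<in> set (d # d' # rev (y # f4))"
        have uf: "u \<in> set f" "u \<noteq> last f" using u sub1 nl by auto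
        have la: "last (rev (f1 @ [x])) = hd f" using hdf by (simp add: last_rev del: rev_append)
        show "u \<noteq> v" using uf v nf u cross by auto
        show "E u v \<longleftrightarrow> u = last (rev (f1 @ [x])) \<and> v = hd (d # d' # rev (y # f4))"
          unfolding la using uf v u cross df nf E_commute by auto
      qed (use ft x2 in \<open>auto simp: ipath_rev simp del: rev_append\<close>)
      have y0: "y0 \<in> set g" "y0 \<noteq> t" using gs gt by auto
      \<comment> \<open>Two nonconsecutive neighbours give a further hole through the edge
        \<open>d d'\<close>. It makes \<open>length f1 + length f4\<close> odd, while the first two
        holes make it even.\<close>
      have "hole E y0 (rev (f1 @ [x]) @ (d # d' # rev (y # f4)))"
        unfolding hole_def
      proof (intro conjI ballI)
        show "y0 \<notin> set (rev (f1 @ [x]) @ d # d' # rev (y # f4))"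
          using disj y0 sub1 sub2 dg by auto
        fix v assume "v \<in> set (rev (f1 @ [x]) @ d # d' # rev (y # f4))"
        then show "E y0 v \<longleftrightarrow> v = hd (rev (f1 @ [x]) @ d # d' # rev (y # f4)) \<or>
            v = last (rev (f1 @ [x]) @ d # d' # rev (y # f4))"
          using s1 s2 dg[OF y0(1)] y0(2) E_commute by auto
      qed (use x3 in auto)
      then have "odd (length f1 + length f4 + 4)"
        using hole_odd[of y0] V gV y0 sub1 sub2 by fastforce
      then show False using par1 par2 by presburger
    qed
  qed
qed

end

section \<open>Intervals of lists and noncut vertices\<close>

definition sublist :: "'a list \<Rightarrow> nat \<Rightarrow> nat \<Rightarrow> 'a list" where
  "sublist l i j = take (Suc j - i) (drop i l)"

lemma sublist_simps:
  assumes "i \<le> j" "j < length l"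
  shows "length (sublist l i j) = Suc j - i" "hd (sublist l i j) = l ! i"
    "last (sublist l i j) = l ! j" "sublist l i j \<noteq> []" "set (sublist l i j) = {l ! k |k. i \<le> k \<and> k \<le> j}"
    "set (sublist l i j) \<subseteq> set l"
proof -
  show len: "length (sublist l i j) = Suc j - i" using assms by (auto simp: sublist_def)
  show ne: "sublist l i j \<noteq> []" using assms len by (metis Suc_diff_le Zero_not_Suc list.size(3))
  have nth: "sublist l i j ! k = l ! (i + k)" if "k < Suc j - i" for k
    using assms that by (auto simp: sublist_def)
  show "hd (sublist l i j) = l ! i" using nth[of 0] ne assms by (simp add: hd_conv_nth)
  show "last (sublist l i j) = l ! j" using nth[of "j - i"] ne assms len by (simp add: last_conv_nth Suc_diff_le)
  show "set (sublist l i j) = {l ! k |k. i \<le> k \<and> k \<le> j}"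
  proof (intro set_eqI iffI)
    fix x assume "x \<in> set (sublist l i j)"
    then obtain k where "k < Suc j - i" "x = sublist l i j ! k" using len by (metis in_set_conv_nth)
    then show "x \<in> {l ! k |k. i \<le> k \<and> k \<le> j}" using nth by (intro CollectI exI[of _ "i + k"]) auto
  next
    fix x assume "x \<in> {l ! k |k. i \<le> k \<and> k \<le> j}"
    then obtain k where k: "x = l ! k" "i \<le> k" "k \<le> j" by auto
    then have "x = sublist l i j ! (k - i)" "k - i < length (sublist l i j)" using nth[of "k - i"] len by auto
    then show "x \<in> set (sublist l i j)" by simp
  qed
  then show "set (sublist l i j) \<subseteq> set l" using assms by auto
qed

context ugraph
begin

lemma ipath_sublist:
  assumes "ipath R l" "i \<le> j" "j < length l"
  shows "ipath R (sublist l i j)"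
proof -
  have "l = take i l @ sublist l i j @ drop (Suc j - i) (drop i l)"
    by (simp add: sublist_def del: drop_drop)
  then show ?thesis
    using assms(1) sublist_simps(4)[OF assms(2,3)] by (metis ipath_appendD1 ipath_appendD2 append_is_Nil_conv)
qed

lemma ipath_nth:
  assumes "ipath E l" "i < length l" "j < length l"
  shows "E (l ! i) (l ! j) \<longleftrightarrow> j = Suc i \<or> i = Suc j"
  using assms
proof (induction l arbitrary: i j)
  case (Cons x l)
  show ?case
  proof (cases "l = []")
    case False
    then have l: "ipath E l" "x \<notin> set l" "\<forall>v\<in>set l. E x v \<longleftrightarrow> v = hd l" and d: "distinct l"
      using Cons.prems(1) ipath_distinct[of E l] by (auto simp: ipath_Cons)
    have x: "E x (l ! k) \<longleftrightarrow> k = 0" if "k < length l" for k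
      using l that d False by (auto simp: hd_conv_nth nth_eq_iff_index_eq)
    show ?thesis
      using Cons.IH[OF l(1)] x Cons.prems(2,3) E_commute[of _ x]
      by (cases i; cases j) auto
  qed (use Cons in auto)
qed simp

text \<open>Two vertices at maximum distance are not cut vertices: if \<open>a\<close> separated
  some \<open>v\<close> from \<open>b\<close>, then a shortest path from \<open>v\<close> to
  \<open>b\<close> would pass through \<open>a\<close>, and \<open>v\<close> would be farther from
  \<open>b\<close> than \<open>a\<close> is. For \<open>co E\<close> this finds vertices whose
  removal keeps a set co-connected.\<close>

lemma two_noncut_vertices:
  assumes "finite T" "conn E T" "x0 \<in> T" "y0 \<in> T" "x0 \<noteq> y0" "\<not> E x0 y0"
  obtains x y where "x \<in> T" "y \<in> T" "x \<noteq> y" "\<not> E x y" "conn E (T - {x})" "conn E (T - {y})"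
proof -
  define path where "path u v p \<longleftrightarrow> ipath E p \<and> set p \<subseteq> T \<and> hd p = u \<and> last p = v" for u v p
  \<comment> \<open>\<open>dst\<close> counts vertices, so a value of at least 3 means distinct and
    nonadjacent.\<close>
  define dst where "dst u v = (LEAST n. \<exists>p. path u v p \<and> length p = n)" for u v
  have ex: "\<exists>p. path u v p \<and> length p = dst u v" if "u \<in> T" "v \<in> T" for u v
  proof -
    have "\<exists>n p. path u v p \<and> length p = n"
      using walk_ipath[OF connD[OF assms(2) that] that(1)] by (auto simp: path_def)
    then show ?thesis unfolding dst_def by (rule LeastI_ex)
  qed
  have le: "dst u v \<le> length p" if "path u v p" for u v p
    unfolding dst_def by (rule Least_le) (use that in auto)
  have comm: "path u v p \<Longrightarrow> path v u (rev p)" for u v p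
    by (auto simp: path_def hd_rev last_rev)
  have dle: "dst v u \<le> dst u v" if uv: "u \<in> T" "v \<in> T" for u v
  proof -
    obtain p where "path u v p" "length p = dst u v" using ex[OF uv] by blast
    then show ?thesis using le[OF comm, of u v p] by simp
  qed
  have dcomm: "dst u v = dst v u" if "u \<in> T" "v \<in> T" for u v
    using dle that by (simp add: antisym)
  obtain xy where xy: "xy \<in> T \<times> T" "\<forall>z\<in>T \<times> T. dst (fst z) (snd z) \<le> dst (fst xy) (snd xy)"
  proof -
    let ?f = "\<lambda>z. dst (fst z) (snd z)"
    have fin: "finite (?f ` (T \<times> T))" "?f ` (T \<times> T) \<noteq> {}" using assms by auto
    from Max_in[OF this] obtain z where "z \<in> T \<times> T" "?f z = Max (?f ` (T \<times> T))" by auto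
    then show thesis using that[of z] Max_ge[OF fin(1)] by auto
  qed
  obtain x y where x: "xy = (x, y)" by (cases xy)
  have xT: "x \<in> T" "y \<in> T" and max: "\<And>u v. u \<in> T \<Longrightarrow> v \<in> T \<Longrightarrow> dst u v \<le> dst x y"
    using xy x by auto
  obtain p0 where p0: "path x0 y0 p0" "length p0 = dst x0 y0" using ex assms by blast
  have "3 \<le> length p0"
  proof (rule ccontr)
    assume "\<not> 3 \<le> length p0"
    then consider "p0 = []" | u where "p0 = [u]" | u v where "p0 = [u, v]"
      by (cases p0 rule: remdups_adj.cases) (auto simp: not_less_eq_eq)
    then show False using p0(1) assms by cases (auto simp: path_def)
  qed
  then have d3: "3 \<le> dst x y" using max[OF assms(3,4)] p0 by simp
  have ne: "x \<noteq> y" using d3 le[of x y "[x]"] xT by (auto simp: path_def)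
  have nE: "\<not> E x y" using d3 le[of x y "[x, y]"] xT ne by (auto simp: path_def)
  have cut: "conn E (T - {a})" if a: "a \<in> T" "b \<in> T" "a \<noteq> b" "dst a b = dst x y" for a b
  proof (rule connI_root[where r = b])
    fix v assume v: "v \<in> T - {a}"
    obtain p where p: "path v b p" "length p = dst v b" using ex v a by blast
    have "a \<notin> set p"
    proof
      assume "a \<in> set p"
      then obtain xs ys where s: "p = xs @ a # ys" by (meson split_list)
      have "xs \<noteq> []" using v p s by (auto simp: path_def)
      have "path a b (a # ys)" using p s by (auto simp: path_def ipath_append split: if_splits)
      then have "dst a b < length p" using le[of a b "a # ys"] s \<open>xs \<noteq> []\<close> by (cases xs) auto
      then show False using max[of v b] p a v by auto
    qed
    then have "set p \<subseteq> T - {a}" "v \<in> set p" "b \<in> set p" "conn E (set p)"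
      using p conn_path by (auto simp: path_def)
    then show "(\<lambda>u w. E u w \<and> u \<in> T - {a} \<and> w \<in> T - {a})\<^sup>*\<^sup>* v b"
      using walk_mono[OF connD] by blast
  qed
  show thesis
    by (rule that[OF xT ne nE cut[OF xT ne refl] cut[OF xT(2,1) ne[symmetric] dcomm[OF xT(2,1)]]])
qed

end

context artemis_graph
begin

text \<open>With \<open>x\<close> in place of the end adjacent to \<open>hd f\<close>, the vertex \<open>y\<close> becomes a hat.\<close>

lemma leap_connected:
  assumes f: "ipath E f" "2 \<le> length f" "set f \<subseteq> V" "d' \<in> V" "K \<subseteq> V" "x \<in> V"
    and d'f: "\<And>v. v \<in> set f \<Longrightarrow> E d' v \<longleftrightarrow> v = last f"
    and xy: "\<not> E x y" "E x d'" "E y d'"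
      "\<And>v. v \<in> set f \<Longrightarrow> E x v \<longleftrightarrow> v = hd f" "\<And>v. v \<in> set f \<Longrightarrow> E y v \<longleftrightarrow> v = last f"
    and K: "conn E K" "y \<in> K" "\<And>k. k \<in> K \<Longrightarrow> k \<noteq> y \<Longrightarrow> \<not> E k d' \<and> \<not> E k (last f)"
    and touch: "k \<in> K" "v \<in> insert x (set (butlast f))" "E k v"
  shows False
proof -
  obtain f0 e where s: "f = f0 @ [e]" "f0 \<noteq> []"
    using f(2) by (cases f rule: rev_cases) (auto, fastforce)
  have i0: "ipath E f0" "e \<notin> set f0" "\<forall>v\<in>set f0. E e v \<longleftrightarrow> v = last f0"
    using f(1) s by (auto simp: ipath_snoc)
  have xf: "x \<notin> set f" using xy(1,2,5) d'f sym s by (metis last_snoc last_in_set snoc_eq_iff_butlast)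
  have hd: "hd f = hd f0" "last f = e" using s by auto
  \<comment> \<open>The hat is \<open>y\<close> over the edge \<open>d' e\<close> with the path
    \<open>x # f0\<close>: \<open>d'\<close> meets this path only in \<open>x\<close>, and
    \<open>e\<close> only in \<open>last f0\<close>.\<close>
  have "ipath E (x # f0)"
    using i0(1) xf xy(4) s hd by (subst ipath_Cons) auto
  moreover have "\<not> E e x" using xy(4)[of e] s hd i0(2) sym by (metis hd_in_set in_set_conv_decomp)
  moreover have "E d' v \<longleftrightarrow> v = x" if "v \<in> set (x # f0)" for v
    using that d'f[of v] xy(2) sym xf s hd i0 by auto
  moreover have "\<not> E y v" if "v \<in> set (x # f0)" for v
    using that xy(5)[of v] xy(1) sym s hd i0(2) by auto
  moreover have "E y d'" "E y e" "E d' e" using xy d'f s hd by auto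
  moreover have "E e v \<longleftrightarrow> v = last (x # f0)" if "v \<in> set (x # f0)" for v
    using that i0(3) \<open>\<not> E e x\<close> s(2) xf s(1) by auto
  moreover have "2 \<le> length (x # f0)" using s(2) by (cases f0) auto
  moreover have "v \<in> set (x # f0)" using touch(2) s by auto
  ultimately show False
    using hat_connected[of y d' e "x # f0" K k v] f(3-6) K touch(1,3) s(1) hd(2)
    by simp
qed

text \<open>A shortest antipath in \<open>T\<close> from a non-neighbour of \<open>p\<close> to a
  non-neighbour of \<open>q\<close> has at least two vertices, as no vertex of \<open>T\<close>
  misses both. Extended by \<open>p\<close> and \<open>q\<close> it is closed by \<open>w\<close> to
  an antihole with at least 5 vertices.\<close>

lemma antipath_bridge:
  assumes T: "conn (co E) T" "T \<subseteq> V" "t0 \<in> T" "\<not> E t0 p" "t1 \<in> T" "\<not> E t1 q"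
    and pq: "p \<in> V" "q \<in> V" "p \<notin> T" "q \<notin> T" "E p q" "\<And>t. t \<in> T \<Longrightarrow> E t p \<or> E t q"
    and w: "w \<in> V" "\<And>t. t \<in> T \<Longrightarrow> E w t" "\<not> E w p" "\<not> E w q"
  shows False
proof -
  interpret co: ugraph "co E" by (rule ugraph_co)
  obtain g where g: "ipath (co E) g" "set g \<subseteq> T" "\<not> E (hd g) p" "\<not> E (last g) q"
      "\<And>t. t \<in> set g \<Longrightarrow> \<not> E t p \<Longrightarrow> t = hd g" "\<And>t. t \<in> set g \<Longrightarrow> \<not> E t q \<Longrightarrow> t = last g"
    using co.shortest_path[OF T(1,3), of "\<lambda>t. \<not> E t p" t1 "\<lambda>t. \<not> E t q"] T by blast
  have gn: "g \<noteq> []" "hd g \<in> set g" "last g \<in> set g" using g(1) by auto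
  have len: "2 \<le> length g"
  proof (rule ccontr)
    assume "\<not> 2 \<le> length g"
    then have "length g = 1" using gn(1) by (cases g) (auto simp: not_less_eq_eq)
    then obtain z where "g = [z]" by (auto simp: length_Suc_conv)
    then show False using g pq(6)[of z] by auto
  qed
  have gq: "co E q v \<longleftrightarrow> v = last g" if "v \<in> set g" for v
    using g(4) g(6)[OF that] that g(2) pq(4) E_commute[of q v] unfolding co_def by blast
  have gp: "co E p v \<longleftrightarrow> v = hd g" if "v \<in> set g" for v
    using g(3) g(5)[OF that] that g(2) pq(3) E_commute[of p v] unfolding co_def by blast
  have qg: "p \<notin> set g" "q \<notin> set g" "p \<noteq> q" "\<not> co E p q"
    using g(2) pq irrefl by (auto simp: co_def)
  have "ipath (co E) (g @ [q])"
    using g(1) gq qg by (subst co.ipath_snoc) simp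
  then have "ipath (co E) (p # g @ [q])"
    using gp qg gn by (subst co.ipath_Cons) auto
  moreover have "w \<noteq> p" "w \<noteq> q" using w(3,4) pq(5) E_commute[of p q] by auto
  moreover have "w \<notin> set (p # g @ [q])" using calculation(2,3) w(2)[of w] g(2) by auto
  moreover have "co E w v \<longleftrightarrow> v = p \<or> v = q" if "v \<in> set (p # g @ [q])" for v
    using that calculation(2,3) w g(2) pq(3,4) by (auto simp: co_def)
  ultimately have "hole (co E) w (p # g @ [q])"
    using len by (simp add: hole_def)
  then show False
    using antihole_short[of w "p # g @ [q]"] len g(2) T(2) pq w by auto
qed

end

lemma sublist_append: "j < length xs \<Longrightarrow> i \<le> j \<Longrightarrow> sublist (xs @ ys) i j = sublist xs i j"
  by (simp add: sublist_def)

context artemis_graph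
begin

section \<open>The Roussel--Rubio lemma\<close>

text \<open>The configuration shared by odd paths and by holes cut open at an edge: \<open>d # f @ [d']\<close> is an
  induced path except that \<open>d\<close> and \<open>d'\<close> may be adjacent.\<close>

definition near_path :: "'a \<Rightarrow> 'a list \<Rightarrow> 'a \<Rightarrow> bool" where
  "near_path d f d' \<longleftrightarrow> ipath E (d # f) \<and> ipath E (f @ [d']) \<and> d \<noteq> d' \<and>
     f \<noteq> [] \<and> even (length f) \<and> d \<in> V \<and> d' \<in> V \<and> set f \<subseteq> V"

text \<open>The exceptional outcome of the Roussel--Rubio lemma. Where it occurs, both vertices are
  moreover adjacent to the ends \<open>d\<close> and \<open>d'\<close>.\<close>

definition leap :: "'a set \<Rightarrow> 'a list \<Rightarrow> bool" where
  "leap T f \<longleftrightarrow> (\<exists>x\<in>T. \<exists>y\<in>T. x \<noteq> y \<and> \<not> E x y \<and>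
     (\<forall>v\<in>set f. E x v \<longleftrightarrow> v = hd f) \<and> (\<forall>v\<in>set f. E y v \<longleftrightarrow> v = last f))"

lemma near_pathD:
  assumes "near_path d f d'"
  shows "ipath E f" "d \<notin> set f" "d' \<notin> set f" "2 \<le> length f"
    "\<And>v. v \<in> set f \<Longrightarrow> E d v \<longleftrightarrow> v = hd f" "\<And>v. v \<in> set f \<Longrightarrow> E d' v \<longleftrightarrow> v = last f"
    "hd f \<noteq> last f"
proof -
  have f: "f \<noteq> []" "even (length f)" using assms by (auto simp: near_path_def)
  then show l: "2 \<le> length f" by (cases f; cases "tl f") auto
  show i: "ipath E f" "d \<notin> set f" "d' \<notin> set f"
    using assms f by (auto simp: near_path_def ipath_Cons ipath_snoc)
  show "E d v \<longleftrightarrow> v = hd f" "E d' v \<longleftrightarrow> v = last f" if "v \<in> set f" for v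
    using assms f that by (auto simp: near_path_def ipath_Cons ipath_snoc)
  show "hd f \<noteq> last f"
    using l ipath_distinct[OF i(1)] f(1) by (cases f) auto
qed

text \<open>Between two successive positions seen by the stable set \<open>B\<close>: a common
  neighbour of the two ends closes the interval to a hole, which gives the parity. Otherwise
  different vertices \<open>x\<close> and \<open>y\<close> see the ends, and the interval, extended
  by both, is closed by \<open>d\<close> or \<open>d'\<close>, unless it is all of \<open>f\<close>.
  In that last case there is a prism or a leap.\<close>

lemma near_path_interval:
  assumes np: "near_path d f d'" and v_def: "v = (\<lambda>i. (d # f @ [d']) ! i)"
    and n_def: "n = length f + 1"
    and B: "B \<subseteq> V" "\<And>x y. x \<in> B \<Longrightarrow> y \<in> B \<Longrightarrow> x \<noteq> y \<Longrightarrow> \<not> E x y"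
      "\<And>t. t \<in> B \<Longrightarrow> E t d \<and> E t d' \<and> t \<notin> set f \<and> (\<exists>u\<in>set f. E t u)"
    and no_leap: "E d d' \<Longrightarrow> \<not> leap B f"
    and ij: "i < j" "j \<le> n" "x \<in> B" "E x (v i)" "y \<in> B" "E y (v j)"
      "\<And>k t. i < k \<Longrightarrow> k < j \<Longrightarrow> t \<in> B \<Longrightarrow> \<not> E t (v k)"
  shows "even (j - i) \<or> j = Suc i \<and> (\<exists>t\<in>B. E t (v i) \<and> E t (v j))"
proof -
  let ?l = "d # f @ [d']"
  note nd = near_pathD[OF np]
  have fV: "d \<in> V" "d' \<in> V" "set f \<subseteq> V" "d \<noteq> d'" "even (length f)"
    "ipath E (d # f)" "ipath E (f @ [d'])"
    using np by (auto simp: near_path_def)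
  have fne: "f \<noteq> []" "0 < length f" using nd(4) by auto
  define p where "p = sublist ?l i j"
  have jl: "j < length ?l" using ij n_def by auto
  note ps = sublist_simps[OF less_imp_le[OF ij(1)] jl, folded p_def]
  have v0: "v 0 = d" "v n = d'" by (auto simp: v_def n_def nth_append)
  have vf: "v k \<in> set f" "v k = f ! (k - 1)" if "0 < k" "k < n" for k
    using that by (auto simp: v_def n_def nth_append nth_Cons')
  have vhd: "v 1 = hd f" "v (n - 1) = last f"
    using nd(4) by (auto simp: v_def n_def nth_append hd_conv_nth last_conv_nth nth_Cons')
  have pV: "set p \<subseteq> V" using ps(6) fV by auto
  have Bp: "t \<notin> set p" if "t \<in> B" for t
    using ps(6) B(3)[OF that] irrefl by auto
  have pk: "\<exists>k. u = v k \<and> i \<le> k \<and> k \<le> j" if "u \<in> set p" for u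
    using that ps(5) by (auto simp: v_def)
  have pin: "u = v i \<or> u = v j \<or> (\<forall>t\<in>B. \<not> E t u)" if "u \<in> set p" for u
    using pk[OF that] ij(7) by (metis le_neq_implies_less)
  have hl: "hd p = v i" "last p = v j" using ps by (auto simp: v_def)
  have pip: "ipath E p" if "i \<noteq> 0 \<or> j \<noteq> n"
  proof (cases "j = n")
    case False
    then have "p = sublist (d # f) i j"
      using ij(2) ij(1) sublist_append[of j "d # f" i "[d']"] by (auto simp: p_def n_def)
    then show ?thesis using ipath_sublist[OF fV(6), of i j] False ij n_def by auto
  next
    case True
    then have "p = sublist (f @ [d']) (i - 1) (j - 1)"
      using that ij(1) by (cases i; cases j) (auto simp: p_def sublist_def n_def)
    then show ?thesis using ipath_sublist[OF fV(7), of "i - 1" "j - 1"] that True ij n_def by auto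
  qed
  show ?thesis
  proof (cases "\<exists>t\<in>B. E t (v i) \<and> E t (v j)")
    case True
    then obtain t where t: "t \<in> B" "E t (v i)" "E t (v j)" by auto
    show ?thesis
    proof (cases "j = Suc i")
      case False
      \<comment> \<open>As \<open>t\<close> has a neighbour in \<open>f\<close>, the interval is not
        the whole list. This is what makes \<open>p\<close> an induced path even when
        \<open>d\<close> and \<open>d'\<close> are adjacent.\<close>
      have "i \<noteq> 0 \<or> j \<noteq> n"
      proof (rule ccontr)
        assume "\<not> (i \<noteq> 0 \<or> j \<noteq> n)"
        moreover obtain u where "u \<in> set f" "E t u" using B(3)[OF t(1)] by auto
        moreover obtain k where "k < length f" "u = f ! k" using \<open>u \<in> set f\<close> by (metis in_set_conv_nth)
        moreover have "v (Suc k) = f ! k" using \<open>k < length f\<close> by (auto simp: v_def nth_append)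
        ultimately show False using ij(7)[of "Suc k" t] t n_def by auto
      qed
      note pip[OF this]
      moreover have "3 \<le> length p" using ps(1) False ij(1) by auto
      moreover have "E t u \<longleftrightarrow> u = hd p \<or> u = last p" if "u \<in> set p" for u
        using pin[OF that] t hl by auto
      ultimately have "hole E t p" using Bp[OF t(1)] by (auto simp: hole_def)
      then have "odd (length p)" using hole_odd[of t p] t(1) B(1) pV by auto
      then show ?thesis using ps(1) ij(1) by auto
    qed (use True in auto)
  next
    case False
    have xy: "\<not> E x (v j)" "\<not> E y (v i)" using False ij by auto
    have i0: "i \<noteq> 0" using xy(2) v0 B(3)[OF ij(5)] by metis
    have jn: "j \<noteq> n" using xy(1) v0 B(3)[OF ij(3)] by metis
    have xny: "x \<noteq> y" using xy ij by auto
    then have nE: "\<not> E x y" using B(2) ij by auto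
    have pi: "ipath E p" using pip i0 by auto
    have pf: "u \<in> set f" if uu: "u \<in> set p" for u
    proof -
      obtain k where "u = v k" "i \<le> k" "k \<le> j" using pk[OF uu] by blast
      then show ?thesis using vf(1)[of k] i0 jn ij(2) by simp
    qed
    have xp: "E x u \<longleftrightarrow> u = hd p" if "u \<in> set p" for u
      using pin[OF that] xy ij(3,4) hl by metis
    have yp: "E y u \<longleftrightarrow> u = last p" if "u \<in> set p" for u
      using pin[OF that] xy ij(5,6) hl by metis
    have "ipath E (p @ [y])" using pi yp Bp[OF ij(5)] by (subst ipath_snoc) auto
    moreover have xpy_hd: "hd p \<in> set p" "y \<noteq> hd p" using ps(4) ij(1) Bp[OF ij(5)] by auto
    ultimately have xpy: "ipath E (x # p @ [y])"
      using xp nE xny Bp[OF ij(3)] ps(4) ij(1) xpy_hd by (subst ipath_Cons) auto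
    \<comment> \<open>An end of the list without neighbours in \<open>p\<close> is adjacent to
      \<open>x\<close> and \<open>y\<close> and closes \<open>x # p @ [y]\<close> to a hole.\<close>
    have ends: "odd (length p)" if w: "w \<in> {d, d'}" "\<And>u. u \<in> set p \<Longrightarrow> \<not> E w u" for w
    proof -
      have "E x w" "E y w" using w(1) B(3)[OF ij(3)] B(3)[OF ij(5)] by auto
      then have "E w x" "E w y" using sym by auto
      moreover have "w \<noteq> x" "w \<noteq> y" using \<open>E w x\<close> \<open>E w y\<close> irrefl by blast+
      moreover have "w \<notin> set p" using w(1) pf nd(2,3) by auto
      ultimately have "hole E w (x # p @ [y])"
        using xpy w(2) ps(4) Bp ij(3,5) by (auto simp: hole_def Suc_le_eq)
      then show ?thesis using hole_odd[of w "x # p @ [y]"] w(1) fV pV B(1) ij by auto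
    qed
    consider (d') "j \<noteq> n - 1" | (d) "i \<noteq> 1" | (both) "j = n - 1" "i = 1" by auto
    then show ?thesis
    proof cases
      case d'
      have "\<not> E d' u" if uu: "u \<in> set p" for u
      proof
        assume "E d' u"
        then have u: "u = v (n - 1)" using nd(6)[OF pf[OF uu]] vhd by auto
        obtain k where k: "u = v k" "i \<le> k" "k \<le> j" using pk[OF uu] by auto
        then have "f ! (k - 1) = f ! (n - 1 - 1)" "0 < k" "k < n - 1"
          using u vf(2)[of k] vf(2)[of "n - 1"] i0 jn d' ij(1,2) n_def nd(4) fne by auto
        then show False using ipath_distinct[OF nd(1)] n_def by (auto simp: nth_eq_iff_index_eq)
      qed
      then show ?thesis using ends[of d'] ps(1) ij(1) by auto
    next
      case d
      have "\<not> E d u" if uu: "u \<in> set p" for u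
      proof
        assume "E d u"
        then have u: "u = v 1" using nd(5)[OF pf[OF uu]] vhd by auto
        obtain k where k: "u = v k" "i \<le> k" "k \<le> j" using pk[OF uu] by auto
        then have "f ! (k - 1) = f ! 0" "1 < k" "k < n"
          using u vf(2)[of k] vf(2)[of 1] i0 jn d ij(1,2) n_def nd(4) fne by auto
        moreover from this have "k - 1 < length f" using n_def by linarith
        ultimately show False using ipath_distinct[OF nd(1)] fne nth_eq_iff_index_eq[of f "k - 1" 0] by simp
      qed
      then show ?thesis using ends[of d] ps(1) ij(1) by auto
    next
      case both
      have "p = f" using both nd(4) by (auto simp: p_def sublist_def n_def)
      have xd: "E x d" "E x d'" "E y d" "E y d'" using B(3) ij by auto
      \<comment> \<open>Now \<open>p\<close> is all of \<open>f\<close>. Without the edge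
        \<open>d d'\<close> the legs \<open>[x, d']\<close>, \<open>[d, y]\<close>, \<open>f\<close>
        form a prism; with it \<open>x\<close> and \<open>y\<close> are a leap.\<close>
      have "E d d'"
      proof (rule ccontr)
        assume nd': "\<not> E d d'"
        have "prism E [x, d'] [d, y] f"
          using xd xp yp nd \<open>p = f\<close> nd' fV(4) nE xny Bp ij(3,5) sym irrefl
          unfolding prism_def rungs_def by auto
        then show False using no_prism[of "[x, d']" "[d, y]" f] fV ij B(1) by auto
      qed
      moreover have "leap B f" using xp yp \<open>p = f\<close> nE xny ij unfolding leap_def by metis
      ultimately show ?thesis using no_leap by simp
    qed
  qed
qed

text \<open>The vertices with a neighbour in a nonempty \<open>B \<subseteq> T\<close> cut the path into intervals, and an odd one is
  a single edge with a common neighbour in \<open>B\<close>.  So the number of edges having a common neighbour in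
  \<open>B\<close> is odd, for every \<open>B\<close>; by inclusion--exclusion modulo 2 so is the number of edges that are
  complete to \<open>T\<close>.\<close>

lemma near_path_stable:
  assumes np: "near_path d f d'" and T: "T \<subseteq> V" "T \<noteq> {}"
    "\<And>x y. x \<in> T \<Longrightarrow> y \<in> T \<Longrightarrow> x \<noteq> y \<Longrightarrow> \<not> E x y"
      "\<And>t. t \<in> T \<Longrightarrow> E t d \<and> E t d' \<and> t \<notin> set f \<and> (\<exists>u\<in>set f. E t u)"
    and no_leap: "E d d' \<Longrightarrow> \<not> leap T f"
  shows "\<exists>u\<in>set f. \<forall>t\<in>T. E t u"
proof -
  define v where "v = (\<lambda>i. (d # f @ [d']) ! i)"
  define n where "n = length f + 1"
  define com where "com i t \<longleftrightarrow> E t (v i) \<and> E t (v (Suc i))" for i t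
  \<comment> \<open>Two parameters allow an induction that moves vertices into \<open>A\<close> one
    at a time: it starts from \<open>cnt {} B\<close>, where the intervals are counted, and ends at
    \<open>cnt T T\<close>, the edges complete to \<open>T\<close>.\<close>
  define cnt where "cnt A B = {i. i < n \<and> (\<forall>t\<in>A. com i t) \<and> (\<exists>t\<in>B. com i t)}" for A B
  note nd = near_pathD[OF np]
  have fin: "finite (cnt A B)" for A B unfolding cnt_def by auto
  have base: "even (card (cnt {} B)) \<longleftrightarrow> even n" if B: "B \<subseteq> T" "B \<noteq> {}" for B
  proof -
    have v0: "v 0 = d" "v n = d'" by (auto simp: v_def n_def nth_append)
    have noleapB: "\<not> leap B f" if "E d d'" using no_leap[OF that] B unfolding leap_def by blast
    define marked where "marked i \<longleftrightarrow> (\<exists>t\<in>B. E t (v i))" for i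
    define c where "c j = {i. i < j \<and> (\<exists>t\<in>B. com i t)}" for j
    have "j \<le> n \<Longrightarrow> marked j \<Longrightarrow> even (card (c j)) \<longleftrightarrow> even j" for j
    proof (induction j rule: less_induct)
      case (less j)
      show ?case
      proof (cases "j = 0")
        case False
        have m0: "marked 0" using B T(4) v0 by (auto simp: marked_def)
        define i where "i = Max {i. i < j \<and> marked i}"
        have fin: "finite {i. i < j \<and> marked i}" "{i. i < j \<and> marked i} \<noteq> {}" using m0 False by auto
        have i: "i < j" "marked i" using Max_in[OF fin] by (auto simp: i_def)
        have btw: "\<not> marked k" if "i < k" "k < j" for k
        proof
          assume "marked k"
          then have "k \<le> i" unfolding i_def using that by (intro Max_ge[OF fin(1)]) simp
          then show False using that by simp
        qed
        obtain x y where xy: "x \<in> B" "E x (v i)" "y \<in> B" "E y (v j)"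
          using i less.prems by (auto simp: marked_def)
        have int: "even (j - i) \<or> j = Suc i \<and> (\<exists>t\<in>B. E t (v i) \<and> E t (v j))"
        proof (rule near_path_interval[OF np v_def n_def, of B i j x y])
          show "B \<subseteq> V" using B T by auto
          show "\<And>x y. x \<in> B \<Longrightarrow> y \<in> B \<Longrightarrow> x \<noteq> y \<Longrightarrow> \<not> E x y" using T(3) B by blast
          show "\<And>t. t \<in> B \<Longrightarrow> E t d \<and> E t d' \<and> t \<notin> set f \<and> (\<exists>u\<in>set f. E t u)" using T(4) B by blast
          show "\<And>k t. i < k \<Longrightarrow> k < j \<Longrightarrow> t \<in> B \<Longrightarrow> \<not> E t (v k)" using btw by (auto simp: marked_def)
        qed (use xy i less.prems noleapB in auto)
        have cm: "com k t \<Longrightarrow> t \<in> B \<Longrightarrow> marked k \<and> marked (Suc k)" for k t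
          by (auto simp: com_def marked_def)
        \<comment> \<open>From one marked position to the next the count grows by one edge exactly
          when their distance is odd.\<close>
        have cj: "c j = c i \<union> (if j = Suc i \<and> (\<exists>t\<in>B. com i t) then {i} else {})"
        proof (intro set_eqI iffI)
          fix k assume "k \<in> c j"
          then obtain t where k: "k < j" "t \<in> B" "com k t" by (auto simp: c_def)
          then have "marked k" "marked (Suc k)" using cm by auto
          then have "k \<le> i" "Suc k \<le> i \<or> Suc k = j" using btw k(1) by (meson not_less Suc_leI le_neq_implies_less)+
          then have "k < i \<or> k = i \<and> j = Suc i" by linarith
          then show "k \<in> c i \<union> (if j = Suc i \<and> (\<exists>t\<in>B. com i t) then {i} else {})"
            using k i by (auto simp: c_def)
        qed (use i in \<open>auto simp: c_def split: if_splits\<close>)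
        have IH: "even (card (c i)) \<longleftrightarrow> even i" using less.IH i less.prems by auto
        have "finite (c i)" "i \<notin> c i" by (auto simp: c_def)
        then show ?thesis
          using int IH i(1) unfolding cj by (auto simp: com_def)
      qed (auto simp: c_def)
    qed
    moreover have "marked n" using B T(4) v0 by (auto simp: marked_def)
    moreover have "cnt {} B = c n" by (auto simp: cnt_def c_def)
    ultimately show ?thesis by simp
  qed
  have par: "even (card (cnt A B)) \<longleftrightarrow> even n" if "finite A" "A \<subseteq> T" "B \<subseteq> T" "B \<noteq> {}" for A B
    using that
  proof (induction A arbitrary: B rule: finite_induct)
    case empty
    then show ?case using base by simp
  next
    case (insert a A)
    have "cnt A (insert a B) = cnt A B \<union> cnt A {a}" "cnt (insert a A) B = cnt A B \<inter> cnt A {a}"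
      by (auto simp: cnt_def)
    then have "card (cnt A (insert a B)) + card (cnt (insert a A) B) = card (cnt A B) + card (cnt A {a})"
      using card_Un_Int[OF fin fin] by metis
    moreover have "even (card (cnt A (insert a B))) \<longleftrightarrow> even n" "even (card (cnt A B)) \<longleftrightarrow> even n"
        "even (card (cnt A {a})) \<longleftrightarrow> even n"
      using insert by auto
    ultimately show ?case by presburger
  qed
  have "odd n" using np by (auto simp: n_def near_path_def)
  then have "odd (card (cnt T T))"
    using par[of T T] T finite_subset[OF _ finite_V] by auto
  then have "cnt T T \<noteq> {}" by auto
  then obtain i where i: "i < n" "\<forall>t\<in>T. com i t" by (auto simp: cnt_def)
  have "v i \<in> set f \<or> v (Suc i) \<in> set f"
  proof (cases i)
    case 0
    then show ?thesis using nd(4) by (cases f) (auto simp: v_def)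
  next
    case (Suc k)
    then show ?thesis using i(1) by (auto simp: v_def n_def nth_append)
  qed
  then show ?thesis using i(2) by (auto simp: com_def)
qed

text \<open>A form of the Roussel--Rubio lemma.  For adjacent \<open>d\<close> and \<open>d'\<close> it concerns a hole, and there
  the leap cannot be excluded.\<close>

lemma near_path_complete:
  assumes np: "near_path d f d'" and T: "T \<subseteq> V" "T \<noteq> {}" "conn (co E) T"
      "\<And>t. t \<in> T \<Longrightarrow> E t d \<and> E t d' \<and> t \<notin> set f \<and> (\<exists>u\<in>set f. E t u)"
    and c: "E d d' \<Longrightarrow> length f = 2 \<Longrightarrow>
      \<exists>c\<in>V. (\<forall>t\<in>T. E c t) \<and> (\<forall>u\<in>set f. \<not> E c u)"
  shows "(\<exists>u\<in>set f. \<forall>t\<in>T. E t u) \<or> E d d' \<and> leap T f"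
  using T c
proof (induction "card T" arbitrary: T rule: less_induct)
  case less
  interpret co: ugraph "co E" by (rule ugraph_co)
  note nd = near_pathD[OF np]
  have V: "d \<in> V" "d' \<in> V" "set f \<subseteq> V" "d \<noteq> d'" "even (length f)" using np by (auto simp: near_path_def)
  have finT: "finite T" using less.prems finite_V finite_subset by blast
  show ?case
  proof (rule ccontr)
    assume contra: "\<not> ?thesis"
    show False
    proof (cases "\<forall>x\<in>T. \<forall>y\<in>T. x \<noteq> y \<longrightarrow> \<not> E x y")
      case True
      then show False using near_path_stable[OF np, of T] less.prems contra by blast
    next
      case False
      then obtain x0 y0 where "x0 \<in> T" "y0 \<in> T" "x0 \<noteq> y0" "\<not> co E x0 y0" by (auto simp: co_def)
      \<comment> \<open>Removing either vertex keeps \<open>T\<close> co-connected. The induction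
        hypothesis then gives a vertex \<open>p\<close> of \<open>f\<close> that misses only
        \<open>x\<close> and a vertex \<open>q\<close> that misses only \<open>y\<close>.\<close>
      from co.two_noncut_vertices[OF finT less.prems(3) this]
      obtain x y where xy: "x \<in> T" "y \<in> T" "x \<noteq> y" "\<not> co E x y"
        "conn (co E) (T - {x})" "conn (co E) (T - {y})" by blast
      have Exy: "E x y" using xy by (auto simp: co_def)
      have type: "\<exists>u\<in>set f. (\<forall>t\<in>T - {z}. E t u) \<and> \<not> E z u"
        if z: "z \<in> T" "conn (co E) (T - {z})" "T - {z} \<noteq> {}" for z
      proof -
        have "(\<exists>u\<in>set f. \<forall>t\<in>T - {z}. E t u) \<or> E d d' \<and> leap (T - {z}) f"
        proof (rule less.hyps)
          show "card (T - {z}) < card T" by (rule card_Diff1_less[OF finT z(1)])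
          show "T - {z} \<subseteq> V" using less.prems(1) by auto
          show "\<And>t. t \<in> T - {z} \<Longrightarrow> E t d \<and> E t d' \<and> t \<notin> set f \<and> (\<exists>u\<in>set f. E t u)"
            using less.prems(4) by blast
          show "\<exists>c\<in>V. (\<forall>t\<in>T - {z}. E c t) \<and> (\<forall>u\<in>set f. \<not> E c u)" if "E d d'" "length f = 2"
            using less.prems(5)[OF that] by blast
        qed (use z in auto)
        moreover have "leap (T - {z}) f \<Longrightarrow> leap T f" unfolding leap_def by blast
        ultimately show ?thesis using contra by (metis Diff_iff singletonD)
      qed
      obtain p where p: "p \<in> set f" "\<And>t. t \<in> T \<Longrightarrow> E t p \<longleftrightarrow> t \<noteq> x"
        using type[OF xy(1,5)] xy by blast
      obtain q where q: "q \<in> set f" "\<And>t. t \<in> T \<Longrightarrow> E t q \<longleftrightarrow> t \<noteq> y"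
        using type[OF xy(2,6)] xy by blast
      have pq: "p \<noteq> q" "p \<notin> T" "q \<notin> T" using p q xy less.prems(4) by metis+
      obtain g where g: "ipath (co E) g" "set g \<subseteq> T" "hd g = x" "last g = y"
        using co.shortest_path[OF less.prems(3) xy(1), of "\<lambda>t. t = x" y "\<lambda>t. t = y"] xy by metis
      have gn: "g \<noteq> []" "hd g \<in> set g" "last g \<in> set g" using g(1) by auto
      have glen: "3 \<le> length g"
      proof (rule ccontr)
        assume "\<not> 3 \<le> length g"
        then consider "g = []" | u where "g = [u]" | u v where "g = [u, v]"
          by (cases g rule: remdups_adj.cases) (auto simp: not_less_eq_eq)
        then show False using g xy by cases auto
      qed
      have gp: "co E p u \<longleftrightarrow> u = x" if "u \<in> set g" for u
        using p(2)[of u] that g(2) pq(2) E_commute[of p u] unfolding co_def by blast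
      have gq: "co E q u \<longleftrightarrow> u = y" if "u \<in> set g" for u
        using q(2)[of u] that g(2) pq(3) E_commute[of q u] unfolding co_def by blast
      have pqg: "p \<notin> set g" "q \<notin> set g" using g(2) pq by auto
      have gqp: "ipath (co E) (g @ [q])"
        using g(1,4) gq pqg by (subst co.ipath_snoc) auto
      have gpp: "co E p u \<longleftrightarrow> u = hd (g @ [q])" if "u \<in> set g" for u
        using gp[OF that] g(3) gn(1) by simp
      have gV: "set g \<subseteq> V" "p \<in> V" "q \<in> V" using g(2) less.prems(1) p q V by auto
      \<comment> \<open>Otherwise \<open>p\<close>, \<open>g\<close>, \<open>q\<close> form an
        antihole, which is long because \<open>g\<close> has at least 3 vertices.\<close>
      have Epq: "E p q"
      proof (rule ccontr)
        assume "\<not> E p q"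
        then have "hole (co E) p (g @ [q])"
          using gqp gpp pqg pq glen gn by (auto simp: hole_def co_def hd_append)
        then show False using antihole_short[of p "g @ [q]"] glen gV by auto
      qed
      \<comment> \<open>Applied to \<open>d\<close> and \<open>d'\<close>, this shows that
        \<open>p\<close> and \<open>q\<close> are the two ends of \<open>f\<close>; as they are
        adjacent, \<open>f\<close> has only two vertices.\<close>
      have key: False if "w \<in> V" "\<And>t. t \<in> T \<Longrightarrow> E w t" "\<not> E w p" "\<not> E w q" for w
      proof -
        have "\<not> E x p" "\<not> E y q" "\<And>t. t \<in> T \<Longrightarrow> E t p \<or> E t q" using p(2) q(2) xy by auto
        then show False
          using antipath_bridge[OF less.prems(3,1) xy(1) _ xy(2), of p q w] gV(2,3) pq Epq that by metis
      qed
      have dT: "\<And>t. t \<in> T \<Longrightarrow> E d t" "\<And>t. t \<in> T \<Longrightarrow> E d' t" using less.prems(4) sym by blast+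
      have ends: "E d p \<or> E d q" "E d' p \<or> E d' q" using key[of d] key[of d'] V dT by blast+
      then have hl: "(p = hd f \<and> q = last f) \<or> (q = hd f \<and> p = last f)"
        using nd p(1) q(1) pq(1) by metis
      have "length f = 2"
      proof -
        have "E (hd f) (last f)" using hl Epq sym by auto
        then have "E (f ! 0) (f ! (length f - 1))" using hd_conv_nth[of f] last_conv_nth[of f] nd(4) by fastforce
        then have "length f - 1 = 1" using ipath_nth[OF nd(1), of 0 "length f - 1"] nd(4) by fastforce
        then show ?thesis by simp
      qed
      then obtain u v where f: "f = [u, v]" by (auto simp: length_Suc_conv numeral_2_eq_2)
      show False
      proof (cases "E d d'")
        case True
        then obtain w where "w \<in> V" "\<forall>t\<in>T. E w t" "\<forall>u\<in>set f. \<not> E w u"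
          using less.prems(5) \<open>length f = 2\<close> by blast
        then show False using key[of w] p q by blast
      next
        case False
        \<comment> \<open>\<open>w\<close> is the end adjacent to \<open>q\<close> and
          \<open>w'\<close> the end adjacent to \<open>p\<close>, so that \<open>w\<close>,
          \<open>p\<close>, \<open>g\<close>, \<open>q\<close>, \<open>w'\<close> is an antihole in
          this order.\<close>
        define w w' where "w = (if q = hd f then d else d')" and "w' = (if q = hd f then d' else d)"
        have w: "E w q" "\<not> E w p" "E w' p" "\<not> E w' q" "\<not> E w w'" "w \<noteq> w'" "w \<in> V" "w' \<in> V"
          "w \<notin> set f" "w' \<notin> set f" "\<And>t. t \<in> T \<Longrightarrow> E w t" "\<And>t. t \<in> T \<Longrightarrow> E w' t"
          using hl nd p(1) q(1) pq(1) False V dT sym unfolding w_def w'_def by auto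
        have wT: "w \<notin> T" "w' \<notin> T" using w(11,12) irrefl by blast+
        have "\<not> co E w' u" if "u \<in> set g" for u using w(12) that g(2) by (auto simp: co_def)
        then have "ipath (co E) ((g @ [q]) @ [w'])"
          using gqp w wT g(2) pqg q(1)
          by (subst co.ipath_snoc) (auto simp: co_def)
        moreover have "\<not> co E w u" if "u \<in> set g" for u using w(11) that g(2) by (auto simp: co_def)
        moreover have "co E p w' \<longleftrightarrow> False" using w sym by (auto simp: co_def)
        moreover have "w \<noteq> p" "w \<noteq> q" "w' \<noteq> p" "w' \<noteq> q" using w p q by auto
        moreover have "\<not> co E p q" using Epq by (auto simp: co_def)
        ultimately have "ipath (co E) (p # g @ [q, w'])"
          using gpp gn pqg pq by (subst co.ipath_Cons) auto
        moreover have "w \<notin> set g" "p \<noteq> w'" using wT g(2) w p by auto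
        ultimately have "hole (co E) w (p # g @ [q, w'])"
          using \<open>\<And>u. u \<in> set g \<Longrightarrow> \<not> co E w u\<close> w \<open>w \<noteq> p\<close> \<open>w \<noteq> q\<close> pq pqg wT g(2)
          by (auto simp: hole_def co_def)
        then show False using antihole_short[of w "p # g @ [q, w']"] glen gV w by auto
      qed
    qed
  qed
qed

section \<open>Interesting sets and outer paths\<close>

definition outer :: "'a set \<Rightarrow> 'a \<Rightarrow> 'a list \<Rightarrow> 'a \<Rightarrow> bool" where
  "outer T x f y \<longleftrightarrow> ipath E (x # f @ [y]) \<and> f \<noteq> [] \<and> x \<in> complete_to E V T \<and> y \<in> complete_to E V T \<and>
     set f \<subseteq> V - T - complete_to E V T"

definition interesting :: "'a set \<Rightarrow> bool" where
  "interesting T \<longleftrightarrow> T \<subseteq> V \<and> T \<noteq> {} \<and> conn (co E) T \<and>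
     (\<exists>u\<in>complete_to E V T. \<exists>v\<in>complete_to E V T. u \<noteq> v \<and> \<not> E u v)"

lemma complete_toD: "v \<in> complete_to E V T \<Longrightarrow> v \<in> V" "v \<in> complete_to E V T \<Longrightarrow> t \<in> T \<Longrightarrow> E v t"
    "v \<in> complete_to E V T \<Longrightarrow> t \<in> T \<Longrightarrow> E t v" "v \<in> complete_to E V T \<Longrightarrow> v \<notin> T"
  using sym irrefl by (auto simp: complete_to_def)

lemma ipath_ends:
  assumes "f \<noteq> []"
  shows "ipath E (x # f @ [y]) \<longleftrightarrow> ipath E f \<and> x \<notin> set f \<and> y \<notin> set f \<and> x \<noteq> y \<and> \<not> E x y \<and>
    (\<forall>v\<in>set f. E x v \<longleftrightarrow> v = hd f) \<and> (\<forall>v\<in>set f. E y v \<longleftrightarrow> v = last f)"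
proof -
  have "hd f \<in> set f" using assms by simp
  then show ?thesis using assms by (auto simp: ipath_Cons ipath_snoc)
qed

text \<open>The form in which the Roussel--Rubio lemma is applied. Since no vertex of
  \<open>f\<close> is complete to \<open>T\<close>, some vertex of \<open>T\<close> is a hat over
  \<open>d\<close> and \<open>d'\<close>, or two of them are a leap over the edge
  \<open>d d'\<close>.\<close>

lemma near_path_no_hat:
  assumes np: "near_path d f d'" and T: "T \<subseteq> V" "T \<noteq> {}" "conn (co E) T"
      "d \<in> complete_to E V T" "d' \<in> complete_to E V T" "set f \<inter> T = {}" "set f \<inter> complete_to E V T = {}"
      and c: "E d d' \<Longrightarrow> length f = 2 \<Longrightarrow> \<exists>c\<in>complete_to E V T. \<forall>u\<in>set f. \<not> E c u"
  shows "(\<exists>t\<in>T. \<forall>u\<in>set f. \<not> E t u) \<or> E d d' \<and> leap T f"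
proof (rule disjCI)
  assume contra: "\<not> (E d d' \<and> leap T f)"
  show "\<exists>t\<in>T. \<forall>u\<in>set f. \<not> E t u"
  proof (rule ccontr)
    assume "\<not> (\<exists>t\<in>T. \<forall>u\<in>set f. \<not> E t u)"
    then have n: "\<And>t. t \<in> T \<Longrightarrow> E t d \<and> E t d' \<and> t \<notin> set f \<and> (\<exists>u\<in>set f. E t u)"
      using T complete_toD(3) by blast
    have c': "\<exists>c\<in>V. (\<forall>t\<in>T. E c t) \<and> (\<forall>u\<in>set f. \<not> E c u)" if "E d d'" "length f = 2"
      using c[OF that] complete_toD by blast
    obtain u where u: "u \<in> set f" "\<forall>t\<in>T. E t u"
      using near_path_complete[OF np T(1-3) n c'] contra by blast
    then have "u \<in> complete_to E V T"
      using np sym by (auto simp: complete_to_def near_path_def)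
    then show False using u T by auto
  qed
qed

text \<open>The ends of an outer path are not adjacent, so an even interior leaves only the hat, and
  a hat closes the path to an odd hole.\<close>

lemma outer_odd:
  assumes T: "T \<subseteq> V" "T \<noteq> {}" "conn (co E) T" and o: "outer T x f y"
  shows "odd (length f)"
proof
  assume ev: "even (length f)"
  have f: "f \<noteq> []" "ipath E (x # f @ [y])" "x \<in> complete_to E V T" "y \<in> complete_to E V T"
    "set f \<subseteq> V - T - complete_to E V T" using o by (auto simp: outer_def)
  note i = f(2)[unfolded ipath_ends[OF f(1)]]
  have np: "near_path x f y" unfolding near_path_def
    using i f ev complete_toD(1) by (auto simp: ipath_Cons ipath_snoc)
  have "(\<exists>t\<in>T. \<forall>u\<in>set f. \<not> E t u) \<or> E x y \<and> leap T f"
    by (rule near_path_no_hat[OF np T f(3,4)]) (use f(5) i in auto)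
  then obtain t where t: "t \<in> T" "\<forall>u\<in>set f. \<not> E t u" using i by auto
  have "E t x" "E t y" using t f(3,4) complete_toD by blast+
  moreover have "t \<notin> set f" using t f(5) by auto
  moreover have "1 \<le> length f" using f(1) by (cases f) auto
  moreover have "t \<noteq> x" "t \<noteq> y" using calculation irrefl by blast+
  ultimately have "hole E t (x # f @ [y])" using f(2) t by (auto simp: hole_def)
  then have "odd (length (x # f @ [y]))"
    by (rule hole_odd) (use t T f complete_toD(1) in auto)
  then show False using ev by simp
qed

end

section \<open>A largest interesting set\<close>

locale maximal_interesting = artemis_graph +
  fixes T :: "'a set"
  assumes int: "interesting T" and max_int: "\<And>T'. interesting T' \<Longrightarrow> card T' \<le> card T"
begin

abbreviation C where "C \<equiv> complete_to E V T"

lemma T: "T \<subseteq> V" "T \<noteq> {}" "conn (co E) T"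
  using int by (auto simp: interesting_def)

lemma C: "v \<in> C \<Longrightarrow> v \<in> V" "v \<in> C \<Longrightarrow> t \<in> T \<Longrightarrow> E v t"
    "v \<in> C \<Longrightarrow> t \<in> T \<Longrightarrow> E t v" "v \<in> C \<Longrightarrow> v \<notin> T"
  using complete_toD by blast+

lemma conn_insert_T:
  assumes "z \<notin> T" "z \<in> V" "z \<notin> C"
  shows "conn (co E) (insert z T)"
proof -
  interpret co: ugraph "co E" by (rule ugraph_co)
  obtain t where "t \<in> T" "\<not> E z t" using assms by (auto simp: complete_to_def)
  then show ?thesis using assms(1) co.conn_insert[OF T(3), of t z] by (auto simp: co_def)
qed

text \<open>Otherwise \<open>insert z T\<close> is co-connected and still has the nonadjacent
  complete vertices \<open>x\<close> and \<open>y\<close>, against the maximality of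
  \<open>T\<close>.\<close>

lemma no_short_outer:
  assumes "x \<in> C" "y \<in> C" "x \<noteq> y" "\<not> E x y" "E x z" "E y z" "z \<in> V" "z \<notin> T"
  shows "z \<in> C"
proof (rule ccontr)
  assume "z \<notin> C"
  then have "conn (co E) (insert z T)" using conn_insert_T assms by blast
  moreover have "x \<in> complete_to E V (insert z T)" "y \<in> complete_to E V (insert z T)"
    using assms by (auto simp: complete_to_def)
  ultimately have "interesting (insert z T)" using assms T unfolding interesting_def by blast
  then have "card (insert z T) \<le> card T" using max_int by blast
  then show False using assms T finite_V finite_subset[of T V] by auto
qed

lemma outer_odd': "outer T x f y \<Longrightarrow> odd (length f)"
  using outer_odd T by blast

end

section \<open>The cliques \<open>A\<close> and \<open>B\<close> of a shortest outer path\<close>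

locale shortest_outer = maximal_interesting +
  fixes \<alpha> :: 'a and z :: "'a list" and \<beta> :: 'a
  assumes out: "outer T \<alpha> z \<beta>" and shortest: "\<And>x f y. outer T x f y \<Longrightarrow> length z \<le> length f"
begin

definition A where "A = {v \<in> C. \<forall>u\<in>set z. E v u \<longleftrightarrow> u = hd z}"
definition B where "B = {v \<in> C. \<forall>u\<in>set z. E v u \<longleftrightarrow> u = last z}"

lemma outer_rev: "outer T x f y \<longleftrightarrow> outer T y (rev f) x"
proof -
  have "ipath E (x # f @ [y]) \<longleftrightarrow> ipath E (y # rev f @ [x])"
    using ipath_rev[of "x # f @ [y]"] by simp
  then show ?thesis by (auto simp: outer_def)
qed

text \<open>Reversal exchanges the roles of \<open>A\<close> and \<open>B\<close>, so statements
  about one side are transferred to the other by interpreting the locale again.\<close>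

lemma rev_shortest_outer: "shortest_outer E V T \<beta> (rev z) \<alpha>"
  using out shortest by unfold_locales (auto simp: outer_rev[of \<beta>])

lemma z: "z \<noteq> []" "ipath E z" "set z \<subseteq> V" "set z \<inter> T = {}" "set z \<inter> C = {}"
    "hd z \<in> set z" "last z \<in> set z"
proof -
  show "z \<noteq> []" "set z \<subseteq> V" "set z \<inter> T = {}" "set z \<inter> C = {}" using out by (auto simp: outer_def)
  then show "ipath E z" "hd z \<in> set z" "last z \<in> set z" using out by (auto simp: outer_def ipath_ends)
qed

lemma z_odd: "odd (length z)"
  using out outer_odd' by blast

lemma A_C: "a \<in> A \<Longrightarrow> a \<in> C" and B_C: "a \<in> B \<Longrightarrow> a \<in> C"
  by (auto simp: A_def B_def)

lemma A_z: "a \<in> A \<Longrightarrow> u \<in> set z \<Longrightarrow> E a u \<longleftrightarrow> u = hd z"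
  and B_z: "b \<in> B \<Longrightarrow> u \<in> set z \<Longrightarrow> E b u \<longleftrightarrow> u = last z"
  by (auto simp: A_def B_def)

lemma \<alpha>\<beta>: "\<alpha> \<in> A" "\<beta> \<in> B"
  using out z(1) by (auto simp: A_def B_def outer_def ipath_ends)

lemma z_len: "3 \<le> length z"
proof (rule ccontr)
  assume "\<not> 3 \<le> length z"
  then have "length z = 1" using z_odd z(1) by (cases z rule: remdups_adj.cases) (auto simp: not_less_eq_eq)
  then obtain u where u: "z = [u]" by (auto simp: length_Suc_conv)
  have "\<alpha> \<noteq> \<beta>" "\<not> E \<alpha> \<beta>" using out z(1) by (auto simp: outer_def ipath_ends)
  then have "u \<in> C"
    using no_short_outer[of \<alpha> \<beta> u] A_C[OF \<alpha>\<beta>(1)] B_C[OF \<alpha>\<beta>(2)] A_z[OF \<alpha>\<beta>(1), of u] B_z[OF \<alpha>\<beta>(2), of u] u z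
    by auto
  then show False using z u by auto
qed

lemma hd_last_z: "hd z \<noteq> last z"
  using z_len ipath_distinct[OF z(2)] by (cases z) auto

lemma tl_z: "set (tl z) = set z - {hd z}" "conn E (set (tl z))" "hd (tl z) \<in> set (tl z)"
   "E (hd z) (hd (tl z))" "last z \<in> set (tl z)" "last (tl z) = last z"
proof -
  obtain a b c where s: "z = a # b # c" using z_len by (cases z rule: remdups_adj.cases) auto
  show "set (tl z) = set z - {hd z}" using ipath_distinct[OF z(2)] s by auto
  show "conn E (set (tl z))" using z(2) s by (intro conn_path) (auto simp: ipath_Cons)
  show "hd (tl z) \<in> set (tl z)" "last z \<in> set (tl z)" "last (tl z) = last z" using s by auto
  show "E (hd z) (hd (tl z))" using z(2) s by (auto simp: ipath_Cons)
qed

text \<open>A common vertex would make \<open>hd z\<close> equal to \<open>last z\<close>, and an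
  edge \<open>a b\<close> would close \<open>z\<close> to a hole with \<open>length z + 2\<close>
  vertices, an odd number.\<close>

lemma AB: assumes "a \<in> A" "b \<in> B" shows "a \<noteq> b" "\<not> E a b"
proof -
  show ab: "a \<noteq> b" using A_z[OF assms(1) z(7)] B_z[OF assms(2) z(7)] hd_last_z by auto
  show "\<not> E a b"
  proof
    assume e: "E a b"
    have nz: "a \<notin> set z" "b \<notin> set z" using assms A_C B_C z(5) by blast+
    have "ipath E (z @ [b])" using z(2) nz B_z[OF assms(2)] by (subst ipath_snoc) auto
    then have "hole E a (z @ [b])"
      using nz ab e A_z[OF assms(1)] z_len z(1) by (auto simp: hole_def hd_append)
    then have "odd (length (z @ [b]))"
      by (rule hole_odd) (use assms A_C B_C C z in auto)
    then show False using z_odd by simp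
  qed
qed

text \<open>Two nonadjacent vertices of \<open>A\<close> would have the common neighbour
  \<open>hd z\<close>, which \<open>no_short_outer\<close> would then place in
  \<open>C\<close>.\<close>

lemma A_clique: "a \<in> A \<Longrightarrow> a' \<in> A \<Longrightarrow> a \<noteq> a' \<Longrightarrow> E a a'"
  using no_short_outer[of a a' "hd z"] A_C A_z z by blast

lemma B_clique: "b \<in> B \<Longrightarrow> b' \<in> B \<Longrightarrow> b \<noteq> b' \<Longrightarrow> E b b'"
  using no_short_outer[of b b' "last z"] B_C B_z z by blast

text \<open>From \<open>a\<close> along \<open>z\<close> to the first neighbour of \<open>v\<close>
  and on to \<open>v\<close> there is an outer path. It cannot be shorter than \<open>z\<close>, so
  that neighbour is \<open>last z\<close> and \<open>v\<close> is in \<open>B\<close>.\<close>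

lemma nonadj_A:
  assumes "v \<in> C" "a \<in> A" "v \<noteq> a" "\<not> E v a" "v \<notin> B" "u \<in> set z"
  shows "\<not> E v u"
proof
  assume "E v u"
  then obtain f1 x f2 where s: "z = f1 @ x # f2" "E v x" "\<forall>w\<in>set f1. \<not> E v w"
    using split_list_first_prop[of z "E v"] assms(6) by blast
  have nz: "v \<notin> set z" "a \<notin> set z" using assms A_C z(5) by blast+
  have d: "distinct z" using ipath_distinct z by blast
  have ip: "ipath E (f1 @ [x])" using z(2) s(1) by (auto simp: ipath_append ipath_Cons)
  have h: "hd (f1 @ [x]) = hd z" using s by (cases f1) auto
  have av: "\<not> E a v" "a \<noteq> v" using assms sym by blast+
  have "ipath E (a # (f1 @ [x]) @ [v])"
    using ip h av nz s A_z[OF assms(2)] d by (subst ipath_ends) auto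
  then have "outer T a (f1 @ [x]) v"
    using assms A_C z s by (auto simp: outer_def)
  then have "length z \<le> length (f1 @ [x])" by (rule shortest)
  then have "f2 = []" using s by simp
  then have "\<forall>u\<in>set z. E v u \<longleftrightarrow> u = last z" using s d by auto
  then have "v \<in> B" using assms(1) by (simp add: B_def)
  then show False using assms by simp
qed

lemma nonadj_B:
  assumes "v \<in> C" "b \<in> B" "v \<noteq> b" "\<not> E v b" "v \<notin> A" "u \<in> set z"
  shows "\<not> E v u"
proof -
  interpret r: shortest_outer E V T \<beta> "rev z" \<alpha> by (rule rev_shortest_outer)
  have "r.A = B" "r.B = A" by (auto simp: r.A_def r.B_def A_def B_def hd_rev last_rev)
  then show ?thesis using r.nonadj_A assms by auto
qed

lemma rev_AB: "shortest_outer.A E V T (rev z) = B" "shortest_outer.B E V T (rev z) = A"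
proof -
  interpret r: shortest_outer E V T \<beta> "rev z" \<alpha> by (rule rev_shortest_outer)
  show "r.A = B" "r.B = A" by (auto simp: r.A_def r.B_def A_def B_def hd_rev last_rev)
qed

text \<open>Collects what the minimality of \<open>z\<close> is used for later; the missed vertex
  \<open>w\<close> may come from either clique.\<close>

lemma far_from_z:
  assumes "v \<in> C" "v \<notin> A" "v \<notin> B" "w \<in> A \<union> B" "\<not> E v w" "u \<in> set z"
  shows "\<not> E v u"
  using assms nonadj_A nonadj_B by blast

end

context ugraph
begin

lemma ipath_part:
  assumes "ipath R l" "i < j" "j \<le> length l"
  shows "ipath R (map ((!) l) [i..<j])"
proof -
  have "sublist l i (j - 1) = map ((!) l) [i..<j]"
    using assms(2,3) by (intro nth_equalityI) (auto simp: sublist_def)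
  then show ?thesis using ipath_sublist[OF assms(1), of i "j - 1"] assms(2,3) by auto
qed

end

section \<open>Odd paths between \<open>A\<close> and \<open>B\<close>, and the order on
  \<open>A\<close>\<close>

context shortest_outer
begin

lemma butlast_z: "set (butlast z) = set z - {last z}" "conn E (set (butlast z))" "last (butlast z) \<in> set (butlast z)"
   "E (last z) (last (butlast z))" "hd z \<in> set (butlast z)"
proof -
  interpret r: shortest_outer E V T \<beta> "rev z" \<alpha> by (rule rev_shortest_outer)
  have b: "butlast z = rev (tl (rev z))" by (metis butlast_rev rev_rev_ident)
  have "tl (rev z) \<noteq> []" using r.tl_z(3) by auto
  then show "set (butlast z) = set z - {last z}" "conn E (set (butlast z))" "last (butlast z) \<in> set (butlast z)"
   "E (last z) (last (butlast z))" "hd z \<in> set (butlast z)"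
    using r.tl_z unfolding b by (auto simp: hd_rev last_rev)
qed

text \<open>Cut the path at the vertices that touch \<open>z\<close>.  As the path is odd, in one of the pieces the first
  and the last vertex of \<open>C\<close> have an odd distance.  Closing this piece through \<open>z\<close> to a hole shows that
  they are adjacent and that some vertex of \<open>T\<close> is a hat, or two of them a leap, over that edge.\<close>

lemma odd_AB_path:
  assumes Q: "ipath E Q" "set Q \<subseteq> V" "hd Q \<in> A" "last Q \<in> B" "even (length Q)"
  shows "Q ! 1 \<in> A \<or> Q ! (length Q - 2) \<in> B"
proof (rule ccontr)
  assume contra: "\<not> (Q ! 1 \<in> A \<or> Q ! (length Q - 2) \<in> B)"
  define q where "q = (!) Q"
  define m where "m = length Q - 1"
  have Qn: "Q \<noteq> []" "distinct Q" using Q(1) ipath_distinct by auto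
  have lenQ: "length Q = Suc m" using Qn by (simp add: m_def)
  have q0: "hd Q = q 0" "last Q = q m" using Qn by (auto simp: q_def m_def hd_conv_nth last_conv_nth)
  have ends: "q 0 \<in> A" "q m \<in> B" "q 1 \<notin> A" "q (m - 1) \<notin> B"
    using Q(3,4) q0 contra by (auto simp: q_def m_def numeral_2_eq_2)
  have adj: "E (q i) (q j) \<longleftrightarrow> j = Suc i \<or> i = Suc j" if "i \<le> m" "j \<le> m" for i j
    unfolding q_def using ipath_nth[OF Q(1)] that lenQ by auto
  have inj: "q i = q j \<longleftrightarrow> i = j" if "i \<le> m" "j \<le> m" for i j
    unfolding q_def using Qn that lenQ by (auto simp: nth_eq_iff_index_eq)
  have qV: "q i \<in> V" if "i \<le> m" for i using Q(2) that lenQ by (auto simp: q_def)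
  have modd: "odd m" using Q(5) lenQ by auto
  have "m \<noteq> 1" using adj[of 0 m] AB(2)[OF ends(1,2)] by auto
  then have m3: "3 \<le> m" using modd by (cases "m = 0"; cases "m = 2") auto
  have aC: "q 0 \<in> C" "q m \<in> C" using ends A_C B_C by auto
  have inT: "q j \<notin> T" if "j \<le> m" for j
  proof
    assume "q j \<in> T"
    then have "E (q j) (q 0)" "E (q j) (q m)" using C(3) aC by blast+
    then show False using adj[of j 0] adj[of j m] that m3 by auto
  qed
  define I where "I = {j. j \<le> m \<and> q j \<in> C}"
  define J where "J = {j. j \<le> m \<and> (q j \<in> set z \<or> (\<exists>u\<in>set z. E (q j) u))}"
  \<comment> \<open>An inner vertex in \<open>A\<close> would be adjacent to \<open>q 0\<close> and
    hence be \<open>q 1\<close>, against \<open>contra\<close>, and similarly for \<open>B\<close>.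
    So an inner vertex of \<open>C\<close> lies in neither clique; as it also misses an end of the
    path, it is far from \<open>z\<close>.\<close>
  have IJ: "j = 0 \<or> j = m" if j: "j \<in> I" "j \<in> J" for j
  proof (rule ccontr)
    assume n: "\<not> (j = 0 \<or> j = m)"
    have jm: "j \<le> m" "q j \<in> C" using j by (auto simp: I_def)
    have "q j \<notin> A"
    proof
      assume "q j \<in> A"
      then have "E (q 0) (q j)" using A_clique[OF ends(1)] inj[of 0 j] n jm by auto
      then show False using adj[of 0 j] jm ends(3) \<open>q j \<in> A\<close> n by auto
    qed
    moreover have "q j \<notin> B"
    proof
      assume "q j \<in> B"
      then have "E (q j) (q m)" using B_clique[OF _ ends(2)] inj[of j m] n jm by auto
      then show False using adj[of j m] jm ends(4) \<open>q j \<in> B\<close> n by auto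
    qed
    moreover have "\<not> E (q j) (q 0) \<or> \<not> E (q j) (q m)"
      using adj[of j 0] adj[of j m] jm m3 by auto
    moreover have "q 0 \<in> A \<union> B" "q m \<in> A \<union> B" using ends by auto
    ultimately have "\<forall>u\<in>set z. \<not> E (q j) u" using far_from_z[OF jm(2)] by blast
    moreover have "q j \<notin> set z" using jm(2) z(5) by auto
    ultimately show False using j(2) by (auto simp: J_def)
  qed
  have far: "\<not> E (q j) u" if "j \<in> I" "0 < j" "j < m" "u \<in> set z" for j u
    using IJ[of j] that by (auto simp: J_def I_def)
  have az: "E (q 0) u \<longleftrightarrow> u = hd z" "E (q m) u \<longleftrightarrow> u = last z" if "u \<in> set z" for u
    using A_z[OF ends(1)] B_z[OF ends(2)] that by auto
  have I0: "0 \<in> I" "m \<in> I" "0 \<in> J" "m \<in> J" using aC az z(6,7) by (auto simp: I_def J_def)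
  have gap: "c' = Suc c \<or> even (c' - c)"
    if c: "c \<in> I" "c' \<in> I" "c < c'" "\<And>x. c < x \<Longrightarrow> x < c' \<Longrightarrow> x \<notin> I" for c c'
  proof (rule disjCI)
    assume "odd (c' - c)"
    show "c' = Suc c"
    proof (rule ccontr)
      assume n: "c' \<noteq> Suc c"
      have cm: "c' \<le> m" using c by (auto simp: I_def)
      let ?f = "map q [Suc c..<c']"
      have "map q [c..<Suc c'] = q c # ?f @ [q c']" using c(3) by (simp add: upt_rec[of c])
      moreover have "ipath E (map q [c..<Suc c'])"
        unfolding q_def using c(3) cm lenQ by (intro ipath_part[OF Q(1)]) auto
      ultimately have "ipath E (q c # ?f @ [q c'])" by metis
      moreover have "x \<in> V - T - C" if "x \<in> set ?f" for x
        using that qV inT c(4) cm by (auto simp: I_def)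
      ultimately have "outer T (q c) ?f (q c')"
        using c n unfolding outer_def I_def by (auto simp: subset_iff)
      then have "odd (length ?f)" by (rule outer_odd')
      then show False using \<open>odd (c' - c)\<close> c(3) by auto
    qed
  qed
  have finI: "finite I" "finite J" by (auto simp: I_def J_def)
  \<comment> \<open>The last position of \<open>C\<close> up to \<open>j\<close>. It is even for
    \<open>j = 0\<close> and odd for \<open>j = m\<close>, so its parity changes across some piece
    between successive cuts; \<open>k\<close> ends the first such piece and \<open>i\<close> begins
    it.\<close>
  define lam where "lam j = Max {c \<in> I. c \<le> j}" for j
  have lam: "lam j \<in> I" "lam j \<le> j" "\<And>c. c \<in> I \<Longrightarrow> c \<le> j \<Longrightarrow> c \<le> lam j" for j
  proof -
    have "{c \<in> I. c \<le> j} \<noteq> {}" using I0(1) by auto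
    then show "lam j \<in> I" "lam j \<le> j" using Max_in[of "{c \<in> I. c \<le> j}"] finI by (auto simp: lam_def)
    show "\<And>c. c \<in> I \<Longrightarrow> c \<le> j \<Longrightarrow> c \<le> lam j" unfolding lam_def using finI by (intro Max_ge) auto
  qed
  have lamI: "lam j = j" if "j \<in> I" for j using lam that by (metis antisym order_refl)
  define k where "k = (LEAST j. j \<in> J \<and> odd (lam j))"
  have k: "k \<in> J" "odd (lam k)" "\<And>j. j \<in> J \<Longrightarrow> j < k \<Longrightarrow> even (lam j)"
  proof -
    have "m \<in> J \<and> odd (lam m)" using I0 lamI modd by auto
    then have "k \<in> J \<and> odd (lam k)" unfolding k_def by (rule LeastI)
    then show "k \<in> J" "odd (lam k)" by auto
    show "\<And>j. j \<in> J \<Longrightarrow> j < k \<Longrightarrow> even (lam j)" unfolding k_def using not_less_Least by blast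
  qed
  have k0: "0 < k" using k(2) lamI[OF I0(1)] by (cases k) auto
  have km: "k \<le> m" using k(1) by (auto simp: J_def)
  define i where "i = Max {j \<in> J. j < k}"
  have i: "i \<in> J" "i < k" "\<And>j. j \<in> J \<Longrightarrow> j < k \<Longrightarrow> j \<le> i"
  proof -
    have "{j \<in> J. j < k} \<noteq> {}" using I0 k0 by auto
    then show "i \<in> J" "i < k" using Max_in[of "{j \<in> J. j < k}"] finI by (auto simp: i_def)
    show "\<And>j. j \<in> J \<Longrightarrow> j < k \<Longrightarrow> j \<le> i" unfolding i_def using finI by (intro Max_ge) auto
  qed
  define l where "l = lam k"
  have l: "l \<in> I" "l \<le> k" "odd l" using lam[of k] k by (auto simp: l_def)
  have lk: "j \<notin> I" if "l < j" "j \<le> k" for j using lam(3)[of j k] that by (auto simp: l_def)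
  have li: "i < l"
  proof (rule ccontr)
    assume "\<not> i < l"
    then have "l \<le> lam i" using lam(3)[OF l(1), of i] by simp
    moreover have "lam i \<le> l" unfolding l_def using lam[of i] i(2) by (intro lam(3)) auto
    ultimately show False using k(3)[OF i(1,2)] l(3) by simp
  qed
  \<comment> \<open>\<open>f\<close> is the first and \<open>l\<close> the last position of
    \<open>C\<close> in the piece from \<open>i\<close> to \<open>k\<close>. If \<open>i\<close> is
    not 0, the gap of \<open>C\<close> that contains \<open>i\<close> is even, so \<open>f\<close>
    has the same parity as \<open>lam i\<close>. Hence \<open>l - f\<close> is odd.\<close>
  obtain f where f: "f \<in> I" "even f" "f < l" "i \<le> f" "i = 0 \<Longrightarrow> f = 0" "i \<noteq> 0 \<Longrightarrow> i < f"
      "\<And>j. i \<le> j \<Longrightarrow> j < f \<Longrightarrow> j \<notin> I"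
  proof (cases "i = 0")
    case True
    then show thesis using that[of 0] I0 li by auto
  next
    case False
    have iI: "i \<notin> I" using IJ[OF _ i(1)] False i(2) km by auto
    define f where "f = (LEAST c. c \<in> I \<and> i < c)"
    have "l \<in> I \<and> i < l" using l li by auto
    then have "f \<in> I \<and> i < f" "f \<le> l" unfolding f_def by (rule LeastI, rule Least_le)
    moreover have "\<And>j. j < f \<Longrightarrow> \<not> (j \<in> I \<and> i < j)" unfolding f_def by (rule not_less_Least)
    ultimately have f: "f \<in> I" "i < f" "f \<le> l" "\<And>j. j < f \<Longrightarrow> \<not> (j \<in> I \<and> i < j)"
      by blast+
    have "lam i < i" using lam(1,2)[of i] iI by (metis le_neq_implies_less)
    then have "even (f - lam i)"
    proof -
      have "x \<notin> I" if "lam i < x" "x < f" for x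
        using lam(3)[of x i] f(4)[of x] that by (metis leD not_le)
      then show ?thesis using gap[of "lam i" f] lam(1)[of i] f(1,2) \<open>lam i < i\<close> by auto
    qed
    then have "even f" using k(3)[OF i(1,2)] \<open>lam i < i\<close> f(2) by simp
    moreover have "f \<noteq> l" using \<open>even f\<close> l by auto
    ultimately show thesis using that[of f] f False iI by (metis le_neq_implies_less less_imp_le_nat)
  qed
  have ik: "Suc i < k"
  proof (rule ccontr)
    assume "\<not> Suc i < k"
    then have "f = i" "l = k" using f(3,4) l(2) by auto
    then have "i = 0" "k = m" using f(6) IJ[OF l(1)] k(1) k0 by auto
    then show False using \<open>\<not> Suc i < k\<close> m3 by auto
  qed
  have notJ: "j \<notin> J" if "i < j" "j < k" for j using i(3)[of j] that by auto
  have zi: "q i \<notin> set z"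
  proof
    assume "q i \<in> set z"
    then have "Suc i \<in> J" using adj[of "Suc i" i] ik km by (auto simp: J_def)
    then show False using notJ[of "Suc i"] ik by auto
  qed
  have zk: "q k \<notin> set z"
  proof
    assume "q k \<in> set z"
    moreover have "k - 1 \<le> m" "Suc (k - 1) = k" using km ik by auto
    ultimately have "k - 1 \<in> J" using adj[of "k - 1" k] km by (auto simp: J_def)
    moreover have "i < k - 1" "k - 1 < k" using ik by auto
    ultimately show False using notJ by blast
  qed
  obtain u1 u2 where "u1 \<in> set z" "E (q i) u1" "u2 \<in> set z" "E (q k) u2"
    using i(1) k(1) zi zk by (auto simp: J_def)
  then obtain r where r: "ipath E r" "set r \<subseteq> set z" "E (q i) (hd r)" "E (q k) (last r)"
     "\<And>w. w \<in> set r \<Longrightarrow> E (q i) w \<Longrightarrow> w = hd r" "\<And>w. w \<in> set r \<Longrightarrow> E (q k) w \<Longrightarrow> w = last r"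
    using shortest_path[OF conn_path[OF z(2)], of u1 "\<lambda>w. E (q i) w" u2 "\<lambda>w. E (q k) w"] by blast
  have rn: "r \<noteq> []" "hd r \<in> set r" "last r \<in> set r" using r(1) by auto
  have qr: "q j \<noteq> w" "E (q j) w \<longleftrightarrow> j = i \<and> w = hd r \<or> j = k \<and> w = last r"
    if ijk: "i \<le> j" "j \<le> k" "w \<in> set r" for j w
  proof -
    have wz: "w \<in> set z" using r(2) ijk by auto
    consider "j = i" | "j = k" | "j \<notin> J" using notJ[of j] ijk by fastforce
    then show "q j \<noteq> w" "E (q j) w \<longleftrightarrow> j = i \<and> w = hd r \<or> j = k \<and> w = last r"
      by (cases; use wz zi zk r ijk km i(1,2) k(1) in \<open>auto simp: J_def\<close>)+
  qed
  \<comment> \<open>One statement for three paths: the piece is closed up through \<open>r\<close>,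
    and its stretch from \<open>f'\<close> to just before \<open>l'\<close> is left out. With
    \<open>f' = i\<close> or \<open>l' = Suc k\<close> nothing of the piece remains on that
    side.\<close>
  have pathX: "ipath E (map q [l'..<Suc k] @ rev r @ map q [i..<f'])"
    if lf: "i < l'" "f' < l'" "l' \<le> Suc k" for l' f'
  proof -
    have X: "ipath E (map q [l'..<Suc k]) \<and> last (map q [l'..<Suc k]) = q k" if "l' < Suc k"
      unfolding q_def using that km lenQ ipath_part[OF Q(1), of l' "Suc k"] by auto
    have Y: "ipath E (map q [i..<f']) \<and> hd (map q [i..<f']) = q i" if "i < f'"
      unfolding q_def using that lf km lenQ ipath_part[OF Q(1), of i f'] by (auto simp: hd_map)
    have rY: "ipath E (rev r @ map q [i..<f'])"
    proof (cases "i < f'")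
      case True
      show ?thesis
      proof (subst ipath_append, intro disjI2 conjI ballI)
        fix u v assume "u \<in> set (rev r)" "v \<in> set (map q [i..<f'])"
        then obtain j where j: "v = q j" "i \<le> j" "j < f'" and u: "u \<in> set r" by auto
        have "j < k" using j(3) lf by auto
        then show "u \<noteq> v" "E u v \<longleftrightarrow> u = last (rev r) \<and> v = hd (map q [i..<f'])"
          using qr[OF j(2) _ u] j Y[OF True] E_commute[of u] inj[of j i] km i(2) by (auto simp: last_rev)
      qed (use r Y True in auto)
    qed (use r in auto)
    show ?thesis
    proof (cases "l' < Suc k")
      case True
      show ?thesis
      proof (subst ipath_append, intro disjI2 conjI ballI)
        fix u v assume "u \<in> set (map q [l'..<Suc k])" and v: "v \<in> set (rev r @ map q [i..<f'])"
        then obtain j where j: "u = q j" "l' \<le> j" "j \<le> k" by auto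
        have hd: "hd (rev r @ map q [i..<f']) = last r" using rn by (simp add: hd_rev)
        have "u \<noteq> v \<and> (E u v \<longleftrightarrow> u = last (map q [l'..<Suc k]) \<and> v = hd (rev r @ map q [i..<f']))"
        proof (cases "v \<in> set r")
          case True
          show ?thesis
            unfolding hd using qr[of j v] True j lf X[OF \<open>l' < Suc k\<close>] inj[of j k] km by auto
        next
          case False
          then obtain j' where j': "v = q j'" "i \<le> j'" "j' < f'" using v by auto
          have "v \<noteq> last r" using qr(1)[of j' "last r"] j' lf rn by auto
          then show ?thesis
            unfolding hd using j j' lf inj[of j j'] adj[of j j'] km by auto
        qed
        then show "u \<noteq> v" "E u v \<longleftrightarrow> u = last (map q [l'..<Suc k]) \<and> v = hd (rev r @ map q [i..<f'])" by auto
      qed (use X True rY in auto)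
    qed (use rY in auto)
  qed
  define g where "g = map q [Suc l..<Suc k] @ rev r @ map q [i..<f]"
  have gset: "v \<in> set g \<longleftrightarrow> v \<in> set r \<or> (\<exists>j. v = q j \<and> (l < j \<and> j \<le> k \<or> i \<le> j \<and> j < f))" for v
    by (auto simp: g_def)
  have dg: "q l # g = map q [l..<Suc k] @ rev r @ map q [i..<f]"
    using l(2) by (simp add: g_def upt_conv_Cons del: upt_Suc)
  have gd: "g @ [q f] = map q [Suc l..<Suc k] @ rev r @ map q [i..<Suc f]"
    using f(4) by (simp add: g_def)
  have lm: "l \<le> m" "f < m" using l(2) km f(3) by auto
  have rV: "set r \<subseteq> V - T - C" using r(2) z by auto
  have hole: "hole E (q i) (map q [Suc i..<Suc k] @ rev r)"
    unfolding hole_def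
  proof (intro conjI ballI)
    show "ipath E (map q [Suc i..<Suc k] @ rev r)" using pathX[of "Suc i" i] i(2) by simp
    show "3 \<le> length (map q [Suc i..<Suc k] @ rev r)" using ik rn by (cases r) auto
    show "q i \<notin> set (map q [Suc i..<Suc k] @ rev r)"
    proof -
      have "q j \<noteq> q i" if "i < j" "j \<le> k" for j using inj[of j i] that km by auto
      moreover have "q i \<in> set r \<or> (\<exists>j. q i = q j \<and> i < j \<and> j \<le> k)"
        if "q i \<in> set (map q [Suc i..<Suc k] @ rev r)"
        using that by (auto simp: Suc_le_eq less_Suc_eq_le simp del: upt_Suc)
      ultimately show ?thesis using qr(1)[of i "q i"] i(2) by (metis order_refl less_imp_le_nat)
    qed
    fix v assume "v \<in> set (map q [Suc i..<Suc k] @ rev r)"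
    moreover have "hd (map q [Suc i..<Suc k] @ rev r) = q (Suc i)"
      using i(2) by (simp add: upt_conv_Cons del: upt_Suc)
    moreover have "last (map q [Suc i..<Suc k] @ rev r) = hd r" using rn by (simp add: last_rev)
    moreover have "q j \<noteq> hd r" if "i < j" "j \<le> k" for j using qr(1)[of j "hd r"] that rn by auto
    moreover have "q (Suc i) \<notin> set r" using qr(1)[of "Suc i"] ik by auto
    ultimately show "E (q i) v \<longleftrightarrow> v = hd (map q [Suc i..<Suc k] @ rev r) \<or>
        v = last (map q [Suc i..<Suc k] @ rev r)"
      using qr(2)[of i] adj[of i] inj[of "Suc i"] km ik by auto
  qed
  have "odd (length (map q [Suc i..<Suc k] @ rev r))"
    by (rule hole_odd[OF hole]) (use qV km i(2) rV in auto)
  then have par: "odd (k - i + length r)" using i(2) by simp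
  \<comment> \<open>\<open>g\<close> is the hole without its arc from \<open>f\<close> to
    \<open>l\<close>. Since \<open>k - i + length r\<close> and \<open>l - f\<close> are both odd,
    \<open>g\<close> has an even number of vertices.\<close>
  have np: "near_path (q l) g (q f)"
    unfolding near_path_def
  proof (intro conjI)
    show "ipath E (q l # g)" unfolding dg by (rule pathX) (use li f l in auto)
    show "ipath E (g @ [q f])" unfolding gd by (rule pathX) (use li f l in auto)
    show "q l \<noteq> q f" using inj[of l f] lm f(3) by auto
    show "g \<noteq> []" using rn by (simp add: g_def)
    have "length g + (l - f) = k - i + length r" using l(2) f(3,4) by (simp add: g_def del: upt_Suc)
    then show "even (length g)" using par l(3) f(2,3) by presburger
    show "set g \<subseteq> V" using gset qV rV km lm by auto
  qed (use qV lm in auto)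
  note nd = near_pathD[OF np]
  have gTC: "set g \<inter> T = {}" "set g \<inter> C = {}"
  proof -
    have "q j \<notin> C" if "l < j \<and> j \<le> k \<or> i \<le> j \<and> j < f" for j
      using lk[of j] f(7)[of j] that km lm by (auto simp: I_def)
    then show "set g \<inter> T = {}" "set g \<inter> C = {}" using gset inT rV km lm by auto
  qed
  have qC: "q l \<in> C" "q f \<in> C" using l f by (auto simp: I_def)
  \<comment> \<open>Nonadjacent ends would turn \<open>g\<close> into the interior of an outer path,
    with the wrong parity.\<close>
  have "l = Suc f"
  proof (rule ccontr)
    assume "l \<noteq> Suc f"
    then have "\<not> E (q l) (q f)" using adj[of l f] lm f(3) by auto
    then have "ipath E (q l # g @ [q f])"
      using np nd unfolding near_path_def by (subst ipath_ends) auto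
    then have "outer T (q l) g (q f)"
      using gTC qC np by (auto simp: outer_def near_path_def)
    then show False using outer_odd' np by (auto simp: near_path_def)
  qed
  then have elf: "E (q l) (q f)" using adj[of l f] lm by auto
  \<comment> \<open>The end of \<open>Q\<close> that misses both \<open>q l\<close> and
    \<open>q f\<close>. It serves as the vertex \<open>c\<close> of \<open>near_path_no_hat\<close>
    and links a hat or a leap to the rest.\<close>
  define c where "c = (if i = 0 then q m else q 0)"
  have kn: "k \<noteq> m" if "i = 0"
    using f(5) that lamI[OF I0(2)] \<open>l = Suc f\<close> m3 by (auto simp: l_def)
  have kl: "l = m" if "k = m" using lamI[OF I0(2)] that by (simp add: l_def)
  have c: "c \<in> C" "\<And>t. t \<in> T \<Longrightarrow> E t c" using aC C(3) by (auto simp: c_def)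
  have c_lf: "\<not> E c (q l)" "\<not> E c (q f)"
    using adj[of m l] adj[of m f] adj[of 0 l] adj[of 0 f] f(5,6) \<open>l = Suc f\<close> lm m3 kn l(2) km
    by (auto simp: c_def)
  have hdr: "hd r = hd z" if "i = 0" using az(1)[of "hd r"] r(2,3) rn(2) that by blast
  have lar: "last r = last z" if "k = m" using az(2)[of "last r"] r(2,4) rn(3) that by blast
  have hdg: "hd g = (if k = m then last r else q (Suc l))"
    using kl l(2) IJ[OF l(1)] k(1) f(3) rn
    by (cases "l = k") (auto simp: g_def hd_rev upt_conv_Cons simp del: upt_Suc)
  have lag: "last g = (if i = 0 then hd r else q (f - 1))"
  proof (cases "i = 0")
    case True
    then show ?thesis using f(5) rn by (simp add: g_def last_rev)
  next
    case False
    then have "[i..<f] = [i..<f - 1] @ [f - 1]" using f(6) by (cases f) auto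
    then show ?thesis using False by (simp add: g_def)
  qed
  have cr: "\<not> E c u" if "u \<in> set r" "i = 0 \<Longrightarrow> u = hd z" "i \<noteq> 0 \<Longrightarrow> u = last z" for u
    using az[of u] that r(2) hd_last_z by (auto simp: c_def)
  \<comment> \<open>An edge from \<open>c\<close> to the one vertex of \<open>Q\<close> in
    \<open>g\<close> would make that vertex a common neighbour of two nonadjacent vertices of
    \<open>C\<close>, and \<open>no_short_outer\<close> would place it in \<open>C\<close>.\<close>
  have cg: "\<forall>u\<in>set g. \<not> E c u" if "length g = 2"
  proof -
    have len: "(k - l) + length r + (f - i) = 2" "1 \<le> length r"
      using that rn(1) by (simp_all add: g_def Suc_le_eq del: upt_Suc)
    show ?thesis
    proof (cases "i = 0")
      case True
      then have l1: "l = 1" "f = 0" using f(5) \<open>l = Suc f\<close> by auto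
      then have "k = 2" "length r = 1" using len ik True by auto
      then have "r = [hd r]" by (cases r) auto
      then have cr': "\<forall>u\<in>set r. \<not> E c u" using cr hdr True by (metis list.set_intros(1) set_ConsD empty_iff empty_set)
      have "\<not> E (q m) (q 2)"
      proof
        assume e: "E (q m) (q 2)"
        have "2 < m" using kn True \<open>k = 2\<close> km by auto
        then have "m = 3" using e adj[of m 2] by auto
        have "q 2 \<notin> C" using lk[of 2] l1 \<open>k = 2\<close> \<open>m = 3\<close> by (auto simp: I_def)
        moreover have "E (q 1) (q 2)" "\<not> E (q 1) (q m)" "q 1 \<noteq> q m" "q 2 \<in> V" "q 2 \<notin> T"
          using adj inj \<open>m = 3\<close> qV inT by auto
        ultimately show False
          using no_short_outer[of "q 1" "q m" "q 2"] e qC(1) l1 aC(2) by auto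
      qed
      moreover have "u \<in> set r \<or> u = q 2" if u: "u \<in> set g" for u
      proof -
        consider "u \<in> set r" | j where "u = q j" "1 < j" "j \<le> 2"
          using gset[of u] u l1 \<open>k = 2\<close> by auto
        then show ?thesis by cases (auto simp: le_Suc_eq numeral_2_eq_2)
      qed
      ultimately show ?thesis using cr' True by (auto simp: c_def)
    next
      case False
      then have "i < f" using f(6) by auto
      then have kl': "k = l" "f = Suc i" "length r = 1" using len l(2) by linarith+
      then have "k = m" using IJ[OF l(1)] k(1) k0 by auto
      have "r = [hd r]" using kl'(3) by (cases r) auto
      then have cr': "\<forall>u\<in>set r. \<not> E c u" using cr lar \<open>k = m\<close> False
        by (metis list.set_intros(1) set_ConsD empty_iff empty_set last.simps)
      have "\<not> E (q 0) (q i)"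
      proof
        assume e: "E (q 0) (q i)"
        then have i1: "i = 1" using adj[of 0 i] False i(2) km by auto
        have "q 1 \<notin> C" using f(7)[of 1] i1 \<open>i < f\<close> lm by (auto simp: I_def)
        moreover have "E (q 2) (q 1)" "\<not> E (q 0) (q 2)" "q 0 \<noteq> q 2" "q 1 \<in> V" "q 1 \<notin> T"
          using adj inj m3 qV inT by auto
        ultimately show False
          using no_short_outer[of "q 0" "q 2" "q 1"] e qC(2) kl' i1 aC(1) by (auto simp: numeral_2_eq_2)
      qed
      then show ?thesis using cr' gset kl' False by (auto simp: c_def less_Suc_eq_le)
    qed
  qed
  have "(\<exists>t\<in>T. \<forall>u\<in>set g. \<not> E t u) \<or> E (q l) (q f) \<and> leap T g"
    by (rule near_path_no_hat[OF np T qC(1,2) gTC]) (use cg c(1) in blast)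
  then show False
  proof
    assume "\<exists>t\<in>T. \<forall>u\<in>set g. \<not> E t u"
    then obtain t where t: "t \<in> T" "\<And>u. u \<in> set g \<Longrightarrow> \<not> E t u" by blast
    \<comment> \<open>The end of \<open>z\<close> seen by \<open>q f\<close> (if
      \<open>i = 0\<close>) or by \<open>q l\<close> (if \<open>k = m\<close>) is removed. Both
      cases together are impossible, since \<open>l = Suc f\<close> and \<open>m\<close> is at least
      3.\<close>
    define K0 where "K0 = (if i = 0 then set (tl z) else if k = m then set (butlast z) else set z)"
    have K0z: "K0 \<subseteq> set z" "conn E K0"
      using tl_z butlast_z conn_path[OF z(2)] by (auto simp: K0_def)
    obtain y0 where y0: "y0 \<in> K0" "E c y0"
    proof (cases "i = 0")
      case True
      then show thesis using that[of "last z"] az(2)[of "last z"] tl_z z by (auto simp: K0_def c_def)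
    next
      case False
      then show thesis using that[of "hd z"] az(1)[of "hd z"] butlast_z z by (auto simp: K0_def c_def)
    qed
    have fm: "i \<noteq> 0 \<Longrightarrow> 0 < f" "k \<noteq> m \<Longrightarrow> l < m" using f(6) l(2) km by auto
    have K0far: "\<not> E y (q l) \<and> \<not> E y (q f)" if y: "y \<in> K0" for y
    proof -
      have yz: "y \<in> set z" using y K0z by auto
      have "\<not> E (q l) y"
      proof (cases "i \<noteq> 0 \<and> k = m")
        case True
        then have "y \<noteq> last z" using y butlast_z by (auto simp: K0_def)
        then show ?thesis using az(2)[OF yz] kl True by simp
      next
        case False
        then have "l < m" using fm kn by auto
        then show ?thesis using far[OF l(1) _ _ yz] li by auto
      qed
      moreover have "\<not> E (q f) y"
      proof (cases "i = 0")
        case True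
        then have "y \<noteq> hd z" using y tl_z by (auto simp: K0_def)
        then show ?thesis using az(1)[OF yz] f(5) True by simp
      next
        case False
        then show ?thesis using far[OF f(1) fm(1) lm(2) yz] by auto
      qed
      ultimately show ?thesis using sym by blast
    qed
    obtain k0 u0 where k0: "k0 \<in> K0" "u0 \<in> set g" "E k0 u0"
    proof (cases "i = 0")
      case True
      then show thesis using that[of "hd (tl z)" "hd z"] tl_z hdr gset rn sym by (auto simp: K0_def)
    next
      case i0: False
      show thesis
      proof (cases "k = m")
        case True
        then show thesis using i0 that[of "last (butlast z)" "last z"] butlast_z lar gset rn sym by (auto simp: K0_def)
      next
        case False
        have "q i \<in> set g" using gset f(6)[OF i0] by auto
        moreover have "E (hd r) (q i)" "hd r \<in> set z" using r(2,3) rn(2) sym by blast+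
        ultimately show thesis using i0 False that[of "hd r" "q i"] by (simp add: K0_def)
      qed
    qed
    show False
    proof (rule hat_connected[of t "q l" "q f" g "insert t (insert c K0)" k0 u0])
      show "conn E (insert t (insert c K0))"
        using conn_insert[OF conn_insert[OF K0z(2) y0]] c(2)[OF t(1)] by blast
      show "insert t (insert c K0) \<subseteq> V" using t(1) T(1) c(1) C(1) K0z(1) z(3) by blast
      show "\<And>k. k \<in> insert t (insert c K0) \<Longrightarrow> k \<noteq> t \<Longrightarrow> \<not> E k (q l) \<and> \<not> E k (q f)"
        using c_lf K0far by blast
      show "E t (q l)" "E t (q f)" using t(1) qC C(3) by blast+
    qed (use nd t k0 elf qC C(1) np in \<open>auto simp: near_path_def\<close>)
  next
    assume lp: "E (q l) (q f) \<and> leap T g"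
    then obtain x y where xy: "x \<in> T" "y \<in> T" "x \<noteq> y" "\<not> E x y"
      "\<And>v. v \<in> set g \<Longrightarrow> E x v \<longleftrightarrow> v = hd g" "\<And>v. v \<in> set g \<Longrightarrow> E y v \<longleftrightarrow> v = last g"
      unfolding leap_def by blast
    have gV: "set g \<subseteq> V" using np by (auto simp: near_path_def)
    have xyE: "E x (q l)" "E x (q f)" "E y (q l)" "E y (q f)" "E x c" "E y c" "E c x" "E c y"
        "x \<in> V" "y \<in> V" "c \<in> V" "q l \<in> V" "q f \<in> V"
      using xy(1,2) qC C c T(1) by blast+
    \<comment> \<open>The linking set consists of \<open>c\<close> and one vertex of the leap, and
      it touches the other one. The end of \<open>g\<close> known to be missed by \<open>c\<close>
      decides in which direction \<open>g\<close> is read.\<close>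
    show False
    proof (cases "i = 0")
      case True
      then have "\<not> E c (last g)" using lag hdr cr[of "hd r"] rn by auto
      then show False
        using leap_connected[of g "q f" "insert y {c}" x y c x] nd gV xy xyE c_lf conn_insert[of "{c}" c y]
        by auto
    next
      case False
      have "\<not> E c (hd g)"
      proof (cases "k = m")
        case True
        then show ?thesis using hdg lar cr[of "last r"] rn False by auto
      next
        case k: False
        have "Suc l \<le> m" using l(2) k km by auto
        then show ?thesis using hdg k adj[of 0 "Suc l"] False li by (auto simp: c_def)
      qed
      moreover have "\<not> E y x" using xy(4) sym by blast
      ultimately show False
        using leap_connected[of "rev g" "q l" "insert x {c}" y x c y] nd gV xy xyE c_lf conn_insert[of "{c}" c x] sym
        by (auto simp: hd_rev last_rev)
    qed
  qed
qed

text \<open>The situation that violates antisymmetry of the order on \<open>A\<close>: here \<open>a # f @ [a']\<close> closes up to a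
  hole.\<close>

definition cross :: "'a \<Rightarrow> 'a \<Rightarrow> 'a list \<Rightarrow> 'a list \<Rightarrow> 'a list \<Rightarrow> bool" where
  "cross a a' r s f \<longleftrightarrow> a \<in> A \<and> a' \<in> A \<and> ipath E (a' # a # r) \<and> ipath E (a # a' # s) \<and>
     set r \<subseteq> V \<and> set s \<subseteq> V \<and> r \<noteq> [] \<and> s \<noteq> [] \<and> last r \<in> B \<and> last s \<in> B \<and>
     ipath E f \<and> set f \<subseteq> set r \<union> set s \<and> hd f = hd r \<and> last f = hd s \<and> even (length f)"

lemma cross_sym: "cross a a' r s f \<Longrightarrow> cross a' a s r (rev f)"
  by (auto simp: cross_def hd_rev last_rev)

text \<open>The main point is that no vertex of \<open>r\<close> or \<open>s\<close> sees both
  \<open>a\<close> and \<open>a'\<close>. Hence these paths avoid \<open>T\<close>, \<open>A\<close>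
  and \<open>hd z\<close>, and their vertices in \<open>C\<close> miss a vertex of \<open>A\<close>,
  so that \<open>far_from_z\<close> applies outside \<open>B\<close>.\<close>

lemma crossD:
  assumes "cross a a' r s f"
  shows "a \<in> C" "a' \<in> C" "E a a'" "ipath E r" "ipath E s"
    "\<And>v. v \<in> set r \<union> set s \<Longrightarrow> E a v \<longleftrightarrow> v = hd r"
    "\<And>v. v \<in> set r \<union> set s \<Longrightarrow> E a' v \<longleftrightarrow> v = hd s"
    "a \<notin> set r \<union> set s" "a' \<notin> set r \<union> set s" "hd r \<noteq> hd s" "last r \<in> C" "last s \<in> C"
    "\<And>v. v \<in> set r \<union> set s \<Longrightarrow> v \<notin> T"
    "\<And>v. v \<in> set r \<union> set s \<Longrightarrow> v \<notin> A"
    "\<And>v. v \<in> set r \<union> set s \<Longrightarrow> v \<in> C \<Longrightarrow> \<not> E v (hd z)"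
    "\<And>v u. v \<in> set r \<union> set s \<Longrightarrow> v \<in> C \<Longrightarrow> v \<notin> B \<Longrightarrow> u \<in> set z \<Longrightarrow> \<not> E v u"
    "near_path a f a'"
    "\<And>v. v \<in> set f \<Longrightarrow> v \<in> set r \<union> set s"
    "tl s \<noteq> []" "E (hd s) (hd (tl s))" "conn E (set (tl s))" "last s \<in> set (tl s)"
    "\<And>k. k \<in> set (tl s) \<Longrightarrow> \<not> E k a \<and> \<not> E k a'" "hd z \<notin> set f"
proof -
  have d: "a \<in> A" "a' \<in> A" "ipath E (a' # a # r)" "ipath E (a # a' # s)"
     "set r \<subseteq> V" "set s \<subseteq> V" "r \<noteq> []" "s \<noteq> []" "last r \<in> B" "last s \<in> B"
     "ipath E f" "set f \<subseteq> set r \<union> set s" "hd f = hd r" "last f = hd s" "even (length f)"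
    using assms by (auto simp: cross_def)
  show aC: "a \<in> C" "a' \<in> C" "last r \<in> C" "last s \<in> C" using d A_C B_C by auto
  show aa: "E a a'" and i: "ipath E r" "ipath E s" using d(3,4,7,8) by (auto simp: ipath_Cons)
  have ne: "hd r \<in> set r" "hd s \<in> set s" "last s \<in> set s" using d(7,8) by auto
  have ar: "E a v \<longleftrightarrow> v = hd r" "\<not> E a' v" "v \<noteq> a" "v \<noteq> a'" if "v \<in> set r" for v
    using d(3,7) that by (auto simp: ipath_Cons)
  have as: "E a' v \<longleftrightarrow> v = hd s" "\<not> E a v" "v \<noteq> a" "v \<noteq> a'" if "v \<in> set s" for v
    using d(4,8) that by (auto simp: ipath_Cons)
  show hrs: "hd r \<noteq> hd s" using ar(1)[OF ne(1)] as(2)[OF ne(2)] by auto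
  show Ea: "E a v \<longleftrightarrow> v = hd r" if "v \<in> set r \<union> set s" for v
    using that ar(1)[of v] as(2)[of v] ar(1)[OF ne(1)] by auto
  show Ea': "E a' v \<longleftrightarrow> v = hd s" if "v \<in> set r \<union> set s" for v
    using that as(1)[of v] ar(2)[of v] as(1)[OF ne(2)] by auto
  show nin: "a \<notin> set r \<union> set s" "a' \<notin> set r \<union> set s"
    using ar(3)[of a] ar(4)[of a'] as(3)[of a] as(4)[of a'] by auto
  have two: "\<not> E a v \<or> \<not> E a' v" if "v \<in> set r \<union> set s" for v using that ar as by auto
  show FT: "v \<notin> T" if "v \<in> set r \<union> set s" for v using two[OF that] C(2) aC by auto
  show FA: "v \<notin> A" if v: "v \<in> set r \<union> set s" for v
  proof
    assume "v \<in> A"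
    moreover have "v \<noteq> a" "v \<noteq> a'" using v nin by auto
    ultimately show False using two[OF v] A_clique d(1,2) by metis
  qed
  show far: "\<not> E v u" if "v \<in> set r \<union> set s" "v \<in> C" "v \<notin> B" "u \<in> set z" for v u
    using far_from_z[OF that(2) FA[OF that(1)] that(3) _ _ that(4)] two[OF that(1)] d(1,2) sym by blast
  show "\<not> E v (hd z)" if v: "v \<in> set r \<union> set s" "v \<in> C" for v
    using far[OF v _ z(6)] B_z[OF _ z(6), of v] hd_last_z by (cases "v \<in> B") auto
  show fF: "v \<in> set r \<union> set s" if "v \<in> set f" for v using that d by auto
  have fne: "f \<noteq> []" using d(11) by auto
  show "near_path a f a'"
    unfolding near_path_def
  proof (intro conjI)
    show "ipath E (a # f)" using d(11,13) fF Ea nin by (subst ipath_Cons) auto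
    show "ipath E (f @ [a'])" using d(11,14) fF Ea' nin by (subst ipath_snoc) auto
    show "set f \<subseteq> V" using d by auto
  qed (use aa aC C(1) fne d(15) in auto)
  have hB: "hd s \<notin> B" using AB(2)[OF d(2)] Ea' ne by auto
  show tl: "tl s \<noteq> []"
  proof
    assume "tl s = []"
    then have "last s = hd s" using d(8) by (cases s) auto
    then show False using hB d(10) by simp
  qed
  have s: "s = hd s # tl s" using d(8) by simp
  then have st: "ipath E (tl s)" "hd s \<notin> set (tl s)" "\<forall>v\<in>set (tl s). E (hd s) v \<longleftrightarrow> v = hd (tl s)"
    using i(2) tl by (metis ipath_Cons)+
  show "E (hd s) (hd (tl s))" "conn E (set (tl s))" using st tl conn_path by auto
  show "last s \<in> set (tl s)" using tl by (metis last_in_set last_tl)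
  show "\<not> E k a \<and> \<not> E k a'" if k: "k \<in> set (tl s)" for k
  proof -
    have "k \<in> set s" "k \<noteq> hd s" using k st(2) by (auto simp: list.set_sel(2)[OF d(8)])
    then show ?thesis using as sym by blast
  qed
  show "hd z \<notin> set f" using two[OF fF] A_z[OF d(1) z(6)] A_z[OF d(2) z(6)] by auto
qed

text \<open>The leap consists of \<open>hd z\<close> and a vertex \<open>t\<close> of
  \<open>T\<close>. As \<open>t\<close> is complete to \<open>C\<close>, only the last vertex
  \<open>w\<close> of \<open>f\<close> is in \<open>C\<close>. This determines \<open>s\<close> and
  the end of \<open>f\<close> so far that two parities collide.\<close>

lemma cross_mixed_leap:
  assumes cr: "cross a a' r s f" and t: "t \<in> T"
    and leap: "\<And>v. v \<in> set f \<Longrightarrow> E (hd z) v \<longleftrightarrow> v = hd f" "\<And>v. v \<in> set f \<Longrightarrow> E t v \<longleftrightarrow> v = last f"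
      "\<not> E (hd z) t"
    and f4: "length f \<noteq> 2" and fC: "set f \<inter> C \<noteq> {}"
  shows False
proof -
  note D = crossD[OF cr]
  note nd = near_pathD[OF D(17)]
  have d: "a \<in> A" "a' \<in> A" "r \<noteq> []" "s \<noteq> []" "last r \<in> B" "last s \<in> B" "set r \<subseteq> V" "set s \<subseteq> V"
     "hd f = hd r" "last f = hd s" "even (length f)"
    using cr by (auto simp: cross_def)
  define w where "w = last f"
  define b where "b = last r"
  have fne: "f \<noteq> []" using nd(1) by auto
  have wf: "w \<in> set f" using fne by (simp add: w_def)
  have onlyw: "v = w" if "v \<in> set f" "v \<in> C" for v
    using leap(2)[OF that(1)] C(3)[OF that(2) t] by (simp add: w_def)
  have wC: "w \<in> C" using fC onlyw by blast
  have fV: "set f \<subseteq> V" using D(17) by (simp add: near_path_def)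
  have a'w: "E a' w" "\<not> E a w" using nd(5,6)[OF wf] nd(7) by (auto simp: w_def)
  have wB: "w \<notin> B" using AB(2)[OF d(2)] a'w by auto
  have wz: "\<not> E w u" if "u \<in> set z" for u using D(16)[OF D(18)[OF wf] wC wB that] .
  have wnz: "w \<notin> set z" using wC z(5) by auto
  have tz: "E t a'" "E t a" "t \<in> V" "E a t" using C D(1,2) t T(1) by auto
  \<comment> \<open>A vertex of \<open>B\<close> that misses \<open>w\<close> would link
    \<open>t\<close> to the rest of \<open>z\<close>, which touches \<open>hd z\<close>, and
    \<open>leap_connected\<close> would apply.\<close>
  have Bw: "E \<beta>' w" if \<beta>': "\<beta>' \<in> B" for \<beta>'
  proof (rule ccontr)
    assume n: "\<not> E \<beta>' w"
    show False
    proof (rule leap_connected[of f a' "insert t (insert \<beta>' (set (tl z)))" "hd z" t "hd (tl z)" "hd z"])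
      have "conn E (insert \<beta>' (set (tl z)))"
        using conn_insert[OF tl_z(2,5)] B_z[OF \<beta>' z(7)] by blast
      then show "conn E (insert t (insert \<beta>' (set (tl z))))"
        using conn_insert[of "insert \<beta>' (set (tl z))" \<beta>' t] C(3)[OF B_C[OF \<beta>'] t] by simp
      show "\<not> E k a' \<and> \<not> E k (last f)" if k: "k \<in> insert t (insert \<beta>' (set (tl z)))" "k \<noteq> t" for k
      proof -
        have "\<not> E a' u \<and> \<not> E w u" if "u \<in> set (tl z)" for u
          using that tl_z(1) A_z[OF d(2)] wz by auto
        then show ?thesis using k AB(2)[OF d(2) \<beta>'] n sym unfolding w_def by blast
      qed
      show "insert t (insert \<beta>' (set (tl z))) \<subseteq> V" using tz \<beta>' B_C C(1) tl_z(1) z(3) by auto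
      show "E (hd z) a'" using A_z[OF d(2) z(6)] sym by auto
      show "E (hd (tl z)) (hd z)" using tl_z(4) sym by blast
    qed (use nd leap tz tl_z fV D(2) C(1) z in auto)
  qed
  have bB: "b \<in> B" "last s \<in> B" using d by (auto simp: b_def)
  have bC: "b \<in> C" "last s \<in> C" using bB B_C by auto
  have nbf: "b \<notin> set f" "last s \<notin> set f" using onlyw bB wB bC by metis+
  have nba: "\<not> E a b" "\<not> E a' b" "a \<noteq> b" "a' \<noteq> b" using AB bB d by auto
  have s2: "set s = {w, last s}"
  proof -
    obtain x y l where s: "s = x # y # l" using D(19) d(4) by (cases s rule: remdups_adj.cases) auto
    have "x = w" using d(10) s by (simp add: w_def)
    have "E x (last (y # l))" using Bw[OF bB(2)] s sym \<open>x = w\<close> by auto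
    then have "last (y # l) = y"
      using D(5) s by (auto simp: ipath_Cons)
    then have "l = []" using ipath_distinct[OF D(5)] s by (cases l rule: rev_cases) auto
    then show ?thesis using s \<open>x = w\<close> by auto
  qed
  have fr: "v \<in> set r" "v \<noteq> b" if "v \<in> set f" "v \<noteq> w" for v
    using D(18)[OF that(1)] s2 that nbf by auto
  have uniq: "v = v'" if v: "v \<in> set f" "v \<noteq> w" "E b v" "v' \<in> set f" "v' \<noteq> w" "E b v'" for v v'
  proof -
    obtain r0 where r: "r = r0 @ [b]" unfolding b_def using d(3) by (metis append_butlast_last_id)
    have "v \<in> set r0" "v' \<in> set r0" using fr v r by auto
    then show ?thesis using D(4) v r by (auto simp: ipath_snoc)
  qed
  \<comment> \<open>Otherwise \<open>a\<close>, \<open>f\<close>, \<open>b\<close> is an odd path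
    from \<open>A\<close> to \<open>B\<close> whose second vertex is not in \<open>A\<close> and
    whose penultimate vertex \<open>w\<close> is not in \<open>B\<close>, against
    \<open>odd_AB_path\<close>.\<close>
  have "\<exists>v\<in>set f. v \<noteq> w \<and> E b v"
  proof (rule ccontr)
    assume n: "\<not> (\<exists>v\<in>set f. v \<noteq> w \<and> E b v)"
    then have "E b v \<longleftrightarrow> v = last f" if "v \<in> set f" for v using that Bw[OF bB(1)] w_def by auto
    then have ip: "ipath E (a # f @ [b])"
      using nd nbf nba by (subst ipath_ends[OF fne]) auto
    have "(a # f @ [b]) ! 1 \<in> A \<or> (a # f @ [b]) ! (length (a # f @ [b]) - 2) \<in> B"
      by (rule odd_AB_path[OF ip]) (use fV C(1) bC D(1) bB d in auto)
    moreover have "(a # f @ [b]) ! 1 = hd f" using fne by (simp add: nth_append hd_conv_nth)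
    moreover have "(a # f @ [b]) ! (length (a # f @ [b]) - 2) = w"
      using fne by (cases f rule: rev_cases) (auto simp: nth_append w_def)
    moreover have "hd f \<notin> A" using D(14)[OF D(18)] fne by auto
    ultimately show False using wB by auto
  qed
  then obtain v0 where v0: "v0 \<in> set f" "v0 \<noteq> w" "E b v0" by blast
  obtain f1 f2 where s: "f = f1 @ v0 # f2" using v0(1) by (meson split_list)
  have f2: "f2 \<noteq> []" "last f2 = w" using v0(2) s by (auto simp: w_def split: if_splits)
  have df: "distinct f" using ipath_distinct nd(1) by blast
  have f1w: "v \<noteq> w" if "v \<in> set f1" for v
    using that s df f2 last_in_set[OF f2(1)] by auto
  have b1: "\<not> E b v" if "v \<in> set f1" for v using uniq[of v v0] that v0 s df f2 last_in_set[OF f2(1)] by auto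
  have b2: "E b v \<longleftrightarrow> v = w" if "v \<in> set f2" for v
    using uniq[of v v0] that v0 s df f2 Bw[OF bB(1)] by auto
  have ip1: "ipath E (f1 @ [v0])" using nd(1) s by (auto simp: ipath_append ipath_Cons)
  have hd1: "hd (f1 @ [v0]) = hd f" using s by (cases f1) auto
  have "ipath E (a # (f1 @ [v0]) @ [b])"
    using ip1 hd1 nd(2,5) nbf nba b1 v0(3) s df by (subst ipath_ends) auto
  moreover have "set (f1 @ [v0]) \<subseteq> V - T - C"
    using s fV D(13)[OF D(18)] onlyw v0(2) f1w by auto
  ultimately have "outer T a (f1 @ [v0]) b" using D(1) bC by (simp add: outer_def)
  then have odd1: "odd (length (f1 @ [v0]))" by (rule outer_odd')
  \<comment> \<open>Otherwise \<open>b\<close> closes \<open>v0 # f2\<close> to a hole and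
    \<open>f2\<close> is even; but \<open>f1 @ [v0]\<close> is odd and \<open>f\<close> is
    even.\<close>
  have "f2 = [w]"
  proof (rule ccontr)
    assume "f2 \<noteq> [w]"
    then have "2 \<le> length f2" using f2 by (cases f2 rule: remdups_adj.cases) auto
    moreover have "ipath E (v0 # f2)" using nd(1) s by (auto simp: ipath_append)
    ultimately have "hole E b (v0 # f2)"
      using b2 v0(3) nbf s f2 by (auto simp: hole_def)
    then have "odd (length (v0 # f2))"
      by (rule hole_odd) (use bC C(1) fV s in auto)
    then show False using odd1 d(11) s by auto
  qed
  then have fs: "f = f1 @ [v0, w]" using s by simp
  have f1: "f1 \<noteq> []" using fs f4 by auto
  have v0a: "\<not> E a v0" "\<not> E a' v0" "v0 \<noteq> a" "v0 \<noteq> a'"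
  proof -
    have "v0 \<noteq> hd f" using fs f1 df by (cases f1) auto
    then show "\<not> E a v0" "\<not> E a' v0" "v0 \<noteq> a" "v0 \<noteq> a'"
      using nd v0 by (auto simp: w_def)
  qed
  have v0C: "v0 \<in> V" "v0 \<notin> C" "v0 \<notin> T" using onlyw v0 fV D(13)[OF D(18)] by auto
  have Ewv: "E v0 w" "\<And>v. v \<in> set f1 \<Longrightarrow> \<not> E w v" "\<And>v. v \<in> set f1 \<Longrightarrow> E v0 v \<longleftrightarrow> v = last f1"
    "ipath E f1"
  proof -
    have i3: "ipath E ((f1 @ [v0]) @ [w])" using nd(1) fs by simp
    then show "E v0 w" "\<And>v. v \<in> set f1 \<Longrightarrow> \<not> E w v"
      using sym[of w v0] df fs unfolding ipath_snoc by auto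
    show "\<And>v. v \<in> set f1 \<Longrightarrow> E v0 v \<longleftrightarrow> v = last f1" "ipath E f1"
      using ip1 f1 unfolding ipath_snoc by auto
  qed
  \<comment> \<open>Otherwise \<open>b\<close> is a hat over the edge \<open>w v0\<close> with the
    path \<open>a' # a # f1\<close>, linked to \<open>a\<close> through \<open>z\<close>.\<close>
  have v0z: "\<exists>u\<in>set z. E v0 u"
  proof (rule ccontr)
    assume n: "\<not> (\<exists>u\<in>set z. E v0 u)"
    have f1f: "v \<in> set f1 \<Longrightarrow> v \<in> set f" for v using fs by auto
    have g: "ipath E (a' # a # f1)"
    proof -
      have hf: "hd f1 = hd f" using fs f1 by auto
      have "ipath E (a # f1)" using Ewv(4) f1 hf nd(2,5) f1f by (subst ipath_Cons) auto
      moreover have "v \<noteq> last f" if "v \<in> set f1" for v using that fs df by auto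
      ultimately show ?thesis
        using D(3) sym nd(3,6) f1f by (subst ipath_Cons) (auto; metis irrefl)
    qed
    show False
    proof (rule hat_connected[of b w v0 "a' # a # f1" "insert b (set z)" "hd z" a])
      show "conn E (insert b (set z))" using conn_insert[OF conn_path[OF z(2)] z(7)] B_z[OF bB(1) z(7)] by blast
      show "\<not> E k w \<and> \<not> E k v0" if "k \<in> insert b (set z)" "k \<noteq> b" for k
        using that wz n sym by blast
      show "E w v \<longleftrightarrow> v = hd (a' # a # f1)" if "v \<in> set (a' # a # f1)" for v
        using that a'w Ewv(2) sym by auto
      show "E v0 v \<longleftrightarrow> v = last (a' # a # f1)" if "v \<in> set (a' # a # f1)" for v
        using that v0a Ewv(3) sym f1 f1f nd(2,3) last_in_set[OF f1] by auto
      show "\<not> E b v" if "v \<in> set (a' # a # f1)" for v using that nba b1 sym by auto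
      show "E (hd z) a" using A_z[OF d(1) z(6)] sym by auto
      show "E w v0" using Ewv(1) sym by blast
      show "set (a' # a # f1) \<subseteq> V" using D(1,2) C(1) fV f1f by auto
    qed (use g v0 v0C wC bC C(1) z Bw[OF bB(1)] in auto)
  qed
  obtain z1 x z2 where zs: "z = z1 @ x # z2" "E v0 x" "\<forall>u\<in>set z1. \<not> E v0 u"
    using split_list_first_prop[of z "E v0"] v0z by blast
  have zip: "ipath E (z1 @ [x])" using z(2) zs by (auto simp: ipath_append ipath_Cons)
  have dz: "distinct z" using ipath_distinct z(2) by blast
  have v0nz: "v0 \<notin> set z"
  proof
    assume "v0 \<in> set z"
    then show False using wz Ewv(1) sym by blast
  qed
  have hz: "hd (z1 @ [x, v0]) = hd z" "hd (z1 @ [x]) = hd z" using zs by (cases z1; auto)+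
  have zv: "ipath E (z1 @ [x, v0])"
  proof -
    have "ipath E ((z1 @ [x]) @ [v0])" using zip zs v0nz dz by (subst ipath_snoc) auto
    then show ?thesis by simp
  qed
  have Az: "E c u \<longleftrightarrow> u = hd z" if "c \<in> {a, a'}" "u \<in> set (z1 @ [x, v0])" for c u
  proof (cases "u = v0")
    case True
    then show ?thesis using that(1) v0a v0nz z(6) by auto
  next
    case False
    then have "u \<in> set z" using that zs by auto
    then show ?thesis using A_z that(1) d by auto
  qed
  have nz: "a \<notin> set z" "a' \<notin> set z" using z(5) D(1,2) by auto
  have zw: "E w u \<longleftrightarrow> u = last (z1 @ [x, v0])" if "u \<in> set (z1 @ [x, v0])" for u
    using that wz Ewv(1) sym v0nz zs by auto
  have aw: "a \<noteq> w" "a' \<noteq> w" using nd(2,3) wf by auto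
  \<comment> \<open>The stretch \<open>z1 @ [x, v0]\<close> is the interior of an outer path from
    \<open>a\<close> to \<open>w\<close>, hence odd; with \<open>w\<close> and \<open>a'\<close> it
    forms a hole, hence it is even.\<close>
  have "ipath E (a # (z1 @ [x, v0]) @ [w])"
    using zv Az[of a] zw aw a'w nz v0a wnz v0 zs hz by (subst ipath_ends) auto
  moreover have "set (z1 @ [x, v0]) \<subseteq> V - T - C" using z v0C zs by auto
  ultimately have "outer T a (z1 @ [x, v0]) w" using D(1) wC by (simp add: outer_def)
  then have "odd (length (z1 @ [x, v0]))" by (rule outer_odd')
  moreover have "odd (length ((z1 @ [x, v0]) @ [w]))"
  proof (rule hole_odd[of a'])
    have "ipath E ((z1 @ [x, v0]) @ [w])"
      using zv zw wnz v0 zs by (subst ipath_snoc) auto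
    moreover have "E a' v \<longleftrightarrow> v = hd z \<or> v = w" if "v \<in> set ((z1 @ [x, v0]) @ [w])" for v
      using that Az[of a' v] a'w wnz z(6) by auto
    ultimately show "hole E a' ((z1 @ [x, v0]) @ [w])"
      using hz nz v0a aw zs by (auto simp: hole_def hd_append)
  qed (use D(2) C(1) wC v0C zs z in auto)
  ultimately show False by simp
qed

text \<open>\<open>u\<close> is a hat over the edge \<open>a a'\<close>. The vertices of
  \<open>s\<close> after the first lead from \<open>last s\<close> back to a neighbour of
  \<open>last f\<close>, so it suffices that \<open>K\<close> reaches \<open>last s\<close>.\<close>

lemma cross_hat:
  assumes cr: "cross a a' r s f" and u: "u \<in> V" "E u a" "E u a'" "\<And>v. v \<in> set f \<Longrightarrow> \<not> E u v"
    and K: "conn E K" "K \<subseteq> V" "u \<in> K" "k \<in> K" "E k (last s)"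
      "\<And>k. k \<in> K \<Longrightarrow> k \<noteq> u \<Longrightarrow> \<not> E k a \<and> \<not> E k a'"
  shows False
proof -
  note D = crossD[OF cr]
  note nd = near_pathD[OF D(17)]
  have d: "set s \<subseteq> V" "s \<noteq> []" "hd s = last f" using cr by (auto simp: cross_def)
  show False
  proof (rule hat_connected[of u a a' f "K \<union> set (tl s)" "hd (tl s)" "last f"])
    show "conn E (K \<union> set (tl s))" using conn_Un[OF K(1) D(21) K(4) D(22)] K(5) by blast
    show "K \<union> set (tl s) \<subseteq> V" using K(2) d(1) list.set_sel(2)[OF d(2)] by blast
    show "\<And>k. k \<in> K \<union> set (tl s) \<Longrightarrow> k \<noteq> u \<Longrightarrow> \<not> E k a \<and> \<not> E k a'"
      using K(6) D(23) by blast
    show "hd (tl s) \<in> K \<union> set (tl s)" using D(19) by simp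
    show "last f \<in> set f" using nd(1) by simp
    show "E (hd (tl s)) (last f)" using D(20) d(3) sym by auto
    show "set f \<subseteq> V" using D(17) by (simp add: near_path_def)
  qed (use nd u D K C(1) in auto)
qed

text \<open>Apart from \<open>a\<close> and \<open>a'\<close> no vertex of the hole is complete to \<open>T\<close> together with the first vertex
  of \<open>z\<close>, so this larger co-connected set contains a hat or a leap.\<close>

lemma no_cross: "\<not> cross a a' r s f"
proof
  assume cr: "cross a a' r s f"
  note D = crossD[OF cr]
  note nd = near_pathD[OF D(17)]
  have d: "a \<in> A" "a' \<in> A" "r \<noteq> []" "s \<noteq> []" "last r \<in> B" "last s \<in> B"
     "hd f = hd r" "last f = hd s"
    using cr by (auto simp: cross_def)
  have fV: "set f \<subseteq> V" "f \<noteq> []" using D(17) by (auto simp: near_path_def)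
  have hf: "hd f \<in> set f" "last f \<in> set f" using fV by auto
  define b where "b = last s"
  have b: "b \<in> B" "b \<in> C" using d B_C by (auto simp: b_def)
  have nba: "\<not> E b a" "\<not> E b a'" "a \<noteq> b" "a' \<noteq> b" using AB[OF _ b(1)] d sym by blast+
  have hat_t: False if t: "t \<in> T" "\<And>v. v \<in> set f \<Longrightarrow> \<not> E t v" for t
    by (rule cross_hat[OF cr, of t "{t}" t]) (use t T C D in auto)
  have hat_z: False if t: "\<And>v. v \<in> set f \<Longrightarrow> \<not> E (hd z) v"
  proof (rule cross_hat[OF cr, of "hd z" "set z" "last z"])
    show "E (hd z) a" "E (hd z) a'" using A_z[OF _ z(6)] d sym by blast+
    show "E (last z) (last s)" using B_z[OF d(6) z(7)] sym by blast
    show "\<And>k. k \<in> set z \<Longrightarrow> k \<noteq> hd z \<Longrightarrow> \<not> E k a \<and> \<not> E k a'"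
      using A_z d sym by blast
  qed (use t z conn_path in auto)
  have bnl: "\<not> E b (last f)" if "last f \<notin> C"
  proof
    assume "E b (last f)"
    then have "last f \<in> C"
      using no_short_outer[of a' b "last f"] D(2) b nba nd(6)[OF hf(2)] sym hf fV D(13)[OF D(18)] by blast
    then show False using that by simp
  qed
  have bnh: "\<not> E b (hd f)" if "hd f \<notin> C"
  proof
    assume "E b (hd f)"
    then have "hd f \<in> C"
      using no_short_outer[of a b "hd f"] D(1) b nba nd(5)[OF hf(1)] sym hf fV D(13)[OF D(18)] by blast
    then show False using that by simp
  qed
  have leapT: False if xy: "x \<in> T" "y \<in> T" "\<not> E x y" "\<And>v. v \<in> set f \<Longrightarrow> E x v \<longleftrightarrow> v = hd f"
      "\<And>v. v \<in> set f \<Longrightarrow> E y v \<longleftrightarrow> v = last f" for x y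
  proof -
    have "last f \<notin> C" using xy(4)[OF hf(2)] C(3) xy(1) nd(7) by auto
    moreover have "x \<in> V" "y \<in> V" "E b x" "E y b" "E x a'" "E y a'" using xy T(1) C b D(2) by blast+
    ultimately show False
      using bnl leap_connected[of f a' "insert y {b}" x y b x] nd fV xy D(1,2) C b nba T(1) conn_insert[of "{b}" b y]
      by auto
  qed
  have len2: "set f = {hd f, last f}" if l2: "length f = 2"
  proof -
    obtain p q where "f = [p, q]" using l2 by (auto simp: length_Suc_conv numeral_2_eq_2)
    then show ?thesis by auto
  qed
  \<comment> \<open>If \<open>f\<close> avoids \<open>C\<close>, then \<open>T\<close> itself can be
    used. Otherwise \<open>T\<close> is enlarged by \<open>hd z\<close>, which misses all vertices
    of \<open>C\<close> on \<open>f\<close>.\<close>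
  show False
  proof (cases "set f \<inter> C = {}")
    case True
    have "(\<exists>t\<in>T. \<forall>u\<in>set f. \<not> E t u) \<or> E a a' \<and> leap T f"
    proof (rule near_path_no_hat[OF D(17) T D(1,2)])
      show "\<exists>c\<in>C. \<forall>u\<in>set f. \<not> E c u" if l2: "length f = 2"
      proof
        show "\<forall>u\<in>set f. \<not> E b u" unfolding len2[OF l2] using bnl bnh hf True by blast
      qed (rule b(2))
    qed (use True D(13)[OF D(18)] in auto)
    then show False using hat_t leapT unfolding leap_def by blast
  next
    case fC: False
    have zC: "\<not> E (hd z) v" if "v \<in> set f" "v \<in> C" for v
      using D(15)[OF D(18)[OF that(1)] that(2)] sym by blast
    show False
    proof (cases "length f = 2")
      case True
      \<comment> \<open>For two vertices, \<open>no_short_outer\<close> places both in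
        \<open>C\<close> as soon as one is there, and then \<open>hd z\<close> is a hat.\<close>
      have e: "E (hd f) (last f)"
      proof -
        obtain p q where "f = [p, q]" using True by (auto simp: length_Suc_conv numeral_2_eq_2)
        then show ?thesis using nd(1) by auto
      qed
      have n1: "\<not> E a' (hd f)" "\<not> E a (last f)" "E a (hd f)" "E a' (last f)"
         "a' \<noteq> hd f" "a \<noteq> last f" using nd hf by auto
      have "hd f \<in> C \<Longrightarrow> last f \<in> C"
        using no_short_outer[of a' "hd f" "last f"] D(2) n1 e hf fV D(13)[OF D(18)] by blast
      moreover have "last f \<in> C \<Longrightarrow> hd f \<in> C"
        using no_short_outer[of a "last f" "hd f"] D(1) n1 e sym hf fV D(13)[OF D(18)] by blast
      ultimately have "set f \<subseteq> C" using fC len2[OF True] by auto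
      then show False using hat_z zC by blast
    next
      case l2: False
      let ?T = "insert (hd z) T"
      have zT: "hd z \<notin> T" "hd z \<in> V" "hd z \<notin> C" using z(3-6) by blast+
      have "(\<exists>t\<in>?T. \<forall>u\<in>set f. \<not> E t u) \<or> E a a' \<and> leap ?T f"
      proof (rule near_path_no_hat[OF D(17)])
        show "?T \<subseteq> V" "?T \<noteq> {}" using T zT by auto
        show "conn (co E) ?T" using conn_insert_T zT by blast
        show "a \<in> complete_to E V ?T" "a' \<in> complete_to E V ?T"
          using D(1,2) A_z[OF _ z(6)] d by (auto simp: complete_to_def)
        show "set f \<inter> ?T = {}" using D(13)[OF D(18)] D(24) by auto
        show "set f \<inter> complete_to E V ?T = {}"
        proof -
          have "v \<notin> complete_to E V ?T" if v: "v \<in> set f" for v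
          proof
            assume "v \<in> complete_to E V ?T"
            then have "v \<in> C" "E v (hd z)" by (auto simp: complete_to_def)
            then show False using zC[OF v] sym by blast
          qed
          then show ?thesis by auto
        qed
      qed (use l2 in auto)
      then show False
      proof
        assume "\<exists>t\<in>?T. \<forall>u\<in>set f. \<not> E t u"
        then show False using hat_t hat_z by blast
      next
        assume "E a a' \<and> leap ?T f"
        then obtain x y where xy: "x \<in> ?T" "y \<in> ?T" "x \<noteq> y" "\<not> E x y"
            "\<And>v. v \<in> set f \<Longrightarrow> E x v \<longleftrightarrow> v = hd f" "\<And>v. v \<in> set f \<Longrightarrow> E y v \<longleftrightarrow> v = last f"
          unfolding leap_def by blast
        consider "x \<in> T" "y \<in> T" | "x = hd z" "y \<in> T" | "y = hd z" "x \<in> T" using xy by auto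
        then show False
        proof cases
          case 1
          then show False using leapT xy by blast
        next
          case 2
          then show False using cross_mixed_leap[OF cr 2(2)] xy l2 fC by blast
        next
          case 3
          show False
            by (rule cross_mixed_leap[OF cross_sym[OF cr] 3(2)])
              (use 3 xy l2 fC sym in \<open>auto simp: hd_rev last_rev\<close>)
        qed
      qed
    qed
  qed
qed

definition below :: "'a \<Rightarrow> 'a \<Rightarrow> bool" where
  "below a a' \<longleftrightarrow> a \<in> A \<and> a' \<in> A \<and> (\<exists>p. ipath E (a # a' # p) \<and> set p \<subseteq> V \<and> p \<noteq> [] \<and> last p \<in> B)"

text \<open>The two paths end in the clique \<open>B\<close>, so together they are connected once
  \<open>a\<close> and \<open>a'\<close> are removed. A shortest connection \<open>f\<close> between
  their first vertices closes with the edge \<open>a a'\<close> to a hole, and this is a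
  \<open>cross\<close>.\<close>

lemma below_asym:
  assumes "below a a'" "below a' a"
  shows False
proof -
  obtain r s where p: "a \<in> A" "a' \<in> A" "ipath E (a' # a # r)" "ipath E (a # a' # s)"
     "set r \<subseteq> V" "set s \<subseteq> V" "r \<noteq> []" "s \<noteq> []" "last r \<in> B" "last s \<in> B"
    using assms unfolding below_def by blast
  have i: "ipath E r" "ipath E s" using p by (auto simp: ipath_Cons)
  have ne: "hd r \<in> set r" "hd s \<in> set s" "last s \<in> set s" "last r \<in> set r" using p by auto
  have ar: "E a v \<longleftrightarrow> v = hd r" "\<not> E a' v" "a \<noteq> v" "a' \<noteq> v" if "v \<in> set r" for v
    using p(3,7) that by (auto simp: ipath_Cons)
  have as: "E a' v \<longleftrightarrow> v = hd s" "\<not> E a v" "a \<noteq> v" "a' \<noteq> v" if "v \<in> set s" for v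
    using p(4,8) that by (auto simp: ipath_Cons)
  have "last r = last s \<or> E (last r) (last s)" using B_clique p by blast
  then have cF: "conn E (set r \<union> set s)" using conn_Un[OF conn_path[OF i(1)] conn_path[OF i(2)] ne(4,3)] by blast
  obtain f where f: "ipath E f" "set f \<subseteq> set r \<union> set s" "E a (hd f)" "E a' (last f)"
     "\<And>w. w \<in> set f \<Longrightarrow> E a w \<Longrightarrow> w = hd f" "\<And>w. w \<in> set f \<Longrightarrow> E a' w \<Longrightarrow> w = last f"
    using shortest_path[OF cF, of "hd r" "E a" "hd s" "E a'"] ne ar as by blast
  have fn: "f \<noteq> []" "hd f \<in> set f" "last f \<in> set f" using f(1) by auto
  have hf: "hd f = hd r" "last f = hd s" using f(2-4) fn ar as by blast+
  have nin: "a \<notin> set f" "a' \<notin> set f" using f(2) ar as by blast+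
  have aa: "E a a'" "a \<noteq> a'" using p(4,8) by (auto simp: ipath_Cons)
  have ipf: "ipath E (f @ [a'])" using f nin by (subst ipath_snoc) auto
  have hl: "hd f \<noteq> last f" using hf ar(1)[OF ne(1)] as(2)[OF ne(2)] by auto
  then have f2: "2 \<le> length f" using fn(1) by (cases f; cases "tl f") auto
  have "E a v \<longleftrightarrow> v = hd f \<or> v = a'" if "v \<in> set (f @ [a'])" for v
    using that f(3) f(5)[of v] aa(1) by auto
  then have "hole E a (f @ [a'])"
    using ipf nin aa(2) fn(1) f2 by (simp add: hole_def)
  then have "odd (length (f @ [a']))"
    by (rule hole_odd) (use p A_C C(1) f(2) in auto)
  then have "cross a a' r s f" using p f(1,2) hf by (simp add: cross_def)
  then show False using no_cross by blast
qed

text \<open>If \<open>a\<close> has no neighbour on \<open>p\<close>, it can replace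
  \<open>a'\<close> on the path. Otherwise the last neighbour of \<open>a\<close> on
  \<open>p\<close> gives a path from \<open>a'\<close> through \<open>a\<close>, so that
  \<open>below a' a\<close>, against asymmetry.\<close>

lemma below_trans:
  assumes "below a a'" "below a' a''"
  shows "below a a''"
proof -
  obtain p where p: "a \<in> A" "a' \<in> A" "a'' \<in> A" "ipath E (a' # a'' # p)" "set p \<subseteq> V" "p \<noteq> []" "last p \<in> B"
    using assms unfolding below_def by blast
  have ip: "ipath E (a'' # p)" "ipath E p" "\<And>v. v \<in> set p \<Longrightarrow> \<not> E a' v \<and> v \<noteq> a' \<and> v \<noteq> a''"
    using p(4,6) by (auto simp: ipath_Cons)
  have ne: "a \<noteq> a''" using assms below_asym by blast
  have ne': "a \<noteq> a'" using assms(1) below_asym by blast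
  have pA: "v \<noteq> a" if "v \<in> set p" for v using ip(3)[OF that] A_clique[OF p(2,1)] ne' by auto
  show ?thesis
  proof (cases "\<exists>v\<in>set p. E a v")
    case False
    then have "ipath E (a # a'' # p)"
      using ip A_clique[OF p(1,3) ne] ne pA by (subst ipath_Cons) auto
    then show ?thesis using p unfolding below_def by blast
  next
    case True
    then obtain xs x ys where s: "p = xs @ x # ys" "E a x" "\<forall>v\<in>set ys. \<not> E a v"
      using split_list_last_prop[of p "E a"] by blast
    have xy: "ipath E (x # ys)" using ip(2) s by (auto simp: ipath_append)
    have "ipath E (a # x # ys)"
      using xy s pA ipath_distinct[OF xy] by (subst ipath_Cons) auto
    then have "ipath E (a' # a # x # ys)"
      using ip(3) s A_clique[OF p(2,1)] ne' by (subst ipath_Cons) auto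
    then have "below a' a" using p s unfolding below_def by (intro conjI exI[of _ "x # ys"]) auto
    then show ?thesis using assms(1) below_asym by blast
  qed
qed

lemma maximal_A: "\<exists>a\<in>A. \<forall>a'. \<not> below a a'"
proof -
  have "A \<subseteq> V" using A_C C(1) by blast
  then have "finite A" "A \<noteq> {}" using finite_V finite_subset \<alpha>\<beta> by auto
  moreover have "asymp_on A below" "transp_on A below"
    using below_asym below_trans by (auto intro!: asymp_onI transp_onI)
  ultimately obtain m where "m \<in> A" "\<forall>x\<in>A. x \<noteq> m \<longrightarrow> \<not> below m x"
    using Finite_Set.bex_max_element[of A below] by blast
  then show ?thesis using below_asym by (metis below_def)
qed

text \<open>A maximal \<open>a\<close> excludes the first outcome of \<open>odd_AB_path\<close>, and
  a maximal \<open>b\<close> for the mirrored order the second. The conditions on second vertices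
  are kept in the statement for the exclusion of quasi-prisms.\<close>

lemma special_ends:
  obtains a b where "a \<in> A" "b \<in> B"
    "\<And>x p. ipath E (a # x # p) \<Longrightarrow> set p \<subseteq> V \<Longrightarrow> p \<noteq> [] \<Longrightarrow> last p = b \<Longrightarrow> x \<notin> A"
    "\<And>x p. ipath E (b # x # p) \<Longrightarrow> set p \<subseteq> V \<Longrightarrow> p \<noteq> [] \<Longrightarrow> last p = a \<Longrightarrow> x \<notin> B"
    "\<And>Q. ipath E Q \<Longrightarrow> set Q \<subseteq> V \<Longrightarrow> hd Q = a \<Longrightarrow> last Q = b \<Longrightarrow> odd (length Q)"
proof -
  interpret r: shortest_outer E V T \<beta> "rev z" \<alpha> by (rule rev_shortest_outer)
  obtain a where a: "a \<in> A" "\<And>a'. \<not> below a a'" using maximal_A by blast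
  obtain b where b: "b \<in> B" "\<And>b'. \<not> r.below b b'" using r.maximal_A by (auto simp: rev_AB)
  have 1: "x \<notin> A" if "ipath E (a # x # p)" "set p \<subseteq> V" "p \<noteq> []" "last p = b" for x p
    using a(2)[of x] that a(1) b(1) unfolding below_def by blast
  have 2: "x \<notin> B" if "ipath E (b # x # p)" "set p \<subseteq> V" "p \<noteq> []" "last p = a" for x p
    using b(2)[of x] that a(1) b(1) unfolding r.below_def rev_AB by blast
  have 3: "odd (length Q)" if Q: "ipath E Q" "set Q \<subseteq> V" "hd Q = a" "last Q = b" for Q
  proof
    assume ev: "even (length Q)"
    have ab: "a \<noteq> b" "\<not> E a b" using AB a(1) b(1) by blast+
    have "3 \<le> length Q"
    proof (rule ccontr)
      assume "\<not> 3 \<le> length Q"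
      then consider "Q = []" | u where "Q = [u]" | u v where "Q = [u, v]"
        by (cases Q rule: remdups_adj.cases) (auto simp: not_less_eq_eq)
      then show False using Q ab by cases auto
    qed
    then obtain x p where p: "Q = a # x # p" "p \<noteq> []"
      using Q(3) by (cases Q rule: remdups_adj.cases) (auto simp: Suc_le_eq)
    then obtain p' y where p': "Q = p' @ [y, b]" "p' \<noteq> []"
    proof -
      have "a # x # p = (butlast (a # x # p)) @ [b]" using Q(4) p by (metis append_butlast_last_id list.discI)
      moreover have "butlast (a # x # p) = butlast (butlast (a # x # p)) @ [last (butlast (a # x # p))]"
        using p by simp
      moreover have "butlast (butlast (a # x # p)) \<noteq> []" using p by simp
      ultimately show thesis using that[of "butlast (butlast (a # x # p))" "last (butlast (a # x # p))"] p
        by (metis append.assoc append_Cons append_Nil)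
    qed
    have "Q ! 1 = x" using p by simp
    moreover have "Q ! (length Q - 2) = y" using p' by simp
    moreover have "x \<notin> A" using 1[of x p] Q p by auto
    moreover have "y \<notin> B"
    proof -
      have "rev Q = b # y # rev p'" using p' by simp
      moreover have "last (rev p') = a" using p' Q(3) by (simp add: last_rev)
      ultimately show ?thesis using 2[of y "rev p'"] Q p' by (metis ipath_rev set_rev rev_is_Nil_conv set_append le_sup_iff)
    qed
    ultimately show False
      using odd_AB_path[of Q] Q ev a(1) b(1) by auto
  qed
  show thesis by (rule that[OF a(1) b(1) 1 2 3])
qed

end

section \<open>Special even pairs\<close>

text \<open>Strictness is left out here; it appears as the bound on the lengths of \<open>S1\<close>
  and \<open>S2\<close> in \<open>special\<close>.\<close>

definition quasi_prism :: "('a \<Rightarrow> 'a \<Rightarrow> bool) \<Rightarrow> 'a list \<Rightarrow> 'a list \<Rightarrow> 'a list \<Rightarrow> 'a list \<Rightarrow> bool" where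
  "quasi_prism E S1 S2 S3 S4 \<longleftrightarrow>
     ipath E S1 \<and> ipath E S2 \<and> ipath E S3 \<and> ipath E S4 \<and> 2 \<le> length S3 \<and> 2 \<le> length S4 \<and>
     (\<forall>u\<in>set S1. \<forall>v\<in>set S2. u \<noteq> v \<and> \<not> E u v) \<and>
     (\<forall>u\<in>set S1. \<forall>v\<in>set S3. u \<noteq> v \<and> (E u v \<longleftrightarrow> u = last S1 \<and> v = hd S3)) \<and>
     (\<forall>u\<in>set S1. \<forall>v\<in>set S4. u \<noteq> v \<and> (E u v \<longleftrightarrow> u = last S1 \<and> v = hd S4)) \<and>
     (\<forall>u\<in>set S2. \<forall>v\<in>set S3. u \<noteq> v \<and> (E u v \<longleftrightarrow> u = last S2 \<and> v = last S3)) \<and>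
     (\<forall>u\<in>set S2. \<forall>v\<in>set S4. u \<noteq> v \<and> (E u v \<longleftrightarrow> u = last S2 \<and> v = last S4)) \<and>
     rungs E S3 S4"

context ugraph
begin

lemma rungs_sym:
  assumes "rungs E P Q"
  shows "rungs E Q P"
  unfolding rungs_def
proof (intro ballI)
  fix u v assume "u \<in> set Q" "v \<in> set P"
  then show "u \<noteq> v \<and> (E u v \<longleftrightarrow> u = hd Q \<and> v = hd P \<or> u = last Q \<and> v = last P)"
    using assms[unfolded rungs_def, rule_format, of v u] E_commute[of u v] by auto
qed

lemma rungs_rev: "rungs E P Q \<Longrightarrow> rungs E (rev P) (rev Q)"
  by (auto simp: rungs_def hd_rev last_rev)

lemma quasi_prism_swap: "quasi_prism E S1 S2 S3 S4 \<Longrightarrow> quasi_prism E S1 S2 S4 S3"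
  using rungs_sym[of S3 S4] by (simp add: quasi_prism_def)

lemma quasi_prism_rev:
  assumes "quasi_prism E S1 S2 S3 S4"
  shows "quasi_prism E S2 S1 (rev S3) (rev S4)"
proof -
  have "\<forall>u\<in>set S1. \<forall>v\<in>set S2. u \<noteq> v \<and> \<not> E u v" using assms by (simp add: quasi_prism_def)
  then have "\<forall>u\<in>set S2. \<forall>v\<in>set S1. u \<noteq> v \<and> \<not> E u v" using sym by blast
  moreover have "rungs E (rev S3) (rev S4)" using assms rungs_rev by (simp add: quasi_prism_def)
  ultimately show ?thesis using assms by (simp add: quasi_prism_def hd_rev last_rev)
qed

end

section \<open>No strict quasi-prism between maximal vertices of \<open>A\<close> and
  \<open>B\<close>\<close>

context shortest_outer
begin

text \<open>The edge between \<open>a' = last S1\<close> and \<open>c = hd S3\<close> lies in a hole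
  that avoids \<open>d\<close>, and once \<open>a'\<close> is known to be in \<open>C\<close>, both
  ends of this edge are complete to the co-connected set \<open>insert d T\<close>. This forces a
  hat or a leap over the edge, and either is linked to the rest of the hole through
  \<open>b\<close>.\<close>

lemma no_special_quasi_prism_aux:
  assumes qp: "quasi_prism E S1 S2 S3 S4"
    and V: "set S1 \<subseteq> V" "set S2 \<subseteq> V" "set S3 \<subseteq> V" "set S4 \<subseteq> V"
    and S1: "2 \<le> length S1" and ab: "hd S1 = a" "hd S2 = b" "a \<in> A" "b \<in> B"
    and max: "\<And>x p. ipath E (a # x # p) \<Longrightarrow> set p \<subseteq> V \<Longrightarrow> p \<noteq> [] \<Longrightarrow> last p = b \<Longrightarrow> x \<notin> A"
    and cC: "hd S3 \<in> C" and dC: "hd S4 \<notin> C"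
  shows False
proof -
  define a' b' c c' d d' where "a' = last S1" and "b' = last S2" and "c = hd S3" and "c' = last S3"
    and "d = hd S4" and "d' = last S4"
  note defs = a'_def b'_def c_def c'_def d_def d'_def
  have ip: "ipath E S1" "ipath E S2" "ipath E S3" "ipath E S4" and len: "2 \<le> length S3" "2 \<le> length S4"
    using qp by (auto simp: quasi_prism_def)
  have ne: "S1 \<noteq> []" "S2 \<noteq> []" "S3 \<noteq> []" "S4 \<noteq> []" using ip by auto
  have x12: "u \<noteq> v" "\<not> E u v" "\<not> E v u" if "u \<in> set S1" "v \<in> set S2" for u v
    using qp that sym by (auto simp: quasi_prism_def)
  have x13: "u \<noteq> v" "E u v \<longleftrightarrow> u = a' \<and> v = c" "E v u \<longleftrightarrow> u = a' \<and> v = c" if "u \<in> set S1" "v \<in> set S3" for u v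
    using qp that E_commute[of u v] by (auto simp: quasi_prism_def defs)
  have x14: "u \<noteq> v" "E u v \<longleftrightarrow> u = a' \<and> v = d" "E v u \<longleftrightarrow> u = a' \<and> v = d" if "u \<in> set S1" "v \<in> set S4" for u v
    using qp that E_commute[of u v] by (auto simp: quasi_prism_def defs)
  have x23: "u \<noteq> v" "E u v \<longleftrightarrow> u = b' \<and> v = c'" "E v u \<longleftrightarrow> u = b' \<and> v = c'" if "u \<in> set S2" "v \<in> set S3" for u v
    using qp that E_commute[of u v] by (auto simp: quasi_prism_def defs)
  have x24: "u \<noteq> v" "E u v \<longleftrightarrow> u = b' \<and> v = d'" "E v u \<longleftrightarrow> u = b' \<and> v = d'" if "u \<in> set S2" "v \<in> set S4" for u v
    using qp that E_commute[of u v] by (auto simp: quasi_prism_def defs)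
  have x34: "u \<noteq> v" "E u v \<longleftrightarrow> u = c \<and> v = d \<or> u = c' \<and> v = d'" "E v u \<longleftrightarrow> u = c \<and> v = d \<or> u = c' \<and> v = d'"
    if "u \<in> set S3" "v \<in> set S4" for u v
    using qp that E_commute[of u v] by (auto simp: quasi_prism_def rungs_def defs)
  have mem: "a \<in> set S1" "a' \<in> set S1" "b \<in> set S2" "b' \<in> set S2" "c \<in> set S3" "c' \<in> set S3" "d \<in> set S4" "d' \<in> set S4"
    using ne ab by (auto simp: defs)
  have hl: "hd p \<noteq> last p" if "ipath E p" "2 \<le> length p" for p
    using ipath_distinct[OF that(1)] that(2) by (cases p; cases "tl p") auto
  have aa: "a \<noteq> a'" "c \<noteq> c'" "d \<noteq> d'" using hl[of S1] hl[of S3] hl[of S4] ip S1 len ab by (auto simp: defs)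
  have aC: "a \<in> C" "b \<in> C" using ab A_C B_C by auto
  have cC: "c \<in> C" and dC: "d \<notin> C" using cC dC by (auto simp: defs)
  have Tab: "E t a" "E t b" "E t c" "E a t" "E b t" "t \<in> V" if "t \<in> T" for t
    using that C aC cC T(1) by blast+
  have ST: "u \<notin> T" if "u \<in> set S1 \<union> set S2 \<union> set S3 \<union> set S4" for u
  proof
    assume "u \<in> T"
    then have "E a u" "E u b" using Tab by auto
    then show False using that x12[of u b] x12[of a u] x13(2)[of a u] x14(2)[of a u] mem aa by auto
  qed
  have cz: "\<not> E c u" if "u \<in> set z" for u
  proof -
    have "\<not> E c a" "\<not> E c b" "c \<noteq> a" "c \<noteq> b"
      using x13(3)[of a c] x23(3)[of b c] x13(1)[of a c] x23(1)[of b c] mem aa by auto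
    then show ?thesis using far_from_z[of c a u] cC A_clique B_clique ab that by blast
  qed
  have cd: "E c d" "E a' d" "E a' c" using x34(2)[of c d] x14(2)[of a' d] x13(2)[of a' c] mem by auto
  have step4: "E t a'" if t: "t \<in> T" "\<not> E t d" for t
  proof (rule ccontr)
    assume na: "\<not> E t a'"
    obtain X s Y where s: "S1 = X @ s # Y" "E t s" "\<forall>y\<in>set Y. \<not> E t y"
      using split_list_last_prop[of S1 "E t"] Tab[OF t(1)] mem(1) by blast
    have "Y \<noteq> []" using s na by (auto simp: defs)
    then obtain Y1 where Y: "Y = Y1 @ [a']" using s by (metis a'_def append_butlast_last_id last_ConsR last_appendR list.discI)
    have iY: "ipath E ((s # Y1) @ [a'])" using ip(1) s Y by (auto simp: ipath_append)
    then have iY0: "ipath E (s # Y1)" "a' \<notin> set (s # Y1)" "\<forall>v\<in>set (s # Y1). E a' v \<longleftrightarrow> v = last (s # Y1)"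
      unfolding ipath_snoc by auto
    have sub: "v \<in> set S1" "v \<noteq> a'" if "v \<in> set (s # Y1)" for v using that iY0(2) s Y by auto
    have tn: "t \<notin> set S1" using ST[of t] t(1) by auto
    have irev: "ipath E (rev (s # Y1))" using iY0(1) by (simp only: ipath_rev)
    have "E t v \<longleftrightarrow> v = s" if "v \<in> set (s # Y1)" for v
      using that s(2,3) Y by auto
    then have ft: "ipath E (rev (s # Y1) @ [t])"
      using irev tn sub by (subst ipath_snoc) (auto simp del: rev.simps simp: last_rev)
    show False
    proof (rule hat_connected[of d a' c "rev (s # Y1) @ [t]" "set S4 \<union> set S2" b t])
      show "conn E (set S4 \<union> set S2)"
        using conn_Un[OF conn_path[OF ip(4)] conn_path[OF ip(2)] mem(8,4)] x24(3)[of b' d'] mem by blast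
      show "\<not> E k a' \<and> \<not> E k c" if "k \<in> set S4 \<union> set S2" "k \<noteq> d" for k
        using that x14(3)[of a' k] x12(3)[of a' k] x34(3)[of c k] x23(2)[of k c] mem aa by auto
      show "E a' v \<longleftrightarrow> v = hd (rev (s # Y1) @ [t])" if "v \<in> set (rev (s # Y1) @ [t])" for v
      proof -
        have "hd (rev (s # Y1) @ [t]) = last (s # Y1)" by (simp add: hd_append hd_rev)
        then show ?thesis using that iY0(3) na sym tn sub(1)[of "last (s # Y1)"] by auto
      qed
      show "E c v \<longleftrightarrow> v = last (rev (s # Y1) @ [t])" if "v \<in> set (rev (s # Y1) @ [t])" for v
        using that x13(3)[OF sub(1) mem(5), of v] sub(2)[of v] Tab(3)[OF t(1)] sym tn sub(1)[of v] by auto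
      show "\<not> E d v" if "v \<in> set (rev (s # Y1) @ [t])" for v
        using that x14(3)[OF sub(1) mem(7), of v] sub(2)[of v] t(2) sym by auto
      show "set (rev (s # Y1) @ [t]) \<subseteq> V" using sub(1) V(1) Tab(6)[OF t(1)] by auto
      show "E d a'" "E d c" using cd sym by blast+
    qed (use ft cd V mem Tab[OF t(1)] in auto)
  qed
  \<comment> \<open>Every vertex of \<open>T\<close> sees \<open>a'\<close> or \<open>d\<close>, and
    \<open>b\<close> is complete to \<open>T\<close> but misses both.\<close>
  have a'C: "a' \<in> C"
  proof (rule ccontr)
    assume "a' \<notin> C"
    then obtain t0 where t0: "t0 \<in> T" "\<not> E t0 a'" using V(1) mem(2) sym by (auto simp: complete_to_def)
    obtain t1 where t1: "t1 \<in> T" "\<not> E t1 d" using dC V(4) mem(7) sym by (auto simp: complete_to_def)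
    show False
      by (rule antipath_bridge[OF T(3,1) t0 t1, of b])
        (use step4 cd V mem ST Tab x12(3)[of a' b] x24(2)[of b d] aa in auto)
  qed
  obtain S0 where S0: "S1 = S0 @ [a']" using ne(1) by (metis a'_def append_butlast_last_id)
  have S0n: "S0 \<noteq> []" using S0 S1 by auto
  obtain S3' where S3': "S3 = c # S3'" using ne(3) by (metis c_def list.collapse)
  have S3n: "S3' \<noteq> []" using S3' len by auto
  have i0: "ipath E S0" "a' \<notin> set S0" "\<And>v. v \<in> set S0 \<Longrightarrow> E a' v \<longleftrightarrow> v = last S0"
    using ip(1) S0n unfolding S0 ipath_snoc by auto
  have i3: "ipath E S3'" "c \<notin> set S3'" "\<And>v. v \<in> set S3' \<Longrightarrow> E c v \<longleftrightarrow> v = hd S3'"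
    using ip(3) S3n unfolding S3' ipath_Cons by auto
  have sub: "\<And>v. v \<in> set S0 \<Longrightarrow> v \<in> set S1" "\<And>v. v \<in> set S3' \<Longrightarrow> v \<in> set S3" "a \<in> set S0" "c' \<in> set S3'"
    using S0 S3' S0n S3n ab by (auto simp: c'_def hd_append)
  \<comment> \<open>If \<open>a'\<close> were in \<open>A\<close>, then \<open>S1\<close> would be
    \<open>[a, a']\<close>, and the path on through \<open>S3\<close> and \<open>S2\<close> to
    \<open>b\<close> would contradict the choice of \<open>a\<close>.\<close>
  have a'A: "a' \<notin> A"
  proof
    assume "a' \<in> A"
    then have e: "E a' a" using A_clique ab aa by blast
    then have "a = last S0" using i0(3)[OF sub(3)] by simp
    moreover have "a = hd S0" using ab S0 S0n by simp
    ultimately have "S0 = [a]" using hl[OF i0(1)] S0n by (cases S0; cases "tl S0") auto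
    have i23: "ipath E (S3 @ rev S2)"
      using ip mem x23 by (subst ipath_append) (auto simp: hd_rev defs)
    have "E a' v \<longleftrightarrow> v = hd (S3 @ rev S2)" if "v \<in> set (S3 @ rev S2)" for v
      using that x13(2)[of a' v] x12[of a' v] mem S3' by auto
    then have i123: "ipath E (a' # S3 @ rev S2)"
      using i23 x13(1)[of a'] x12(1)[of a'] mem by (subst ipath_Cons) auto
    have "E a v \<longleftrightarrow> v = a'" if "v \<in> set (a' # S3 @ rev S2)" for v
      using that e sym x13(2)[of a v] x12[of a v] mem aa x13(1)[of a' v] x12(1)[of a' v] by auto
    then have "ipath E (a # a' # S3 @ rev S2)"
      using i123 x13(1)[of a] x12(1)[of a] mem aa by (subst ipath_Cons) auto
    then have "a' \<notin> A"
      by (rule max) (use V ne ab in \<open>auto simp: last_rev\<close>)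
    then show False using \<open>a' \<in> A\<close> by simp
  qed
  have a'z: "\<not> E a' u" if "u \<in> set z" for u
    using far_from_z[OF a'C a'A, of b u] that ab x12[OF mem(2,3)] B_clique by blast
  \<comment> \<open>\<open>z\<close> links \<open>S0\<close> to \<open>S2\<close>, so the remaining
    neighbours of \<open>a'\<close> and of \<open>c\<close> are joined without the use of
    \<open>S4\<close>.\<close>
  define F where "F = set S0 \<union> set z \<union> set S2 \<union> set S3'"
  have "conn E (set S0 \<union> set z)"
    using conn_Un[OF conn_path[OF i0(1)] conn_path[OF z(2)] sub(3) z(6)] A_z[OF ab(3) z(6)] by blast
  then have "conn E (set S0 \<union> set z \<union> set S2)"
    using conn_Un[of "set S0 \<union> set z" "set S2" "last z" b] conn_path[OF ip(2)] mem z(7) B_z[OF ab(4) z(7)] sym by blast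
  then have cF: "conn E F" unfolding F_def
    using conn_Un[of "set S0 \<union> set z \<union> set S2" "set S3'" b' c'] conn_path[OF i3(1)] mem sub x23(2)[of b' c'] by blast
  have Fa': "E a' v \<longleftrightarrow> v = last S0" if "v \<in> F" for v
    using that i0(3) a'z x12[of a' v] x13(2)[of a' v] x12[of "last S0" v] x13(1)[of "last S0" v]
      mem sub i3(2) S0n a'z[of "last S0"] i0(3)[of "last S0"] unfolding F_def by auto
  have Fc: "E c v \<longleftrightarrow> v = hd S3'" if "v \<in> F" for v
    using that i3(3) cz x23(3)[of v c] x13(3)[of v c] mem sub i0(2) S3n aa cz[of "hd S3'"] i3(3)[of "hd S3'"]
      x13(1)[of v "hd S3'"] x23(1)[of v "hd S3'"] unfolding F_def by auto
  have inF: "last S0 \<in> F" "hd S3' \<in> F" using S0n S3n by (auto simp: F_def)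
  obtain f where f: "ipath E f" "set f \<subseteq> F" "E a' (hd f)" "E c (last f)"
     "\<And>w. w \<in> set f \<Longrightarrow> E a' w \<Longrightarrow> w = hd f" "\<And>w. w \<in> set f \<Longrightarrow> E c w \<Longrightarrow> w = last f"
    using shortest_path[OF cF inF(1), of "E a'" "hd S3'" "E c"] inF Fa' Fc by blast
  have fn: "f \<noteq> []" "hd f \<in> set f" "last f \<in> set f" using f(1) by auto
  have hf: "hd f = last S0" "last f = hd S3'" using f(2-4) fn Fa' Fc by blast+
  have FV: "F \<subseteq> V" using V z(3) sub by (auto simp: F_def)
  have FT: "v \<notin> T" if "v \<in> F" for v using that ST[of v] z(4) sub by (auto simp: F_def)
  have nF: "a' \<notin> F" "c \<notin> F" "d \<notin> F"
  proof -
    have "a' \<notin> set z" "c \<notin> set z" "d \<notin> set z"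
      using a'z cz cd sym by blast+
    moreover have "a' \<notin> set S2" "a' \<notin> set S3'" "c \<notin> set S0" "c \<notin> set S2"
        "d \<notin> set S0" "d \<notin> set S2" "d \<notin> set S3'"
      using x12(1)[OF mem(2), of a'] x13(1)[OF mem(2) sub(2), of a'] x13(1)[OF sub(1) mem(5), of c]
        x23(1)[OF _ mem(5), of c] x14(1)[OF sub(1) mem(7), of d] x24(1)[OF _ mem(7), of d]
        x34(1)[OF sub(2) mem(7), of d] by blast+
    ultimately show "a' \<notin> F" "c \<notin> F" "d \<notin> F"
      using i0(2) i3(2) unfolding F_def by blast+
  qed
  have e12: "\<not> E (hd f) (last f)" "hd f \<noteq> last f"
    using hf x13[of "last S0" "hd S3'"] sub S0n S3n i0(2) by auto
  have f2: "2 \<le> length f" using e12(2) fn(1) by (cases f; cases "tl f") auto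
  have f2': "length f \<noteq> 2"
  proof
    assume l2: "length f = 2"
    obtain p q where "f = [p, q]" using l2 by (auto simp: length_Suc_conv numeral_2_eq_2)
    then show False using e12 f(1) by auto
  qed
  have nf: "a' \<notin> set f" "c \<notin> set f" "d \<notin> set f" using nF f(2) by auto
  have ipf: "ipath E (f @ [c])" using f nf by (subst ipath_snoc) auto
  have "E a' v \<longleftrightarrow> v = hd f \<or> v = c" if "v \<in> set (f @ [c])" for v
    using that f(3) f(5)[of v] cd(3) by auto
  then have "hole E a' (f @ [c])"
    using ipf nf fn(1) f2 x13(1)[OF mem(2,5)] by (simp add: hole_def)
  then have "odd (length (f @ [c]))"
    by (rule hole_odd) (use a'C cC C(1) f(2) FV in auto)
  then have ev: "even (length f)" by simp
  have np: "near_path a' f c"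
    unfolding near_path_def
  proof (intro conjI)
    show "ipath E (a' # f)" using f(1,3,5) nf by (subst ipath_Cons) blast
    show "a' \<noteq> c" using x13(1)[OF mem(2,5)] .
    show "set f \<subseteq> V" using f(2) FV by blast
  qed (use ipf fn ev a'C cC C(1) in blast)+
  note nd = near_pathD[OF np]
  \<comment> \<open>\<open>K\<close> leads from a neighbour of \<open>last f\<close> to
    \<open>b\<close> and contains no neighbour of \<open>a'\<close> or \<open>c\<close>; it links
    every hat to \<open>f\<close>.\<close>
  define K where "K = set S2 \<union> set (tl S3')"
  have KV: "K \<subseteq> V" using V(2,3) sub(2) list.set_sel(2)[OF S3n] by (auto simp: K_def)
  have K: "conn E K" "\<exists>k\<in>K. E k (last f)" "\<And>k. k \<in> K \<Longrightarrow> \<not> E k a' \<and> \<not> E k c"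
  proof -
    have b'c': "E b' c'" using x23(2)[of b' c'] mem by auto
    have t: "v \<in> set (tl S3') \<Longrightarrow> v \<in> set S3' \<and> v \<noteq> hd S3'" for v
      using ipath_distinct[OF i3(1)] S3n by (cases S3') auto
    show "\<And>k. k \<in> K \<Longrightarrow> \<not> E k a' \<and> \<not> E k c"
    proof -
      fix k assume "k \<in> K"
      then consider "k \<in> set S2" | "k \<in> set (tl S3')" by (auto simp: K_def)
      then show "\<not> E k a' \<and> \<not> E k c"
      proof cases
        case 1
        then show ?thesis using x12(3)[OF mem(2) 1] x23(2)[OF 1 mem(5)] aa by simp
      next
        case 2
        then have k: "k \<in> set S3'" "k \<noteq> hd S3'" using t by auto
        then have "\<not> E c k" "k \<noteq> c" using i3 by auto
        then show ?thesis using x13(3)[OF mem(2) sub(2)[OF k(1)]] sym by blast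
      qed
    qed
    show "conn E K"
    proof (cases "tl S3' = []")
      case True
      then show ?thesis using conn_path ip(2) by (simp add: K_def)
    next
      case False
      then have "ipath E (tl S3')" "last (tl S3') = c'" using i3(1) S3' S3n
        by (cases S3'; auto simp: ipath_Cons c'_def)+
      then show ?thesis unfolding K_def
        using conn_Un[OF conn_path[OF ip(2)] conn_path[of "tl S3'"] mem(4), of c'] False b'c'
        by (metis last_in_set)
    qed
    show "\<exists>k\<in>K. E k (last f)"
    proof (cases "tl S3' = []")
      case True
      then have "last f = c'" using hf S3' S3n by (cases S3') (auto simp: c'_def)
      then show ?thesis using b'c' mem by (auto simp: K_def)
    next
      case False
      then have "E (hd S3') (hd (tl S3'))" "hd (tl S3') \<in> K" using i3(1) S3n
        by (cases S3'; auto simp: ipath_Cons K_def)+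
      then show ?thesis using hf sym by metis
    qed
  qed
  have hat: False if u: "E u a'" "E u c" "u \<in> V" "\<And>v. v \<in> set f \<Longrightarrow> \<not> E u v"
      "conn E L" "u \<in> L" "K \<subseteq> L" "L \<subseteq> V" "\<And>k. k \<in> L \<Longrightarrow> k \<noteq> u \<Longrightarrow> k \<notin> K \<Longrightarrow> \<not> E k a' \<and> \<not> E k c" for u L
  proof -
    obtain k where "k \<in> K" "E k (last f)" using K by blast
    show False
    proof (rule hat_connected[of u a' c f L k "last f"])
      show "\<not> E k a' \<and> \<not> E k c" if "k \<in> L" "k \<noteq> u" for k
        using u(9)[OF that] K(3)[of k] by blast
      show "set f \<subseteq> V" using f(2) FV by blast
      show "k \<in> L" using \<open>k \<in> K\<close> u(7) by blast
    qed (use u nd cd(3) fn a'C cC C(1) \<open>E k (last f)\<close> in blast)+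
  qed
  let ?T = "insert d T"
  have dd: "d \<in> V" "d \<notin> T" using V mem ST[of d] by auto
  have "(\<exists>t\<in>?T. \<forall>u\<in>set f. \<not> E t u) \<or> E a' c \<and> leap ?T f"
  proof (rule near_path_no_hat[OF np])
    show "?T \<subseteq> V" "?T \<noteq> {}" using T dd by auto
    show "conn (co E) ?T" using conn_insert_T[OF dd(2,1) dC] .
    show "a' \<in> complete_to E V ?T" "c \<in> complete_to E V ?T"
      using a'C cC cd by (auto simp: complete_to_def)
    show "set f \<inter> ?T = {}" using nf FT f(2) by auto
    show "set f \<inter> complete_to E V ?T = {}"
    proof -
      have "v \<notin> complete_to E V ?T" if v: "v \<in> F" for v
      proof
        assume "v \<in> complete_to E V ?T"
        then have vC: "v \<in> C" "E v d" by (auto simp: complete_to_def)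
        then show False
          using v z(5) x14(2)[of v d] x24(2)[of v d] x34(2)[of v d] mem sub aa i0(2) i3(2)
          unfolding F_def by blast
      qed
      then show ?thesis using f(2) by auto
    qed
  qed (use f2' in auto)
  then show False
  proof
    assume "\<exists>t\<in>?T. \<forall>u\<in>set f. \<not> E t u"
    then obtain u where u: "u = d \<or> u \<in> T" "\<And>v. v \<in> set f \<Longrightarrow> \<not> E u v" by blast
    from u(1) show False
    proof
      assume "u = d"
      show False
      proof (rule hat[of d "set S4 \<union> K"])
        show "conn E (set S4 \<union> K)"
          using conn_Un[OF conn_path[OF ip(4)] K(1) mem(8), of b'] x24(3)[of b' d'] mem by (auto simp: K_def)
        show "\<not> E k a' \<and> \<not> E k c" if "k \<in> set S4 \<union> K" "k \<noteq> d" "k \<notin> K" for k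
          using that x14(3)[of a' k] x34(3)[of c k] mem aa by auto
      qed (use u \<open>u = d\<close> cd sym V KV mem in auto)
    next
      assume uT: "u \<in> T"
      have "b \<in> K" using mem by (auto simp: K_def)
      then have "conn E (insert u K)" using conn_insert[OF K(1)] Tab[OF uT] by blast
      then show False
        using hat[of u "insert u K"] u Tab[OF uT] KV C(3)[OF a'C uT] by auto
    qed
  next
    assume "E a' c \<and> leap ?T f"
    then obtain x y where xy: "x \<in> ?T" "y \<in> ?T" "x \<noteq> y" "\<not> E x y"
      "\<And>v. v \<in> set f \<Longrightarrow> E x v \<longleftrightarrow> v = hd f" "\<And>v. v \<in> set f \<Longrightarrow> E y v \<longleftrightarrow> v = last f"
      unfolding leap_def by blast
    \<comment> \<open>\<open>d\<close> sees neither end of \<open>f\<close>, so the leap lies in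
      \<open>T\<close>, and \<open>b\<close> links its two vertices.\<close>
    have "x \<noteq> d" using xy(5)[OF fn(2)] x14(3)[of "last S0" d] hf mem sub S0n i0(2) by auto
    moreover have "y \<noteq> d" using xy(6)[OF fn(3)] x34(3)[of "hd S3'" d] hf mem sub S3n i3(2) aa by auto
    ultimately have xyT: "x \<in> T" "y \<in> T" using xy by auto
    have nb: "\<not> E b a'" "\<not> E b (hd f)" using x12(3) mem hf sub S0n by auto
    have xye: "E x a'" "E y a'" "\<not> E y x" using xyT C(3)[OF a'C] xy(4) sym by blast+
    have Eb: "E x b" "E b x" "E b y" using Tab xyT by auto
    show False
      using leap_connected[of "rev f" a' "insert x {b}" y x b y] nd np xy xyT xye nb Eb Tab V mem
        conn_insert[of "{b}" b x] a'C C(1)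
      by (auto simp: hd_rev last_rev near_path_def)
  qed
qed

text \<open>Otherwise \<open>last S1\<close> is a hat over the edge \<open>c d\<close>: the rest of
  \<open>S3\<close> and of \<open>S4\<close> form the path, and \<open>S1\<close>, \<open>W\<close>,
  \<open>S2\<close> lead from the hat to it. The lemma is used with a vertex of \<open>T\<close> and
  with \<open>z\<close> in the place of \<open>W\<close>.\<close>

lemma quasi_prism_hat:
  assumes qp: "quasi_prism E S1 S2 S3 S4"
    and V: "set S1 \<subseteq> V" "set S2 \<subseteq> V" "set S3 \<subseteq> V" "set S4 \<subseteq> V" "W \<subseteq> V"
    and W: "conn E W" "w1 \<in> W" "E w1 (hd S1)" "w2 \<in> W" "E w2 (hd S2)"
  shows "\<exists>w\<in>W. E w (hd S3) \<or> E w (hd S4)"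
proof (rule ccontr)
  assume nW: "\<not> ?thesis"
  have ip: "ipath E S1" "ipath E S2" "ipath E S3" "ipath E S4" and len: "2 \<le> length S3" "2 \<le> length S4"
    and r: "rungs E S3 S4"
    using qp by (auto simp: quasi_prism_def)
  obtain c S3' where S3: "S3 = c # S3'" "S3' \<noteq> []" using len by (cases S3) (auto simp: Suc_le_eq)
  obtain d S4' where S4: "S4 = d # S4'" "S4' \<noteq> []" using len by (cases S4) (auto simp: Suc_le_eq)
  have ne: "S1 \<noteq> []" "S2 \<noteq> []" using ip by auto
  have i3: "ipath E S3'" "c \<notin> set S3'" "\<And>v. v \<in> set S3' \<Longrightarrow> E c v \<longleftrightarrow> v = hd S3'"
    using ip(3) S3 by (auto simp: ipath_Cons)
  have i4: "ipath E S4'" "d \<notin> set S4'" "\<And>v. v \<in> set S4' \<Longrightarrow> E d v \<longleftrightarrow> v = hd S4'"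
    using ip(4) S4 by (auto simp: ipath_Cons)
  have l: "last S3 = last S3'" "last S4 = last S4'" using S3 S4 by auto
  have mem: "last S3' \<in> set S3'" "last S4' \<in> set S4'" "hd S3' \<in> set S3'" "hd S4' \<in> set S4'"
    "hd S1 \<in> set S1" "last S1 \<in> set S1" "hd S2 \<in> set S2" "last S2 \<in> set S2"
    using S3 S4 ne by auto
  have x34: "u \<noteq> v" "E u v \<longleftrightarrow> u = c \<and> v = d \<or> u = last S3' \<and> v = last S4'"
     "E v u \<longleftrightarrow> u = c \<and> v = d \<or> u = last S3' \<and> v = last S4'"
    if "u \<in> insert c (set S3')" "v \<in> insert d (set S4')" for u v
    using r that l S3 S4 E_commute[of u v] by (auto simp: rungs_def)
  have x1: "u \<noteq> v" "E u v \<longleftrightarrow> u = last S1 \<and> (v = c \<or> v = d)"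
    if "u \<in> set S1" "v \<in> set S3 \<union> set S4" for u v
    using qp that S3 S4 x34(1)[of v d] x34(1)[of c v] by (auto simp: quasi_prism_def)
  have x2: "u \<noteq> v" "E u v \<longleftrightarrow> u = last S2 \<and> (v = last S3' \<or> v = last S4')"
    if "u \<in> set S2" "v \<in> set S3 \<union> set S4" for u v
  proof -
    have q: "\<And>v. v \<in> set S3 \<Longrightarrow> u \<noteq> v \<and> (E u v \<longleftrightarrow> u = last S2 \<and> v = last S3')"
        "\<And>v. v \<in> set S4 \<Longrightarrow> u \<noteq> v \<and> (E u v \<longleftrightarrow> u = last S2 \<and> v = last S4')"
      using qp that(1) l by (simp_all add: quasi_prism_def)
    have n: "v \<noteq> last S4'" if "v \<in> set S3" for v using x34(1)[of v "last S4'"] that S3 mem by auto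
    have n': "v \<noteq> last S3'" if "v \<in> set S4" for v using x34(1)[of "last S3'" v] that S4 mem by auto
    from that(2) show "u \<noteq> v" "E u v \<longleftrightarrow> u = last S2 \<and> (v = last S3' \<or> v = last S4')"
      using q[of v] n[of v] n'[of v] by auto
  qed
  let ?f = "S3' @ rev S4'"
  have ipf: "ipath E ?f"
  proof (subst ipath_append, intro disjI2 conjI ballI)
    fix u v assume "u \<in> set S3'" "v \<in> set (rev S4')"
    then show "u \<noteq> v" "E u v \<longleftrightarrow> u = last S3' \<and> v = hd (rev S4')"
      using x34[of u v] i3(2) S4(2) by (auto simp: hd_rev)
  qed (use i3 i4 in simp_all)
  show False
  proof (rule hat_connected[of "last S1" c d ?f "set S1 \<union> W \<union> set S2" "last S2" "last S3'"])
    have "conn E (set S1 \<union> W)"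
      using conn_Un[OF conn_path[OF ip(1)] W(1) mem(5) W(2)] W(3) sym by blast
    then show "conn E (set S1 \<union> W \<union> set S2)"
      using conn_Un[OF _ conn_path[OF ip(2)] _ mem(7), of "set S1 \<union> W" w2] W(4,5) by blast
    show "\<not> E k c \<and> \<not> E k d" if "k \<in> set S1 \<union> W \<union> set S2" "k \<noteq> last S1" for k
      using that nW x1(2)[of k c] x1(2)[of k d] x2(2)[of k c] x2(2)[of k d] S3 S4 i3(2) i4(2) mem
        x34(1)[of c "last S4'"] x34(1)[of "last S3'" d] by auto
    show "E (last S1) c" "E (last S1) d" using x1(2)[of "last S1"] mem S3 S4 by auto
    show "E c d" using x34(2)[of c d] by auto
    show "c \<in> V" "d \<in> V" "set ?f \<subseteq> V" "set S1 \<union> W \<union> set S2 \<subseteq> V" using V S3 S4 by auto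
    show "2 \<le> length ?f" using S3(2) S4(2) by (cases S3'; cases S4') auto
    show "E c v \<longleftrightarrow> v = hd ?f" if "v \<in> set ?f" for v
      using that i3 x34(2)[of c v] S3(2) i4(2) x34(1)[of "hd S3'" v] mem by auto
    show "E d v \<longleftrightarrow> v = last ?f" if "v \<in> set ?f" for v
      using that i4 x34(3)[of v d] S4(2) i3(2) x34(1)[of v "hd S4'"] mem by (auto simp: last_rev)
    show "\<not> E (last S1) v" if "v \<in> set ?f" for v
      using that x1(2)[of "last S1" v] mem S3 S4 i3(2) i4(2) x34(1)[of v d] x34(1)[of c v] by auto
    show "E (last S2) (last S3')" using x2(2)[of "last S2" "last S3'"] mem S3 by auto
  qed (use ipf mem in auto)
qed

text \<open>Every vertex of \<open>T\<close> sees \<open>c\<close> or \<open>d\<close>, so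
  \<open>antipath_bridge\<close> places one of them in \<open>C\<close>. They are not both there,
  since a vertex of \<open>z\<close> also sees \<open>c\<close> or \<open>d\<close>, whereas
  vertices of \<open>C\<close> that miss \<open>a\<close> and \<open>b\<close> are far from
  \<open>z\<close>. The remaining two cases differ by exchanging \<open>S3\<close> and
  \<open>S4\<close>.\<close>

lemma no_special_quasi_prism:
  assumes qp: "quasi_prism E S1 S2 S3 S4"
    and V: "set S1 \<subseteq> V" "set S2 \<subseteq> V" "set S3 \<subseteq> V" "set S4 \<subseteq> V"
    and S1: "2 \<le> length S1" and ab: "hd S1 = a" "hd S2 = b" "a \<in> A" "b \<in> B"
    and max: "\<And>x p. ipath E (a # x # p) \<Longrightarrow> set p \<subseteq> V \<Longrightarrow> p \<noteq> [] \<Longrightarrow> last p = b \<Longrightarrow> x \<notin> A"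
  shows False
proof -
  define c d where "c = hd S3" and "d = hd S4"
  have aC: "a \<in> C" "b \<in> C" using ab A_C B_C by auto
  have ne: "S1 \<noteq> []" "S2 \<noteq> []" "S3 \<noteq> []" "S4 \<noteq> []" "ipath E S1" "ipath E S3" "ipath E S4"
     "2 \<le> length S3" "2 \<le> length S4"
    using qp by (auto simp: quasi_prism_def)
  have mem: "c \<in> set S3" "d \<in> set S4" "a \<in> set S1" "b \<in> set S2" using ne ab by (auto simp: c_def d_def)
  have hl: "hd p \<noteq> last p" if "ipath E p" "2 \<le> length p" for p
    using ipath_distinct[OF that(1)] that(2) by (cases p; cases "tl p") auto
  have x: "\<And>v. v \<in> set S3 \<Longrightarrow> a \<noteq> v \<and> (E a v \<longleftrightarrow> a = last S1 \<and> v = hd S3)"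
      "\<And>v. v \<in> set S4 \<Longrightarrow> a \<noteq> v \<and> (E a v \<longleftrightarrow> a = last S1 \<and> v = hd S4)"
      "\<And>v. v \<in> set S3 \<Longrightarrow> b \<noteq> v \<and> (E b v \<longleftrightarrow> b = last S2 \<and> v = last S3)"
      "\<And>v. v \<in> set S4 \<Longrightarrow> b \<noteq> v \<and> (E b v \<longleftrightarrow> b = last S2 \<and> v = last S4)"
      "rungs E S3 S4"
    using qp mem(3,4) by (simp_all add: quasi_prism_def)
  have n: "\<not> E a c" "\<not> E a d" "\<not> E b c" "\<not> E b d" "a \<noteq> c" "a \<noteq> d" "b \<noteq> c" "b \<noteq> d"
    using x(1)[OF mem(1)] x(2)[OF mem(2)] x(3)[OF mem(1)] x(4)[OF mem(2)]
      hl[OF ne(5) S1] hl[OF ne(6,8)] hl[OF ne(7,9)] ab by (auto simp: c_def d_def)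
  have "E c d" using x(5) mem by (simp add: rungs_def c_def d_def)
  note n = n this
  have Tcd: "E t c \<or> E t d" if t: "t \<in> T" for t
    using quasi_prism_hat[OF qp V, of "{t}" t t] t T(1) C(3)[OF aC(1) t] C(3)[OF aC(2) t] ab
    by (auto simp: c_def d_def)
  have nT: "c \<notin> T" "d \<notin> T" using n C(2)[OF aC(1)] by blast+
  have "c \<in> C \<or> d \<in> C"
  proof (rule ccontr)
    assume "\<not> ?thesis"
    then obtain t0 t1 where t: "t0 \<in> T" "\<not> E t0 c" "t1 \<in> T" "\<not> E t1 d"
      using V(3,4) mem sym by (auto simp: complete_to_def subset_iff) blast
    show False
      by (rule antipath_bridge[OF T(3,1) t, of b]) (use Tcd nT n V mem C(2)[OF aC(2)] in auto)
  qed
  moreover have "\<not> (c \<in> C \<and> d \<in> C)"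
  proof
    assume cd: "c \<in> C \<and> d \<in> C"
    have "\<exists>w\<in>set z. E w c \<or> E w d"
      using quasi_prism_hat[OF qp V z(3) conn_path[OF z(2)] z(6) _ z(7)] A_z[OF ab(3) z(6)] B_z[OF ab(4) z(7)] ab sym
      by (auto simp: c_def d_def)
    moreover have "\<not> E x u" if "x \<in> {c, d}" "u \<in> set z" for x u
    proof -
      have "x \<in> C" "\<not> E a x" "\<not> E b x" "a \<noteq> x" "b \<noteq> x" using that cd n by auto
      then show ?thesis
        using far_from_z[of x a u] A_clique[OF ab(3), of x] B_clique[OF ab(4), of x] ab that(2) sym by blast
    qed
    ultimately show False using sym by blast
  qed
  ultimately consider "c \<in> C" "d \<notin> C" | "d \<in> C" "c \<notin> C" by blast
  then show False
  proof cases
    case 1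
    show False
      by (rule no_special_quasi_prism_aux[OF qp V S1 ab])
        (erule (3) max | use 1 in \<open>simp add: c_def d_def\<close>)+
  next
    case 2
    show False
      by (rule no_special_quasi_prism_aux[OF quasi_prism_swap[OF qp] V(1,2,4,3) S1 ab])
        (erule (3) max | use 2 in \<open>simp add: c_def d_def\<close>)+
  qed
qed

lemma special_pair:
  obtains a b where "a \<in> C" "b \<in> C" "a \<noteq> b"
    "\<And>Q. ipath E Q \<Longrightarrow> set Q \<subseteq> V \<Longrightarrow> hd Q = a \<Longrightarrow> last Q = b \<Longrightarrow> odd (length Q)"
    "\<And>S1 S2 S3 S4. quasi_prism E S1 S2 S3 S4 \<Longrightarrow> set S1 \<union> set S2 \<union> set S3 \<union> set S4 \<subseteq> V \<Longrightarrow>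
       hd S1 = a \<Longrightarrow> hd S2 = b \<Longrightarrow> 2 \<le> length S1 \<or> 2 \<le> length S2 \<Longrightarrow> False"
proof -
  interpret r: shortest_outer E V T \<beta> "rev z" \<alpha> by (rule rev_shortest_outer)
  obtain a b where ab: "a \<in> A" "b \<in> B"
    and 1: "\<And>x p. ipath E (a # x # p) \<Longrightarrow> set p \<subseteq> V \<Longrightarrow> p \<noteq> [] \<Longrightarrow> last p = b \<Longrightarrow> x \<notin> A"
    and 2: "\<And>x p. ipath E (b # x # p) \<Longrightarrow> set p \<subseteq> V \<Longrightarrow> p \<noteq> [] \<Longrightarrow> last p = a \<Longrightarrow> x \<notin> B"
    and 3: "\<And>Q. ipath E Q \<Longrightarrow> set Q \<subseteq> V \<Longrightarrow> hd Q = a \<Longrightarrow> last Q = b \<Longrightarrow> odd (length Q)"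
    by (rule special_ends) blast
  have 4: False if q: "quasi_prism E S1 S2 S3 S4" "set S1 \<union> set S2 \<union> set S3 \<union> set S4 \<subseteq> V"
    "hd S1 = a" "hd S2 = b" "2 \<le> length S1 \<or> 2 \<le> length S2" for S1 S2 S3 S4
  proof -
    have V: "set S1 \<subseteq> V" "set S2 \<subseteq> V" "set S3 \<subseteq> V" "set S4 \<subseteq> V"
      "set (rev S3) \<subseteq> V" "set (rev S4) \<subseteq> V" using q(2) by auto
    from q(5) show False
    proof
      assume l: "2 \<le> length S1"
      show False by (rule no_special_quasi_prism[OF q(1) V(1-4) l q(3,4) ab]) (erule (3) 1)
    next
      assume l: "2 \<le> length S2"
      show False
        by (rule r.no_special_quasi_prism[OF quasi_prism_rev[OF q(1)] V(2,1,5,6) l q(4,3), unfolded rev_AB, OF ab(2,1)])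
          (erule (3) 2)
    qed
  qed
  show thesis
  proof (rule that)
    show "a \<in> C" "b \<in> C" "a \<noteq> b" using ab A_C B_C AB by auto
    show "odd (length Q)" if "ipath E Q" "set Q \<subseteq> V" "hd Q = a" "last Q = b" for Q
      by (rule 3[OF that])
    show False if "quasi_prism E S1 S2 S3 S4" "set S1 \<union> set S2 \<union> set S3 \<union> set S4 \<subseteq> V"
      "hd S1 = a" "hd S2 = b" "2 \<le> length S1 \<or> 2 \<le> length S2" for S1 S2 S3 S4
      by (rule 4[OF that])
  qed
qed

end

definition special :: "('a \<Rightarrow> 'a \<Rightarrow> bool) \<Rightarrow> 'a set \<Rightarrow> 'a \<Rightarrow> 'a \<Rightarrow> bool" where
  "special E V a b \<longleftrightarrow> a \<in> V \<and> b \<in> V \<and> a \<noteq> b \<and>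
     (\<forall>Q. ipath E Q \<and> set Q \<subseteq> V \<and> hd Q = a \<and> last Q = b \<longrightarrow> odd (length Q)) \<and>
     (\<forall>S1 S2 S3 S4. quasi_prism E S1 S2 S3 S4 \<and> set S1 \<union> set S2 \<union> set S3 \<union> set S4 \<subseteq> V \<and>
        hd S1 = a \<and> hd S2 = b \<longrightarrow> length S1 < 2 \<and> length S2 < 2)"

text \<open>With the same path through \<open>S4\<close>, this covers a quasi-prism by induced paths
  between its two ends, so that facts about such paths apply to all its vertices.\<close>

lemma (in ugraph) quasi_prism_path:
  assumes "quasi_prism E S1 S2 S3 S4"
  shows "ipath E (S1 @ S3 @ rev S2)"
proof -
  have q: "ipath E S1" "ipath E S2" "ipath E S3"
    "\<And>u v. u \<in> set S1 \<Longrightarrow> v \<in> set S2 \<Longrightarrow> u \<noteq> v \<and> \<not> E u v"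
    "\<And>u v. u \<in> set S1 \<Longrightarrow> v \<in> set S3 \<Longrightarrow> u \<noteq> v \<and> (E u v \<longleftrightarrow> u = last S1 \<and> v = hd S3)"
    "\<And>u v. u \<in> set S2 \<Longrightarrow> v \<in> set S3 \<Longrightarrow> u \<noteq> v \<and> (E u v \<longleftrightarrow> u = last S2 \<and> v = last S3)"
    using assms by (simp_all add: quasi_prism_def)
  have ne: "S3 \<noteq> []" "hd S3 \<in> set S3" using q by auto
  have "ipath E (S3 @ rev S2)"
  proof (subst ipath_append, intro disjI2 conjI ballI)
    fix u v assume "u \<in> set S3" "v \<in> set (rev S2)"
    then show "u \<noteq> v" "E u v \<longleftrightarrow> u = last S3 \<and> v = hd (rev S2)"
      using q(6)[of v u] E_commute[of u v] by (auto simp: hd_rev)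
  qed (use q in simp_all)
  then show ?thesis
  proof (subst ipath_append, intro disjI2 conjI ballI)
    fix u v assume u: "u \<in> set S1" and "v \<in> set (S3 @ rev S2)"
    then consider "v \<in> set S3" | "v \<in> set S2" by auto
    then show "u \<noteq> v" "E u v \<longleftrightarrow> u = last S1 \<and> v = hd (S3 @ rev S2)"
      by (cases; use q(4)[OF u] q(5)[OF u] q(6)[of v "hd S3"] ne in auto)+
  qed (use q in simp_all)
qed

lemma (in artemis_graph) artemis_subset: "W \<subseteq> V \<Longrightarrow> artemis_graph E W"
  using finite_V hole_odd antihole_short no_prism
  by unfold_locales (auto intro: finite_subset, blast+)

section \<open>The case without outer paths, and the induction\<close>

context maximal_interesting
begin

text \<open>A maximal stretch of the path outside \<open>C\<close> would be the interior of an outer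
  path.\<close>

lemma path_in_C:
  assumes no: "\<And>x f y. \<not> outer T x f y"
    and Q: "ipath E Q" "set Q \<subseteq> V" "hd Q \<in> C" "last Q \<in> C" "set Q \<inter> T = {}"
  shows "set Q \<subseteq> C"
proof (rule ccontr)
  assume "\<not> set Q \<subseteq> C"
  then obtain Q1 x Q2 where s: "Q = Q1 @ x # Q2" "x \<notin> C" "\<forall>v\<in>set Q1. v \<in> C"
    using split_list_first_prop[of Q "\<lambda>v. v \<notin> C"] by blast
  have "Q1 \<noteq> []" using s Q(3) by auto
  then obtain Q0 w where Q1: "Q1 = Q0 @ [w]" by (metis append_butlast_last_id)
  have "Q2 \<noteq> []" using s Q(4) by auto
  then have "\<exists>v\<in>set Q2. v \<in> C" using s Q(4) by (metis last_ConsR last_appendR last_in_set list.discI)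
  then obtain m y Q3 where s2: "Q2 = m @ y # Q3" "y \<in> C" "\<forall>v\<in>set m. v \<notin> C"
    using split_list_first_prop[of Q2 "\<lambda>v. v \<in> C"] by blast
  have "Q = Q0 @ (w # (x # m) @ [y]) @ Q3" using s s2 Q1 by simp
  then have "ipath E (w # (x # m) @ [y])"
    using Q(1) ipath_appendD1 ipath_appendD2 by (metis append_is_Nil_conv list.discI)
  then have "outer T w (x # m) y"
    using s s2 Q1 Q by (auto simp: outer_def)
  then show False using no by blast
qed

text \<open>A vertex of \<open>T\<close> is adjacent to both ends, so on an induced path it comes
  directly after the first and directly before the last vertex.\<close>

lemma path_through_T:
  assumes "ipath E Q" "hd Q \<in> C" "last Q \<in> C" "t \<in> set Q" "t \<in> T"
  shows "length Q = 3"
proof -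
  have "t \<noteq> hd Q" "t \<noteq> last Q" using assms C(4) by blast+
  obtain i where i: "i < length Q" "t = Q ! i" using assms(4) by (metis in_set_conv_nth)
  have ne: "Q \<noteq> []" using assms(1) by auto
  have e: "E (Q ! i) (Q ! 0)" "E (Q ! i) (Q ! (length Q - 1))"
    using i assms(2,3,5) C(3) ne by (auto simp: hd_conv_nth last_conv_nth)
  have "i \<noteq> 0" using \<open>t \<noteq> hd Q\<close> i(2) ne by (metis hd_conv_nth)
  then have "i = 1" using ipath_nth[OF assms(1) i(1), of 0] e ne by auto
  moreover have "i \<noteq> length Q - 1" using \<open>t \<noteq> last Q\<close> i ne by (auto simp: last_conv_nth)
  moreover have "length Q - 1 = Suc i \<or> i = Suc (length Q - 1)"
    using ipath_nth[OF assms(1) i(1), of "length Q - 1"] e(2) ne by simp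
  ultimately show ?thesis using i(1) by linarith
qed

end

theorem special_pair_exists:
  assumes "artemis_graph E V" "u \<in> V" "v \<in> V" "u \<noteq> v" "\<not> E u v"
  shows "\<exists>a b. special E V a b"
  using assms
proof (induction "card V" arbitrary: V u v rule: less_induct)
  case less
  interpret artemis_graph E V by (rule less.prems)
  show ?case
  proof (cases "\<exists>t\<in>V. \<exists>x\<in>V. \<exists>y\<in>V. E t x \<and> E t y \<and> x \<noteq> y \<and> \<not> E x y")
    case False
    \<comment> \<open>Here all neighbourhoods are cliques, so no induced path has three vertices; a
      quasi-prism would contain one, namely \<open>last S1\<close>, \<open>c\<close>,
      \<open>c2\<close>.\<close>
    have "special E V u v"
      unfolding special_def
    proof (intro conjI allI impI)
      fix Q assume Q: "ipath E Q \<and> set Q \<subseteq> V \<and> hd Q = u \<and> last Q = v"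
      consider "Q = []" | w where "Q = [w]" | w w' where "Q = [w, w']" | w w' w'' q where "Q = w # w' # w'' # q"
        by (metis remdups_adj.cases)
      then show "odd (length Q)"
      proof cases
        case 4
        then have "E w' w" "E w' w''" "w \<noteq> w''" "\<not> E w w''" "w \<in> V" "w' \<in> V" "w'' \<in> V"
          using Q sym by (auto simp: ipath_Cons)
        then show ?thesis using False by blast
      qed (use Q less.prems in auto)
    next
      fix S1 S2 S3 S4
      assume S: "quasi_prism E S1 S2 S3 S4 \<and> set S1 \<union> set S2 \<union> set S3 \<union> set S4 \<subseteq> V \<and> hd S1 = u \<and> hd S2 = v"
      have i: "ipath E S1" "ipath E S3" "2 \<le> length S3"
         and x: "\<And>x y. x \<in> set S1 \<Longrightarrow> y \<in> set S3 \<Longrightarrow> x \<noteq> y \<and> (E x y \<longleftrightarrow> x = last S1 \<and> y = hd S3)"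
        using S by (auto simp: quasi_prism_def)
      obtain c c2 S3' where c: "S3 = c # c2 # S3'" using i(3) by (cases S3 rule: remdups_adj.cases) auto
      have m: "last S1 \<in> set S1" using i(1) by simp
      have "E c c2" "c \<noteq> c2" using i(2) c by auto
      moreover have "E c (last S1)" "\<not> E (last S1) c2" "last S1 \<noteq> c2"
        using x[OF m, of c] x[OF m, of c2] c \<open>c \<noteq> c2\<close> sym by auto
      moreover have "last S1 \<in> V" "c \<in> V" "c2 \<in> V" using S m c by auto
      ultimately have False using False by blast
      then show "length S1 < 2" "length S2 < 2" by auto
    qed (use less.prems in auto)
    then show ?thesis by blast
  next
    case True
    then obtain t x y where t: "t \<in> V" "x \<in> V" "y \<in> V" "E t x" "E t y" "x \<noteq> y" "\<not> E x y" by blast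
    interpret co: ugraph "co E" by (rule ugraph_co)
    have "x \<in> complete_to E V {t}" "y \<in> complete_to E V {t}" using t sym by (auto simp: complete_to_def)
    then have "interesting {t}" using t unfolding interesting_def by auto
    moreover have "\<forall>T. interesting T \<longrightarrow> card T \<le> card V"
      using finite_V by (auto simp: interesting_def intro: card_mono)
    ultimately obtain T where T: "interesting T" "\<And>T'. interesting T' \<Longrightarrow> card T' \<le> card T"
      using ex_has_greatest_nat[of interesting "{t}" card "Suc (card V)"] by (auto simp: less_Suc_eq_le)
    interpret m: maximal_interesting E V T
      by unfold_locales (use T in auto)
    show ?thesis
    proof (cases "\<exists>x f y. outer T x f y")
      case True
      define P where "P n \<longleftrightarrow> (\<exists>x f y. outer T x f y \<and> length f = n)" for n
      have "\<exists>n. P n" using True unfolding P_def by blast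
      then have "P (LEAST n. P n)" by (rule LeastI_ex)
      then obtain \<alpha> z \<beta> where z: "outer T \<alpha> z \<beta>" "length z = (LEAST n. P n)" unfolding P_def by blast
      have "length z \<le> length f" if "outer T x f y" for x f y
        unfolding z(2) by (rule Least_le) (use that in \<open>auto simp: P_def\<close>)
      then interpret s: shortest_outer E V T \<alpha> z \<beta>
        by unfold_locales (use z in auto)
      obtain a b where ab: "a \<in> m.C" "b \<in> m.C" "a \<noteq> b"
        "\<And>Q. ipath E Q \<Longrightarrow> set Q \<subseteq> V \<Longrightarrow> hd Q = a \<Longrightarrow> last Q = b \<Longrightarrow> odd (length Q)"
        "\<And>S1 S2 S3 S4. quasi_prism E S1 S2 S3 S4 \<Longrightarrow> set S1 \<union> set S2 \<union> set S3 \<union> set S4 \<subseteq> V \<Longrightarrow>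
           hd S1 = a \<Longrightarrow> hd S2 = b \<Longrightarrow> 2 \<le> length S1 \<or> 2 \<le> length S2 \<Longrightarrow> False"
        using s.special_pair by blast
      have "special E V a b"
        unfolding special_def
      proof (intro conjI allI impI)
        fix Q assume "ipath E Q \<and> set Q \<subseteq> V \<and> hd Q = a \<and> last Q = b"
        then show "odd (length Q)" using ab(4) by blast
      next
        fix S1 S2 S3 S4
        assume "quasi_prism E S1 S2 S3 S4 \<and> set S1 \<union> set S2 \<union> set S3 \<union> set S4 \<subseteq> V \<and>
          hd S1 = a \<and> hd S2 = b"
        then show "length S1 < 2" "length S2 < 2" using ab(5)[of S1 S2 S3 S4] by (meson not_less)+
      qed (use ab m.C(1) in auto)
      then show ?thesis by blast
    next
      case no: False
      have CV: "m.C \<subseteq> V" using m.C(1) by blast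
      obtain x' y' where xy: "x' \<in> m.C" "y' \<in> m.C" "x' \<noteq> y'" "\<not> E x' y'"
        using T(1) unfolding interesting_def by blast
      obtain t where "t \<in> T" using m.T(2) by blast
      then have "t \<in> V" "t \<notin> m.C" using m.T(1) m.C(4) by blast+
      \<comment> \<open>\<open>T\<close> is nonempty and disjoint from \<open>C\<close>; as
        \<open>C\<close> is not a clique, the induction hypothesis applies to it.\<close>
      then have "card m.C < card V" using CV finite_V by (metis psubsetI psubset_card_mono)
      then obtain a b where ab: "special E m.C a b"
        using less.hyps artemis_subset[OF CV] xy by blast
      have C: "a \<in> m.C" "b \<in> m.C" "a \<noteq> b" using ab by (auto simp: special_def)
      have path: "set Q \<subseteq> m.C \<or> length Q = 3"
        if "ipath E Q" "set Q \<subseteq> V" "hd Q = a" "last Q = b" for Q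
        using m.path_in_C[of Q] m.path_through_T[of Q] no that C by blast
      have "special E V a b"
        unfolding special_def
      proof (intro conjI allI impI)
        fix Q assume Q: "ipath E Q \<and> set Q \<subseteq> V \<and> hd Q = a \<and> last Q = b"
        then show "odd (length Q)"
          using path[of Q] ab by (auto simp: special_def)
      next
        fix S1 S2 S3 S4
        assume S: "quasi_prism E S1 S2 S3 S4 \<and> set S1 \<union> set S2 \<union> set S3 \<union> set S4 \<subseteq> V \<and> hd S1 = a \<and> hd S2 = b"
        have "length S1 < 2 \<and> length S2 < 2"
        proof (rule ccontr)
          assume strict: "\<not> ?thesis"
          have ne: "S1 \<noteq> []" "S2 \<noteq> []" "2 \<le> length S3" "2 \<le> length S4" using S by (auto simp: quasi_prism_def)
          have "1 \<le> length S1" "1 \<le> length S2" using ne by (auto simp: Suc_le_eq)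
          \<comment> \<open>Both paths have at least four vertices, so they do not meet
            \<open>T\<close> and the whole quasi-prism lies in \<open>C\<close>.\<close>
          then have "length (S1 @ S3 @ rev S2) \<noteq> 3" "length (S1 @ S4 @ rev S2) \<noteq> 3"
            using strict ne by auto
          moreover have "ipath E (S1 @ S3 @ rev S2)" "ipath E (S1 @ S4 @ rev S2)"
            using S quasi_prism_path quasi_prism_swap by blast+
          moreover have "hd (S1 @ S @ rev S2) = a" "last (S1 @ S @ rev S2) = b" for S
            using S ne by (auto simp: last_rev)
          moreover have "set (S1 @ S3 @ rev S2) \<subseteq> V" "set (S1 @ S4 @ rev S2) \<subseteq> V" using S by auto
          ultimately have "set (S1 @ S3 @ rev S2) \<subseteq> m.C" "set (S1 @ S4 @ rev S2) \<subseteq> m.C"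
            using path by blast+
          then have "set S1 \<union> set S2 \<union> set S3 \<union> set S4 \<subseteq> m.C" by auto
          then show False using ab S strict unfolding special_def by blast
        qed
        then show "length S1 < 2" "length S2 < 2" by auto
      qed (use C CV in auto)
      then show ?thesis by blast
    qed
  qed
qed

section \<open>Contraction\<close>

lemma ipath_map:
  assumes "inj_on \<phi> (set p)" "\<And>u v. u \<in> set p \<Longrightarrow> v \<in> set p \<Longrightarrow> E (\<phi> u) (\<phi> v) \<longleftrightarrow> R u v"
  shows "ipath E (map \<phi> p) \<longleftrightarrow> ipath R p"
  using assms
proof (induction R p rule: ipath.induct)
  case (3 R x y ys)
  have "ipath E (map \<phi> (y # ys)) \<longleftrightarrow> ipath R (y # ys)"
    by (rule 3(1)) (use 3(2,3) in \<open>auto simp: inj_on_def\<close>)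
  moreover have "\<phi> u = \<phi> v \<longleftrightarrow> u = v" if "u \<in> set (x # y # ys)" "v \<in> set (x # y # ys)" for u v
    using 3(2) that by (meson inj_onD)
  ultimately show ?case using 3(3) by auto
qed auto

lemma hole_map:
  assumes "inj_on \<phi> (insert d (set f))"
    "\<And>u v. u \<in> insert d (set f) \<Longrightarrow> v \<in> insert d (set f) \<Longrightarrow> E (\<phi> u) (\<phi> v) \<longleftrightarrow> R u v"
  shows "hole E (\<phi> d) (map \<phi> f) \<longleftrightarrow> hole R d f"
proof (cases "f = []")
  case False
  have "ipath E (map \<phi> f) \<longleftrightarrow> ipath R f"
    by (rule ipath_map) (use assms in \<open>auto simp: inj_on_def\<close>)
  moreover have "\<phi> d \<in> \<phi> ` set f \<longleftrightarrow> d \<in> set f" using assms(1) by (auto simp: inj_on_def)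
  moreover have "\<phi> v = \<phi> w \<longleftrightarrow> v = w" if "v \<in> set f" "w \<in> set f" for v w
    using assms(1) that by (auto simp: inj_on_def)
  ultimately show ?thesis
    using False assms(2) by (auto simp: hole_def hd_map last_map)
qed (auto simp: hole_def)

lemma rungs_map:
  assumes "inj_on \<phi> (set P \<union> set Q)" "P \<noteq> []" "Q \<noteq> []"
    "\<And>u v. u \<in> set P \<union> set Q \<Longrightarrow> v \<in> set P \<union> set Q \<Longrightarrow> E (\<phi> u) (\<phi> v) \<longleftrightarrow> R u v"
  shows "rungs E (map \<phi> P) (map \<phi> Q) \<longleftrightarrow> rungs R P Q"
proof -
  have "\<phi> v = \<phi> w \<longleftrightarrow> v = w" if "v \<in> set P \<union> set Q" "w \<in> set P \<union> set Q" for v w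
    using assms(1) that by (auto simp: inj_on_def)
  moreover have "hd P \<in> set P" "last P \<in> set P" "hd Q \<in> set Q" "last Q \<in> set Q" using assms by auto
  ultimately show ?thesis
    using assms(2-4) unfolding rungs_def by (simp add: hd_map last_map)
qed

text \<open>Used with the identity for induced subgraphs, and after a contraction with the map that
  puts \<open>x\<close> or \<open>y\<close> in the place of the new vertex.\<close>

lemma (in artemis_graph) artemis_map:
  assumes "ugraph R" "inj_on \<phi> S" "\<phi> ` S \<subseteq> V"
    "\<And>u v. u \<in> S \<Longrightarrow> v \<in> S \<Longrightarrow> E (\<phi> u) (\<phi> v) \<longleftrightarrow> R u v"
  shows "artemis_graph R S"
proof -
  interpret R: ugraph R by fact
  have inj: "inj_on \<phi> W" if "W \<subseteq> S" for W using assms(2) that inj_on_subset by blast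
  have coR: "co E (\<phi> u) (\<phi> v) \<longleftrightarrow> co R u v" if "u \<in> S" "v \<in> S" for u v
    using assms(4)[OF that] inj_onD[OF assms(2) _ that] by (auto simp: co_def)
  show ?thesis
  proof
    show "finite S" using assms(2,3) finite_V by (metis finite_imageD finite_subset)
    show "odd (length f)" if "hole R d f" "d \<in> S" "set f \<subseteq> S" for d f
    proof -
      have "hole E (\<phi> d) (map \<phi> f)"
        using hole_map[of \<phi> d f E R] inj[of "insert d (set f)"] assms(4) that by (auto simp: subset_iff)
      then show ?thesis using hole_odd[of "\<phi> d" "map \<phi> f"] that assms(3) by auto
    qed
    show "length f \<le> 3" if "hole (co R) d f" "d \<in> S" "set f \<subseteq> S" for d f
    proof -
      have "hole (co E) (\<phi> d) (map \<phi> f)"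
        using hole_map[of \<phi> d f "co E" "co R"] inj[of "insert d (set f)"] coR that by (auto simp: subset_iff)
      then show ?thesis using antihole_short[of "\<phi> d" "map \<phi> f"] that assms(3) by auto
    qed
    show False if p: "prism R P Q P'" "set P \<subseteq> S" "set Q \<subseteq> S" "set P' \<subseteq> S" for P Q P'
    proof -
      have ne: "P \<noteq> []" "Q \<noteq> []" "P' \<noteq> []" using p by (auto simp: prism_def)
      have ip: "ipath E (map \<phi> X) \<longleftrightarrow> ipath R X" if "set X \<subseteq> S" for X
        by (rule ipath_map) (use inj that assms(4) in blast)+
      have r: "rungs E (map \<phi> X) (map \<phi> Y) \<longleftrightarrow> rungs R X Y"
        if "set X \<subseteq> S" "set Y \<subseteq> S" "X \<noteq> []" "Y \<noteq> []" for X Y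
        by (rule rungs_map) (use inj[of "set X \<union> set Y"] that assms(4) in blast)+
      have "prism E (map \<phi> P) (map \<phi> Q) (map \<phi> P')"
        using p ip r ne unfolding prism_def by simp
      then show False using no_prism p assms(3) by (metis image_mono image_set order_trans)
    qed
  qed
qed

text \<open>The encoding of holes singles out one vertex. This lemma passes to another one, so that
  the new vertex of a contraction can be taken.\<close>

lemma (in ugraph) hole_rotate:
  assumes "hole E d f" "x \<in> insert d (set f)"
  obtains f' where "hole E x f'" "insert x (set f') = insert d (set f)" "length f' = length f"
proof (cases "x = d")
  case True
  then show thesis using that[of f] assms by auto
next
  case False
  then obtain f1 f2 where f: "f = f1 @ x # f2" using assms(2) by (metis insertE split_list)
  have h: "ipath E f" "3 \<le> length f" "d \<notin> set f" "\<And>v. v \<in> set f \<Longrightarrow> E d v \<longleftrightarrow> v = hd f \<or> v = last f"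
    using assms by (auto simp: hole_def)
  have dist: "distinct f" using ipath_distinct[OF h(1)] .
  have i12: "f1 \<noteq> [] \<Longrightarrow> ipath E f1" "f2 \<noteq> [] \<Longrightarrow> ipath E f2"
    "\<And>v. v \<in> set f1 \<Longrightarrow> E x v \<longleftrightarrow> v = last f1" "\<And>v. v \<in> set f2 \<Longrightarrow> E x v \<longleftrightarrow> v = hd f2"
  proof -
    have a: "ipath E (f1 @ [x])" "ipath E (x # f2)"
      using h(1) unfolding f by (auto simp: ipath_append ipath_Cons)
    show "f1 \<noteq> [] \<Longrightarrow> ipath E f1" "\<And>v. v \<in> set f1 \<Longrightarrow> E x v \<longleftrightarrow> v = last f1"
      using a(1) by (auto simp: ipath_snoc)
    show "f2 \<noteq> [] \<Longrightarrow> ipath E f2" "\<And>v. v \<in> set f2 \<Longrightarrow> E x v \<longleftrightarrow> v = hd f2"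
      using a(2) by (auto simp: ipath_Cons)
  qed
  have x12: "u \<noteq> v" "\<not> E u v" "\<not> E v u" if "u \<in> set f1" "v \<in> set f2" for u v
  proof -
    show "u \<noteq> v" using dist that f by auto
    have "u \<in> set f1 \<Longrightarrow> v \<in> set (x # f2) \<Longrightarrow> E u v \<longleftrightarrow> u = last f1 \<and> v = x"
      using h(1) unfolding f by (subst (asm) ipath_append) auto
    then show "\<not> E u v" using that dist f by auto
    then show "\<not> E v u" using sym by blast
  qed
  have d1: "E d v \<longleftrightarrow> v = hd f1 \<or> (f2 = [] \<and> v = x)" if "v \<in> set f1" for v
    using h(4)[of v] that dist f last_in_set[of f2] by (cases f1) (auto split: if_splits)
  have d2: "E d v \<longleftrightarrow> v = last f2 \<or> (f1 = [] \<and> v = x)" if "v \<in> set f2" for v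
    using h(4)[of v] that dist f last_in_set[of f2] by (cases f1) (auto split: if_splits)
  have dx: "E d x \<longleftrightarrow> f1 = [] \<or> f2 = []"
    using h(4)[of x] dist f last_in_set[of f2] by (cases f1) (auto split: if_splits)
  have dn: "d \<notin> set f1" "d \<notin> set f2" "d \<noteq> x" using h(3) f by auto
  have d1f: "ipath E (d # f1)"
    using i12(1) d1 dist f dn by (cases "f1 = []") (auto simp: ipath_Cons)
  have "ipath E (f2 @ (d # f1))"
  proof (cases "f2 = []")
    case False
    show ?thesis
    proof (subst ipath_append, intro disjI2 conjI ballI)
      fix u v assume "u \<in> set f2" "v \<in> set (d # f1)"
      then show "u \<noteq> v" "E u v \<longleftrightarrow> u = last f2 \<and> v = hd (d # f1)"
        using x12[of v u] d2[of u] dn dist f E_commute[of u d] by auto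
    qed (use False i12 d1f in auto)
  qed (use d1f in auto)
  moreover have "E x v \<longleftrightarrow> v = hd (f2 @ (d # f1)) \<or> v = last (f2 @ (d # f1))" if vv: "v \<in> set (f2 @ (d # f1))" for v
  proof -
    have hl: "hd (f2 @ (d # f1)) = (if f2 = [] then d else hd f2)"
      "last (f2 @ (d # f1)) = (if f1 = [] then d else last f1)" by auto
    consider "v \<in> set f1" | "v \<in> set f2" | "v = d" using vv by auto
    then show ?thesis
    proof cases
      case 1
      then have "v \<noteq> d" "f2 \<noteq> [] \<Longrightarrow> v \<noteq> hd f2" "f1 \<noteq> []" using dn x12(1)[of v "hd f2"] by auto
      then show ?thesis using i12(3)[OF 1] unfolding hl by auto
    next
      case 2
      then have "v \<noteq> d" "f1 \<noteq> [] \<Longrightarrow> v \<noteq> last f1" "f2 \<noteq> []" using dn x12(1)[of "last f1" v] by auto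
      then show ?thesis using i12(4)[OF 2] unfolding hl by auto
    next
      case 3
      have "d \<noteq> hd f2" if "f2 \<noteq> []" using dn(2) that hd_in_set by metis
      moreover have "d \<noteq> last f1" if "f1 \<noteq> []" using dn(1) that last_in_set by metis
      ultimately show ?thesis using dx 3 E_commute[of x d] unfolding hl by auto
    qed
  qed
  ultimately have "hole E x (f2 @ (d # f1))"
    using h(2) dn dist f by (auto simp: hole_def)
  then show thesis by (rule that) (use f in auto)
qed

text \<open>\<open>x\<close> stands for the new vertex. The old vertex \<open>y\<close> disappears
  only through the vertex set \<open>V - {y}\<close>, and its remaining adjacencies do not matter
  there.\<close>

definition contr :: "('a \<Rightarrow> 'a \<Rightarrow> bool) \<Rightarrow> 'a \<Rightarrow> 'a \<Rightarrow> 'a \<Rightarrow> 'a \<Rightarrow> bool" where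
  "contr E x y u v \<longleftrightarrow>
     (if u = x then v \<noteq> x \<and> v \<noteq> y \<and> (E x v \<or> E y v)
      else if v = x then u \<noteq> y \<and> (E x u \<or> E y u) else E u v)"

lemma (in ugraph) ugraph_contr: "ugraph (contr E x y)"
  by unfold_locales (auto simp: contr_def E_commute split: if_splits)

section \<open>Holes and antiholes of the contraction\<close>

locale special_contraction = artemis_graph +
  fixes x y :: 'a
  assumes sp: "special E V x y"
begin

abbreviation R where "R \<equiv> contr E x y"

sublocale R: ugraph R by (rule ugraph_contr)

text \<open>The contracted pair in either order, which allows the roles of the two vertices to be
  chosen.\<close>

definition pr :: "'a \<Rightarrow> 'a \<Rightarrow> bool" where
  "pr p q \<longleftrightarrow> p = x \<and> q = y \<or> p = y \<and> q = x"

lemma xy: "x \<in> V" "y \<in> V" "x \<noteq> y"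
  using sp by (auto simp: special_def)

lemma pr_sym: "pr p q \<Longrightarrow> pr q p"
  by (auto simp: pr_def)

lemma pr_path:
  assumes "pr p q" "ipath E Q" "set Q \<subseteq> V" "hd Q = p" "last Q = q"
  shows "odd (length Q)"
proof -
  have *: "odd (length Q)" if "ipath E Q" "set Q \<subseteq> V" "hd Q = x" "last Q = y" for Q
    using sp that by (simp add: special_def)
  show ?thesis using *[of Q] *[of "rev Q"] assms by (auto simp: pr_def hd_rev last_rev)
qed

lemma prD: "pr p q \<Longrightarrow> p \<in> V \<and> q \<in> V \<and> p \<noteq> q \<and> \<not> E p q \<and> \<not> E q p"
proof -
  assume p: "pr p q"
  then have m: "p \<in> V" "q \<in> V" "p \<noteq> q" using xy by (auto simp: pr_def)
  have "\<not> E p q" using pr_path[OF p, of "[p, q]"] m by auto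
  then show ?thesis using m sym by blast
qed

lemma pr_quasi_prism:
  assumes "pr p q" "quasi_prism E S1 S2 S3 S4" "set S1 \<union> set S2 \<union> set S3 \<union> set S4 \<subseteq> V"
    "hd S1 = p" "hd S2 = q"
  shows "length S1 < 2 \<and> length S2 < 2"
proof -
  have *: "length S1 < 2 \<and> length S2 < 2"
    if "quasi_prism E S1 S2 S3 S4" "set S1 \<union> set S2 \<union> set S3 \<union> set S4 \<subseteq> V" "hd S1 = x" "hd S2 = y"
    for S1 S2 S3 S4
    using sp that unfolding special_def by blast
  from assms(1) show ?thesis
  proof (unfold pr_def, elim disjE conjE)
    assume "p = x" "q = y"
    then show ?thesis using *[OF assms(2,3)] assms(4,5) by simp
  next
    assume "p = y" "q = x"
    then show ?thesis
      using *[OF quasi_prism_rev[OF assms(2)]] assms(3-5) by auto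
  qed
qed

lemma R_E: "u \<noteq> x \<Longrightarrow> v \<noteq> x \<Longrightarrow> R u v \<longleftrightarrow> E u v"
  by (simp add: contr_def)

lemma R_x: "pr p q \<Longrightarrow> v \<noteq> x \<Longrightarrow> v \<noteq> y \<Longrightarrow> R x v \<longleftrightarrow> E p v \<or> E q v"
  by (auto simp: contr_def pr_def)

text \<open>If within \<open>S\<close> all neighbours of \<open>p\<close> were neighbours of
  \<open>q\<close>, the new vertex would behave like \<open>q\<close>, and \<open>S\<close> would be
  a copy of an induced subgraph of the original graph. So each of the two vertices has a private
  neighbour.\<close>

lemma mixed:
  assumes "S \<subseteq> V - {y}" "\<not> artemis_graph R S"
  shows "x \<in> S" "pr p q \<Longrightarrow> \<exists>v\<in>S. v \<noteq> x \<and> E p v \<and> \<not> E q v"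
proof -
  have key: "artemis_graph R S"
    if w: "w \<in> {x, y}" "\<And>v. v \<in> S \<Longrightarrow> x \<in> S \<Longrightarrow> v \<noteq> x \<Longrightarrow> R x v \<Longrightarrow> E w v" for w
  proof (rule artemis_map[of R "\<lambda>u. if u = x then w else u"])
    show "ugraph R" by (rule ugraph_contr)
    show "inj_on (\<lambda>u. if u = x then w else u) S" using w(1) assms(1) by (auto simp: inj_on_def)
    show "(\<lambda>u. if u = x then w else u) ` S \<subseteq> V" using w(1) assms(1) xy by auto
    have wx: "x \<in> S \<Longrightarrow> v \<in> S \<Longrightarrow> v \<noteq> x \<Longrightarrow> E w v \<longleftrightarrow> R x v" for v
      using w assms(1) by (auto simp: contr_def)
    show "E (if u = x then w else u) (if v = x then w else v) \<longleftrightarrow> R u v" if "u \<in> S" "v \<in> S" for u v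
      using that wx[of u] wx[of v] R_E[of u v] R.E_commute[of u x] E_commute[of u w] by auto
  qed
  show "x \<in> S" using key[of x] assms(2) by blast
  show "\<exists>v\<in>S. v \<noteq> x \<and> E p v \<and> \<not> E q v" if "pr p q"
  proof (rule ccontr)
    assume n: "\<not> ?thesis"
    have "artemis_graph R S"
    proof (rule key[of q])
      show "q \<in> {x, y}" using that by (auto simp: pr_def)
      show "E q v" if v: "v \<in> S" "v \<noteq> x" "R x v" for v
      proof -
        have "v \<noteq> y" using v(1) assms(1) by blast
        then show ?thesis using R_x[OF \<open>pr p q\<close> v(2)] v n by blast
      qed
    qed
    then show False using assms(2) by simp
  qed
qed

text \<open>By \<open>mixed\<close> one hole neighbour of the new vertex is private to
  \<open>p\<close> and the other to \<open>q\<close>. The rest of the hole then joins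
  \<open>p\<close> to \<open>q\<close> by an induced path, whose parity is known.\<close>

lemma contr_hole_odd:
  assumes h: "hole R d f" "d \<in> V - {y}" "set f \<subseteq> V - {y}"
  shows "odd (length f)"
proof (rule ccontr)
  assume ev: "\<not> odd (length f)"
  let ?S = "insert d (set f)"
  have S: "?S \<subseteq> V - {y}" using h by auto
  have "\<not> artemis_graph R ?S" using artemis_graph.hole_odd[OF _ h(1)] ev by blast
  note m = mixed[OF S this]
  obtain f' where f': "hole R x f'" "insert x (set f') = ?S" "length f' = length f"
    using R.hole_rotate[OF h(1) m(1)] by blast
  have xf: "x \<notin> set f'" and hf: "ipath R f'" "\<And>v. v \<in> set f' \<Longrightarrow> R x v \<longleftrightarrow> v = hd f' \<or> v = last f'"
    and ne: "f' \<noteq> []"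
    using f'(1) by (auto simp: hole_def)
  have fV: "set f' \<subseteq> V" "y \<notin> set f'" using f'(2) S by auto
  have RE: "R u v \<longleftrightarrow> E u v" if "u \<in> set f'" "v \<in> set f'" for u v
    using R_E[of u v] that xf by blast
  have "ipath E (map id f') \<longleftrightarrow> ipath R f'"
    by (rule ipath_map) (use RE in auto)
  then have ip: "ipath E f'" using hf(1) by simp
  have ends: "E p v \<or> E q v \<longleftrightarrow> v = hd f' \<or> v = last f'" if "pr p q" "v \<in> set f'" for p q v
    using R_x[OF that(1), of v] that(2) hf(2) xf fV by blast
  have ex: "\<exists>v\<in>set f'. E p v \<and> \<not> E q v" if "pr p q" for p q
    using m(2)[OF that] f'(2) by blast
  obtain p q where pq: "pr p q" "E p (hd f')" "\<not> E q (hd f')"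
  proof -
    have prx: "pr x y" by (simp add: pr_def)
    have "E x (hd f') \<and> \<not> E y (hd f') \<or> E y (hd f') \<and> \<not> E x (hd f')"
    proof (rule ccontr)
      assume n: "\<not> ?thesis"
      obtain v1 v2 where "v1 \<in> set f'" "E x v1" "\<not> E y v1" "v2 \<in> set f'" "E y v2" "\<not> E x v2"
        using ex[OF prx] ex[OF pr_sym[OF prx]] by blast
      then show False using ends[OF prx] n by metis
    qed
    then show thesis using that[OF prx] that[OF pr_sym[OF prx]] by blast
  qed
  have l: "E q (last f')" "\<not> E p (last f')"
    using ex[OF pr_sym[OF pq(1)]] ends[OF pq(1)] pq by blast+
  have "ipath E (p # f' @ [q])"
    using ip pq l ends[OF pq(1)] prD[OF pq(1)] xf fV ne
    by (subst ipath_ends[OF ne]) (auto simp: pr_def)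
  then have "odd (length (p # f' @ [q]))"
    by (rule pr_path[OF pq(1)]) (use fV prD[OF pq(1)] in auto)
  then show False using ev f'(3) by simp
qed

text \<open>Successive non-neighbours of \<open>p\<close>, or of \<open>q\<close>, on
  \<open>f\<close> are at distance at most 2 (\<open>gap\<close>), since a longer stretch would be
  an antihole. An inner non-neighbour of \<open>p\<close> and one of \<open>q\<close> are
  consecutive (\<open>chi\<close>), since otherwise they give a path with 4 vertices from
  \<open>p\<close> to \<open>q\<close>. Only \<open>m = 4\<close> and \<open>m = 5\<close>
  survive.\<close>

lemma antihole_aux:
  assumes pq: "pr p q" and f: "ipath (co E) f" "set f \<subseteq> V" "p \<notin> set f" "q \<notin> set f" "4 \<le> length f"
    and adj: "\<And>v. v \<in> set f \<Longrightarrow> E p v \<or> E q v \<longleftrightarrow> v \<noteq> hd f \<and> v \<noteq> last f"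
    and ex: "v0 \<in> set f" "E q v0" "\<not> E p v0" "v1 \<in> set f" "E p v1" "\<not> E q v1"
    and p1: "E p (f ! 1)"
  shows False
proof -
  interpret co: ugraph "co E" by (rule ugraph_co)
  define m where "m = length f"
  have dist: "distinct f" using co.ipath_distinct[OF f(1)] .
  have ne: "f \<noteq> []" using f(5) by auto
  have fadj: "E (f ! i) (f ! j) \<longleftrightarrow> i \<noteq> j \<and> j \<noteq> Suc i \<and> i \<noteq> Suc j" if "i < m" "j < m" for i j
    using co.ipath_nth[OF f(1), of i j] that dist by (auto simp: co_def m_def nth_eq_iff_index_eq)
  have fin: "f ! i \<in> set f" "f ! i \<in> V" if "i < m" for i using that f(2) by (auto simp: m_def)
  have cov: "E p (f ! i) \<or> E q (f ! i) \<longleftrightarrow> 0 < i \<and> i < m - 1" if "i < m" for i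
    using adj[OF fin(1)[OF that]] that dist ne
    by (auto simp: hd_conv_nth last_conv_nth nth_eq_iff_index_eq m_def)
  have gap: "j \<le> i + 2"
    if ij: "i < j" "j < m" "\<not> E w (f ! i)" "\<not> E w (f ! j)" "\<And>k. i < k \<Longrightarrow> k < j \<Longrightarrow> E w (f ! k)" and w: "w \<in> {p, q}" for i j w
  proof (rule ccontr)
    assume n: "\<not> j \<le> i + 2"
    have jl: "i \<le> j" "j < length f" using ij by (auto simp: m_def)
    note ss = sublist_simps[OF jl]
    have "hole (co E) w (sublist f i j)"
      unfolding hole_def
    proof (intro conjI ballI)
      show "ipath (co E) (sublist f i j)" by (rule co.ipath_sublist[OF f(1) jl])
      show "3 \<le> length (sublist f i j)" using ss(1) n by simp
      show wn: "w \<notin> set (sublist f i j)" using ss(6) f w by auto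
      fix v assume v: "v \<in> set (sublist f i j)"
      then obtain k where k: "v = f ! k" "i \<le> k" "k \<le> j" using ss(5) by auto
      have "v = f ! i \<longleftrightarrow> k = i" "v = f ! j \<longleftrightarrow> k = j" using k dist jl by (auto simp: nth_eq_iff_index_eq)
      moreover have "w \<noteq> v" using v wn by auto
      moreover have "i < k \<and> k < j \<Longrightarrow> E w v" using ij(5) k by auto
      ultimately show "co E w v \<longleftrightarrow> v = hd (sublist f i j) \<or> v = last (sublist f i j)"
        unfolding ss(2,3) co_def using k ij(3,4) by (metis le_neq_implies_less)
    qed
    then have "length (sublist f i j) \<le> 3"
      by (rule antihole_short) (use w prD[OF pq] ss(6) f(2) in auto)
    then show False using ss(1) n by simp
  qed
  have chi: "i = Suc j \<or> j = Suc i"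
    if ij: "0 < i" "i < m - 1" "\<not> E p (f ! i)" "0 < j" "j < m - 1" "\<not> E q (f ! j)" for i j
  proof (rule ccontr)
    assume n: "\<not> (i = Suc j \<or> j = Suc i)"
    have lt: "i < m" "j < m" using ij by auto
    have e: "E q (f ! i)" "E p (f ! j)" using cov[OF lt(1)] cov[OF lt(2)] ij by auto
    have "i \<noteq> j" using e ij by auto
    then have "E (f ! j) (f ! i)" using fadj[of j i] lt n by auto
    then have "ipath E [p, f ! j, f ! i, q]"
      using e ij prD[OF pq] fin(1)[OF lt(1)] fin(1)[OF lt(2)] f(3,4) sym \<open>i \<noteq> j\<close> dist lt
      by (auto simp: m_def nth_eq_iff_index_eq)
    from pr_path[OF pq this] show False using fin lt prD[OF pq] by auto
  qed
  have m4: "4 \<le> m" using f(5) by (simp add: m_def)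
  have end0: "\<not> E p (f ! 0)" "\<not> E q (f ! 0)" "\<not> E p (f ! (m - 1))" "\<not> E q (f ! (m - 1))"
    using cov[of 0] cov[of "m - 1"] m4 by auto
  define X where "X i \<longleftrightarrow> 0 < i \<and> i < m - 1 \<and> \<not> E p (f ! i)" for i
  define Y where "Y i \<longleftrightarrow> 0 < i \<and> i < m - 1 \<and> \<not> E q (f ! i)" for i
  have exX: "\<exists>i. X i" "\<exists>i. Y i"
  proof -
    obtain k where "k < m" "v0 = f ! k" using ex(1) by (metis in_set_conv_nth m_def)
    then show "\<exists>i. X i" using cov[of k] ex unfolding X_def by blast
    obtain k where "k < m" "v1 = f ! k" using ex(4) by (metis in_set_conv_nth m_def)
    then show "\<exists>i. Y i" using cov[of k] ex unfolding Y_def by blast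
  qed
  have X2: "X 2"
  proof -
    define i where "i = (LEAST i. X i)"
    have i: "X i" "\<And>k. k < i \<Longrightarrow> \<not> X k" unfolding i_def using exX(1) by (auto intro: LeastI_ex dest: not_less_Least)
    have "i \<le> 0 + 2"
      by (rule gap[of 0 i p]) (use i end0 in \<open>auto simp: X_def\<close>)
    moreover have "i \<noteq> 1" "i \<noteq> 0" using i(1) p1 by (auto simp: X_def)
    ultimately have "i = 2" by linarith
    then show ?thesis using i by simp
  qed
  have Yonly: "i = 1 \<or> i = 3" if "Y i" for i
    using chi[of 2 i] X2 that by (auto simp: X_def Y_def)
  have Y1: "Y 1"
  proof (rule ccontr)
    assume n: "\<not> Y 1"
    then have "Y 3" using exX(2) Yonly by metis
    have "3 \<le> 0 + (2::nat)"
    proof (rule gap[of 0 3 q])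
      fix k :: nat assume "0 < k" "k < 3"
      then have "k = 1 \<or> k = 2" by auto
      then show "E q (f ! k)" using n X2 cov[of 1] cov[of 2] m4 by (auto simp: X_def Y_def)
    qed (use \<open>Y 3\<close> end0 in \<open>auto simp: Y_def\<close>)
    then show False by simp
  qed
  have Xonly: "i = 2" if "X i" for i
    using chi[of i 1] Y1 that by (auto simp: X_def Y_def)
  have "m - 1 \<le> 2 + 2"
  proof (rule gap[of 2 "m - 1" p])
    fix k assume "2 < k" "k < m - 1"
    then show "E p (f ! k)" using Xonly[of k] by (auto simp: X_def)
  qed (use X2 end0 in \<open>auto simp: X_def\<close>)
  then consider "m = 4" | "m = 5" using m4 by linarith
  then show False
  proof cases
    case 1
    then obtain a b c d where l: "f = [a, b, c, d]"
      by (auto simp: m_def length_Suc_conv eval_nat_numeral)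
    have e: "\<not> E a b" "\<not> E b c" "\<not> E c d" "E a c" "E a d" "E b d"
      using fadj[of 0 1] fadj[of 1 2] fadj[of 2 3] fadj[of 0 2] fadj[of 0 3] fadj[of 1 3] 1 l by auto
    have e2: "\<not> E p c" "E q c" "\<not> E q b" "E p b" "\<not> E p a" "\<not> E q a" "\<not> E p d" "\<not> E q d"
      using X2 Y1 cov[of 1] cov[of 2] end0 1 l by (auto simp: X_def Y_def)
    \<comment> \<open>An antihole with 5 vertices is a hole as well; undoing the contraction leaves
      a path of length 5.\<close>
    have "ipath E [p, b, d, a, c, q]"
      using e e2 prD[OF pq] f(3,4) dist l by (auto simp: E_commute)
    from pr_path[OF pq this] show False using f(2) l prD[OF pq] by auto
  next
    case 2
    then obtain a b c d g where l: "f = [a, b, c, d, g]"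
      by (auto simp: m_def length_Suc_conv eval_nat_numeral)
    have Y3: "Y 3"
    proof (rule ccontr)
      assume n: "\<not> Y 3"
      have "4 \<le> 1 + (2::nat)"
      proof (rule gap[of 1 4 q])
        fix k :: nat assume "1 < k" "k < 4"
        then have "k = 2 \<or> k = 3" by auto
        then show "E q (f ! k)" using n X2 cov[of 2] 2 by (auto simp: X_def Y_def)
      qed (use Y1 end0 2 in \<open>auto simp: Y_def\<close>)
      then show False by simp
    qed
    have e: "\<not> E a b" "\<not> E b c" "\<not> E c d" "\<not> E d g" "E a c" "E a d" "E a g" "E b d" "E b g" "E c g"
      using fadj[of 0 1] fadj[of 1 2] fadj[of 2 3] fadj[of 3 4] fadj[of 0 2] fadj[of 0 3] fadj[of 0 4]
        fadj[of 1 3] fadj[of 1 4] fadj[of 2 4] 2 l by (auto simp: eval_nat_numeral)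
    have e2: "\<not> E p c" "E q c" "\<not> E q b" "E p b" "\<not> E q d" "E p d" "\<not> E p a" "\<not> E q a" "\<not> E p g" "\<not> E q g"
      using X2 Y1 Y3 cov[of 1] cov[of 2] cov[of 3] end0 2 l by (auto simp: X_def Y_def eval_nat_numeral)
    \<comment> \<open>The antihole with 6 vertices is a prism, and its leg through the new vertex is
      split into \<open>[q, c]\<close> and \<open>[p]\<close>; the first of these makes the
      quasi-prism strict.\<close>
    have "quasi_prism E [q, c] [p] [a, d] [g, b]"
      unfolding quasi_prism_def rungs_def
      using e e2 prD[OF pq] f(3,4) dist l by (auto simp: E_commute)
    from pr_quasi_prism[OF pr_sym[OF pq] this] show False using f(2) l prD[OF pq] by auto
  qed
qed

lemma contr_antihole_short:
  assumes h: "hole (co R) d f" "d \<in> V - {y}" "set f \<subseteq> V - {y}"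
  shows "length f \<le> 3"
proof (rule ccontr)
  assume long: "\<not> length f \<le> 3"
  interpret coR: ugraph "co R" by (rule R.ugraph_co)
  let ?S = "insert d (set f)"
  have S: "?S \<subseteq> V - {y}" using h by auto
  have "\<not> artemis_graph R ?S" using artemis_graph.antihole_short[OF _ h(1)] long by blast
  note m = mixed[OF S this]
  obtain f' where f': "hole (co R) x f'" "insert x (set f') = ?S" "length f' = length f"
    using coR.hole_rotate[OF h(1) m(1)] by blast
  have xf: "x \<notin> set f'" and hf: "ipath (co R) f'" "\<And>v. v \<in> set f' \<Longrightarrow> co R x v \<longleftrightarrow> v = hd f' \<or> v = last f'"
    using f'(1) by (auto simp: hole_def)
  have fV: "set f' \<subseteq> V" "y \<notin> set f'" using f'(2) S by auto
  have RE: "R u v \<longleftrightarrow> E u v" if "u \<in> set f'" "v \<in> set f'" for u v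
    using R_E[of u v] that xf by blast
  have "ipath (co E) (map id f') \<longleftrightarrow> ipath (co R) f'"
    by (rule ipath_map) (use RE in \<open>auto simp: co_def\<close>)
  then have ip: "ipath (co E) f'" using hf(1) by simp
  have adj: "E p v \<or> E q v \<longleftrightarrow> v \<noteq> hd f' \<and> v \<noteq> last f'" if "pr p q" "v \<in> set f'" for p q v
    using R_x[OF that(1), of v] that(2) hf(2)[OF that(2)] xf fV by (auto simp: co_def)
  have ex: "\<exists>v\<in>set f'. E p v \<and> \<not> E q v" if "pr p q" for p q
    using m(2)[OF that] f'(2) by blast
  have l: "4 \<le> length f'" using f'(3) long by simp
  have aux: False if pq: "pr p q" "E p (f' ! 1)" for p q
  proof -
    have "p \<notin> set f'" "q \<notin> set f'" using pq(1) xf fV by (auto simp: pr_def)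
    moreover obtain v0 v1 where "v0 \<in> set f'" "E q v0" "\<not> E p v0" "v1 \<in> set f'" "E p v1" "\<not> E q v1"
      using ex[OF pq(1)] ex[OF pr_sym[OF pq(1)]] by blast
    ultimately show False
      using antihole_aux[OF pq(1) ip fV(1) _ _ l adj[OF pq(1)] _ _ _ _ _ _ pq(2)] by blast
  qed
  have prx: "pr x y" by (simp add: pr_def)
  have "f' ! 1 \<in> set f'" using l by simp
  moreover have "f' ! 1 \<noteq> hd f'" "f' ! 1 \<noteq> last f'"
  proof -
    have "distinct f'" using coR.ipath_distinct hf(1) by blast
    moreover have "f' \<noteq> []" using l by auto
    ultimately show "f' ! 1 \<noteq> hd f'" "f' ! 1 \<noteq> last f'"
      using l by (auto simp: hd_conv_nth last_conv_nth nth_eq_iff_index_eq)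
  qed
  ultimately have "E x (f' ! 1) \<or> E y (f' ! 1)" using adj[OF prx] by blast
  then show False using aux[OF prx] aux[OF pr_sym[OF prx]] by blast
qed

end

section \<open>Prisms of the contraction\<close>

context ugraph
begin

lemma prism_swap12: "prism E P Q W \<Longrightarrow> prism E Q P W"
  using rungs_sym by (auto simp: prism_def)

lemma prism_swap23: "prism E P Q W \<Longrightarrow> prism E P W Q"
  using rungs_sym by (auto simp: prism_def)

lemma prism_rev: "prism E P Q W \<Longrightarrow> prism E (rev P) (rev Q) (rev W)"
  using rungs_rev by (auto simp: prism_def)

end

context special_contraction
begin

text \<open>A prism of the contraction in which the new vertex is an end of the leg \<open>x # P\<close>, seen in the
  original graph.\<close>

definition end_split :: "'a \<Rightarrow> 'a \<Rightarrow> 'a list \<Rightarrow> 'a list \<Rightarrow> 'a list \<Rightarrow> bool" where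
  "end_split p q P Q W \<longleftrightarrow> pr p q \<and> ipath E P \<and> ipath E Q \<and> ipath E W \<and>
     2 \<le> length Q \<and> 2 \<le> length W \<and> set P \<union> set Q \<union> set W \<subseteq> V - {p, q} \<and>
     (\<forall>u\<in>set P. \<forall>v\<in>set Q. u \<noteq> v \<and> (E u v \<longleftrightarrow> u = last P \<and> v = last Q)) \<and>
     (\<forall>u\<in>set P. \<forall>v\<in>set W. u \<noteq> v \<and> (E u v \<longleftrightarrow> u = last P \<and> v = last W)) \<and>
     rungs E Q W \<and>
     (\<forall>v\<in>set P \<union> set Q \<union> set W. E p v \<or> E q v \<longleftrightarrow> v = hd P \<or> v = hd Q \<or> v = hd W)"

lemma end_split_sym: "end_split p q P Q W \<Longrightarrow> end_split q p P Q W"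
  by (auto simp: end_split_def pr_sym insert_commute)

lemma end_split_swap: "end_split p q P Q W \<Longrightarrow> end_split p q P W Q"
  using rungs_sym by (auto simp: end_split_def)

text \<open>If \<open>q\<close> misses \<open>hd Q\<close>, the split leg gives a strict quasi-prism
  with ends \<open>p\<close> and \<open>q\<close>. If \<open>q\<close> sees \<open>hd Q\<close>,
  then \<open>W @ rev P\<close> is odd as the interior of a path from \<open>p\<close> to
  \<open>q\<close>, but even because with \<open>q\<close> it is closed by \<open>hd Q\<close> to a
  hole.\<close>

lemma end_split_aux:
  assumes es: "end_split p q P Q W"
    and e: "E p (hd Q)" "E p (hd W)" "\<not> E p (hd P)" "E q (hd P)" "\<not> E q (hd W)"
  shows False
proof -
  have pq: "pr p q" and ip: "ipath E P" "ipath E Q" "ipath E W" and len: "2 \<le> length Q" "2 \<le> length W"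
    and V: "set P \<subseteq> V" "set Q \<subseteq> V" "set W \<subseteq> V" and r: "rungs E Q W"
    and nin: "p \<notin> set P" "p \<notin> set Q" "p \<notin> set W" "q \<notin> set P" "q \<notin> set Q" "q \<notin> set W"
    and PQ: "\<And>u v. u \<in> set P \<Longrightarrow> v \<in> set Q \<Longrightarrow> u \<noteq> v \<and> (E u v \<longleftrightarrow> u = last P \<and> v = last Q)"
    and PW: "\<And>u v. u \<in> set P \<Longrightarrow> v \<in> set W \<Longrightarrow> u \<noteq> v \<and> (E u v \<longleftrightarrow> u = last P \<and> v = last W)"
    and cov: "\<And>v. v \<in> set P \<union> set Q \<union> set W \<Longrightarrow> E p v \<or> E q v \<longleftrightarrow> v = hd P \<or> v = hd Q \<or> v = hd W"
    using es unfolding end_split_def by (simp_all, blast+)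
  have QW: "\<And>u v. u \<in> set Q \<Longrightarrow> v \<in> set W \<Longrightarrow> u \<noteq> v \<and> (E u v \<longleftrightarrow> u = hd Q \<and> v = hd W \<or> u = last Q \<and> v = last W)"
    using r by (simp add: rungs_def)
  have ne: "P \<noteq> []" "Q \<noteq> []" "W \<noteq> []" using ip by auto
  have mem: "hd P \<in> set P" "last P \<in> set P" "hd Q \<in> set Q" "last Q \<in> set Q" "hd W \<in> set W" "last W \<in> set W"
    using ne by auto
  have hl: "hd Q \<noteq> last Q" "hd W \<noteq> last W"
  proof -
    show "hd Q \<noteq> last Q" using ipath_distinct[OF ip(2)] len(1) by (cases Q; cases "tl Q") auto
    show "hd W \<noteq> last W" using ipath_distinct[OF ip(3)] len(2) by (cases W; cases "tl W") auto
  qed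
  have hne: "hd P \<noteq> hd Q" "hd P \<noteq> hd W" "hd Q \<noteq> hd W" using PQ PW QW mem by blast+
  have pP: "\<not> E p v" if "v \<in> set P" for v using cov[of v] that e(3) PQ[of v "hd Q"] PW[of v "hd W"] mem by auto
  have pQ: "E p v \<longleftrightarrow> v = hd Q" if "v \<in> set Q" for v
    using cov[of v] that e(1) PQ[of "hd P" v] QW[of v "hd W"] mem by auto
  have pW: "E p v \<longleftrightarrow> v = hd W" if "v \<in> set W" for v
    using cov[of v] that e(2) PW[of "hd P" v] QW[of "hd Q" v] mem by auto
  have qP: "E q v \<longleftrightarrow> v = hd P" if "v \<in> set P" for v
    using cov[of v] that e(4) PQ[of v "hd Q"] PW[of v "hd W"] mem by auto
  have qQ: "E q v \<longleftrightarrow> v = hd Q \<and> E q (hd Q)" if "v \<in> set Q" for v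
    using cov[of v] that PQ[of "hd P" v] QW[of v "hd W"] mem by auto
  have qW: "\<not> E q v" if "v \<in> set W" for v
    using cov[of v] that e(5) PW[of "hd P" v] QW[of "hd Q" v] mem by auto
  have pq': "p \<in> V" "q \<in> V" "p \<noteq> q" "\<not> E p q" "\<not> E q p" using prD[OF pq] by auto
  have qPi: "ipath E (q # P)" using ip(1) nin qP by (subst ipath_Cons) auto
  show False
  proof (cases "E q (hd Q)")
    case False
    have qQ': "\<not> E q v" if "v \<in> set Q" for v using qQ[OF that] False by blast
    have "quasi_prism E [p] (q # P) Q W"
      unfolding quasi_prism_def
    proof (intro conjI)
      show "\<forall>u\<in>set [p]. \<forall>v\<in>set (q # P). u \<noteq> v \<and> \<not> E u v" using pq' pP nin by auto
      show "\<forall>u\<in>set [p]. \<forall>v\<in>set Q. u \<noteq> v \<and> (E u v \<longleftrightarrow> u = last [p] \<and> v = hd Q)" using pQ nin by auto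
      show "\<forall>u\<in>set [p]. \<forall>v\<in>set W. u \<noteq> v \<and> (E u v \<longleftrightarrow> u = last [p] \<and> v = hd W)" using pW nin by auto
      show "\<forall>u\<in>set (q # P). \<forall>v\<in>set Q. u \<noteq> v \<and> (E u v \<longleftrightarrow> u = last (q # P) \<and> v = last Q)"
        using PQ qQ' nin ne mem by auto
      show "\<forall>u\<in>set (q # P). \<forall>v\<in>set W. u \<noteq> v \<and> (E u v \<longleftrightarrow> u = last (q # P) \<and> v = last W)"
        using PW qW nin ne mem by auto
    qed (use ip len r qPi in auto)
    from pr_quasi_prism[OF pq this] show False using V pq' ne by (auto simp: not_less_eq)
  next
    case True
    have WP: "ipath E (W @ rev P)"
    proof (subst ipath_append, intro disjI2 conjI ballI)
      fix u v assume "u \<in> set W" "v \<in> set (rev P)"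
      then show "u \<noteq> v" "E u v \<longleftrightarrow> u = last W \<and> v = hd (rev P)"
        using PW[of v u] E_commute[of u v] by (auto simp: hd_rev)
    qed (use ip in simp_all)
    have h: "hd (W @ rev P) = hd W" "last (W @ rev P) = hd P" using ne by (auto simp: last_rev)
    have WPne: "W @ rev P \<noteq> []" using ne by simp
    have "ipath E (p # (W @ rev P) @ [q])"
      unfolding ipath_ends[OF WPne] h
      using WP nin pq' pW pP qW qP PW mem by auto
    from pr_path[OF pq this] have o: "odd (length (p # (W @ rev P) @ [q]))"
      using V pq' by simp
    have WPq: "ipath E ((W @ rev P) @ [q])"
      using WP nin qW qP h PW mem by (subst ipath_snoc) auto
    have "E (hd Q) v \<longleftrightarrow> v = hd W \<or> v = q" if "v \<in> set ((W @ rev P) @ [q])" for v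
      using that QW[of "hd Q" v] PQ[of v "hd Q"] mem hl E_commute[of "hd Q" v] True nin by auto
    moreover have "hd Q \<notin> set ((W @ rev P) @ [q])"
      using QW[of "hd Q"] PQ[of _ "hd Q"] mem nin by auto
    ultimately have "hole E (hd Q) ((W @ rev P) @ [q])"
      using WPq h ne len(2) by (simp add: hole_def)
    then have "odd (length ((W @ rev P) @ [q]))"
      by (rule hole_odd) (use V pq' mem in auto)
    then show False using o by simp
  qed
qed

text \<open>If \<open>hd Q\<close> and \<open>hd W\<close> are seen by different vertices of the
  pair only, then \<open>p\<close>, \<open>hd Q\<close>, \<open>hd W\<close>, \<open>q\<close> is a
  path of length 3. Otherwise one of the pair sees both, the private neighbours fix the rest, and
  \<open>end_split_aux\<close> applies up to swapping \<open>Q\<close> and \<open>W\<close>.\<close>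

lemma no_end_split:
  assumes es: "end_split x y P Q W"
    and ex: "\<And>p q. pr p q \<Longrightarrow> \<exists>v\<in>set P \<union> set Q \<union> set W. E p v \<and> \<not> E q v"
  shows False
proof -
  have prx: "pr x y" "pr y x" by (auto simp: pr_def)
  have cov: "\<And>v. v \<in> set P \<union> set Q \<union> set W \<Longrightarrow> E x v \<or> E y v \<longleftrightarrow> v = hd P \<or> v = hd Q \<or> v = hd W"
    and ip: "ipath E P" "ipath E Q" "ipath E W" and r: "rungs E Q W"
    and V: "set Q \<subseteq> V" "set W \<subseteq> V" "x \<notin> set Q" "y \<notin> set Q" "x \<notin> set W" "y \<notin> set W"
    using es unfolding end_split_def by (simp_all, blast+)
  have mem: "hd P \<in> set P" "hd Q \<in> set Q" "hd W \<in> set W" using ip by auto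
  have QW: "E (hd Q) (hd W)" "hd Q \<noteq> hd W" using r mem by (auto simp: rungs_def)
  have cP: "E x (hd P) \<or> E y (hd P)" and cQ: "E x (hd Q) \<or> E y (hd Q)" and cW: "E x (hd W) \<or> E y (hd W)"
    using cov mem by blast+
  have both: False if b: "end_split p q P Q W" "pr p q" "E p (hd Q)" "E p (hd W)" for p q
  proof -
    have c: "\<And>v. v \<in> set P \<union> set Q \<union> set W \<Longrightarrow> E p v \<or> E q v \<longleftrightarrow> v = hd P \<or> v = hd Q \<or> v = hd W"
      using b(1) by (simp add: end_split_def)
    obtain v2 where "v2 \<in> set P \<union> set Q \<union> set W" "E q v2" "\<not> E p v2" using ex[OF pr_sym[OF b(2)]] by blast
    then have 2: "E q (hd P)" "\<not> E p (hd P)" using c[of v2] b(3,4) by auto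
    obtain v1 where "v1 \<in> set P \<union> set Q \<union> set W" "E p v1" "\<not> E q v1" using ex[OF b(2)] by blast
    then have "\<not> E q (hd Q) \<or> \<not> E q (hd W)" using c[of v1] 2 by auto
    then show False
      using end_split_aux[OF b(1,3,4) 2(2,1)] end_split_aux[OF end_split_swap[OF b(1)] b(4,3) 2(2,1)] by blast
  qed
  have one: False if "pr p q" "E p (hd Q)" "E q (hd W)" "\<not> E p (hd W)" "\<not> E q (hd Q)" for p q
  proof -
    have "p \<noteq> hd Q" "p \<noteq> hd W" "q \<noteq> hd Q" "q \<noteq> hd W" using that(1) V mem by (auto simp: pr_def)
    then have "ipath E [p, hd Q, hd W, q]"
      using that QW prD[OF that(1)] sym by auto
    from pr_path[OF that(1) this] show False using V mem prD[OF that(1)] by auto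
  qed
  show False
    using both[OF es prx(1)] both[OF end_split_sym[OF es] prx(2)] one[OF prx(1)] one[OF prx(2)] cQ cW by blast
qed

text \<open>The two neighbours of the new vertex on its leg are private to different vertices of the
  pair. Undoing the contraction therefore cuts the leg into the two end paths of a strict
  quasi-prism.\<close>

lemma no_inner_split:
  assumes pr: "prism R (P1 @ x # P2) Q W" and ne: "P1 \<noteq> []" "P2 \<noteq> []"
    and V: "set P1 \<union> set P2 \<union> set Q \<union> set W \<subseteq> V - {x, y}"
    and ex: "\<And>p q. pr p q \<Longrightarrow> \<exists>v\<in>set P1 \<union> set P2 \<union> set Q \<union> set W. E p v \<and> \<not> E q v"
  shows False
proof -
  let ?P = "P1 @ x # P2" and ?S = "set P1 \<union> set P2 \<union> set Q \<union> set W"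
  have ip: "ipath R ?P" "ipath R Q" "ipath R W" and len: "2 \<le> length Q" "2 \<le> length W"
    and r: "rungs R ?P Q" "rungs R ?P W" "rungs R Q W"
    using pr by (auto simp: prism_def)
  have RE: "R u v \<longleftrightarrow> E u v" if "u \<in> ?S" "v \<in> ?S" for u v
    using R_E[of u v] that V by blast
  have ipE: "ipath E X \<longleftrightarrow> ipath R X" if "set X \<subseteq> ?S" for X
    using ipath_map[of id X E R] RE that by (auto simp: subset_iff)
  have dist: "distinct ?P" using R.ipath_distinct[OF ip(1)] .
  have hP: "hd ?P = hd P1" "last ?P = last P2" using ne by auto
  have mem: "hd P1 \<in> set P1" "last P1 \<in> set P1" "hd P2 \<in> set P2" "last P2 \<in> set P2" using ne by auto
  have PP: "u \<noteq> v \<and> (R u v \<longleftrightarrow> u = last P1 \<and> v = x)" if "u \<in> set P1" "v \<in> set (x # P2)" for u v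
    using ip(1) that by (subst (asm) R.ipath_append) auto
  have i1: "ipath R P1" "ipath R (x # P2)" using ip(1) ne by (auto simp: R.ipath_append)
  have i2: "ipath R P2" "\<And>v. v \<in> set P2 \<Longrightarrow> R x v \<longleftrightarrow> v = hd P2" using i1(2) ne by (auto simp: R.ipath_Cons)
  have X: "R u v \<longleftrightarrow> u = hd P1 \<and> v = hd Y \<or> u = last P2 \<and> v = last Y" "u \<noteq> v"
    if "u \<in> insert x (set P1 \<union> set P2)" "v \<in> set Y" "Y = Q \<or> Y = W" for u v Y
  proof -
    have "rungs R ?P Y" "u \<in> set ?P" using r that(1,3) by auto
    then show "R u v \<longleftrightarrow> u = hd P1 \<and> v = hd Y \<or> u = last P2 \<and> v = last Y" "u \<noteq> v"
      using that(2) unfolding rungs_def hP by blast+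
  qed
  have Rx: "R x v \<longleftrightarrow> v = last P1 \<or> v = hd P2" if vS: "v \<in> ?S" for v
  proof -
    have xn: "x \<noteq> hd P1" "x \<noteq> last P2" using dist mem by auto
    consider "v \<in> set P1" | "v \<in> set P2" | "v \<in> set Q" | "v \<in> set W" using vS by blast
    then show ?thesis
    proof cases
      case 1
      then show ?thesis using PP[of v x] PP[of v "hd P2"] R.E_commute[of x v] mem by auto
    next
      case 2
      then show ?thesis using i2(2)[OF 2] PP[of "last P1" v] mem by auto
    next
      case 3
      then show ?thesis using X[of x v Q] X(2)[of "last P1" v Q] X(2)[of "hd P2" v Q] xn mem by auto
    next
      case 4
      then show ?thesis using X[of x v W] X(2)[of "last P1" v W] X(2)[of "hd P2" v W] xn mem by auto
    qed
  qed
  have cov: "E p v \<or> E q v \<longleftrightarrow> v = last P1 \<or> v = hd P2" if "pr p q" "v \<in> ?S" for p q v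
  proof -
    have "v \<noteq> x" "v \<noteq> y" using that(2) V by auto
    then show ?thesis using R_x[OF that(1)] Rx[OF that(2)] by blast
  qed
  have prx: "pr x y" "pr y x" by (auto simp: pr_def)
  obtain p q where pq: "pr p q" "E p (last P1)" "\<not> E q (last P1)"
  proof -
    have "E x (last P1) \<and> \<not> E y (last P1) \<or> E y (last P1) \<and> \<not> E x (last P1)"
    proof (rule ccontr)
      assume n: "\<not> ?thesis"
      obtain v1 v2 where "v1 \<in> ?S" "E x v1" "\<not> E y v1" "v2 \<in> ?S" "E y v2" "\<not> E x v2"
        using ex[OF prx(1)] ex[OF prx(2)] by blast
      then show False using cov[OF prx(1)] n by metis
    qed
    then show thesis using that[OF prx(1)] that[OF prx(2)] by blast
  qed
  have q2: "E q (hd P2)" "\<not> E p (hd P2)" using ex[OF pr_sym[OF pq(1)]] cov[OF pq(1)] pq by blast+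
  have pS: "E p v \<longleftrightarrow> v = last P1" "E q v \<longleftrightarrow> v = hd P2" if "v \<in> ?S" for v
    using cov[OF pq(1) that] pq q2 by blast+
  have nin: "p \<notin> ?S" "q \<notin> ?S" using pq(1) V by (auto simp: pr_def)
  have pq': "p \<in> V" "q \<in> V" "p \<noteq> q" "\<not> E p q" "\<not> E q p" using prD[OF pq(1)] by auto
  have "ipath E (rev P1)" using ipE[of P1] i1(1) by auto
  then have ia: "ipath E (p # rev P1)"
    using pS(1) nin ne by (subst ipath_Cons) (auto simp: hd_rev)
  have ib: "ipath E (q # P2)"
    using ipE[of P2] i2(1) pS(2) nin by (subst ipath_Cons) auto
  have PQ: "last P1 \<notin> set P2 \<union> set Q \<union> set W" "hd P2 \<notin> set P1 \<union> set Q \<union> set W"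
  proof -
    have "last P1 \<notin> set P2" "hd P2 \<notin> set P1" using dist mem by auto
    moreover have "last P1 \<notin> set Y" "hd P2 \<notin> set Y" if "Y = Q \<or> Y = W" for Y
      using X(2)[of "last P1" "last P1" Y] X(2)[of "hd P2" "hd P2" Y] that mem by blast+
    ultimately show "last P1 \<notin> set P2 \<union> set Q \<union> set W" "hd P2 \<notin> set P1 \<union> set Q \<union> set W" by blast+
  qed
  have "quasi_prism E (p # rev P1) (q # P2) Q W"
    unfolding quasi_prism_def
  proof (intro conjI)
    show "ipath E Q" "ipath E W" using ipE ip by auto
    show "\<forall>u\<in>set (p # rev P1). \<forall>v\<in>set (q # P2). u \<noteq> v \<and> \<not> E u v"
    proof (intro ballI)
      fix u v assume "u \<in> set (p # rev P1)" "v \<in> set (q # P2)"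
      then consider "u = p" "v = q" | "u = p" "v \<in> set P2" | "v = q" "u \<in> set P1" | "u \<in> set P1" "v \<in> set P2" by auto
      then show "u \<noteq> v \<and> \<not> E u v"
      proof cases
        case 2
        then show ?thesis using pS(1)[of v] nin PQ by auto
      next
        case 3
        then show ?thesis using pS(2)[of u] nin PQ sym by blast
      next
        case 4
        then show ?thesis using PP[of u v] RE[of u v] dist by auto
      qed (use pq' in auto)
    qed
    have Z: "\<forall>u\<in>set (p # rev P1). \<forall>v\<in>set Y. u \<noteq> v \<and> (E u v \<longleftrightarrow> u = last (p # rev P1) \<and> v = hd Y)"
        "\<forall>u\<in>set (q # P2). \<forall>v\<in>set Y. u \<noteq> v \<and> (E u v \<longleftrightarrow> u = last (q # P2) \<and> v = last Y)"
      if Y: "Y = Q \<or> Y = W" for Y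
    proof -
      have YS: "set Y \<subseteq> ?S" using Y by auto
      have l: "last (p # rev P1) = hd P1" "last (q # P2) = last P2" using ne by (auto simp: last_rev)
      have e: "hd P1 \<noteq> last P2" "\<And>u. u \<in> set P1 \<Longrightarrow> u \<noteq> last P2" "\<And>u. u \<in> set P2 \<Longrightarrow> u \<noteq> hd P1"
        using dist mem by auto
      show "\<forall>u\<in>set (p # rev P1). \<forall>v\<in>set Y. u \<noteq> v \<and> (E u v \<longleftrightarrow> u = last (p # rev P1) \<and> v = hd Y)"
        unfolding l
      proof (intro ballI)
        fix u v assume u: "u \<in> set (p # rev P1)" and v: "v \<in> set Y"
        have vS: "v \<in> ?S" using v YS by blast
        show "u \<noteq> v \<and> (E u v \<longleftrightarrow> u = hd P1 \<and> v = hd Y)"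
        proof (cases "u = p")
          case True
          then show ?thesis using pS(1)[OF vS] nin vS PQ v Y mem by auto
        next
          case False
          then have "u \<in> set P1" using u by auto
          then show ?thesis using X[of u v Y] RE[of u v] vS v Y e(2)[of u] by auto
        qed
      qed
      show "\<forall>u\<in>set (q # P2). \<forall>v\<in>set Y. u \<noteq> v \<and> (E u v \<longleftrightarrow> u = last (q # P2) \<and> v = last Y)"
        unfolding l
      proof (intro ballI)
        fix u v assume u: "u \<in> set (q # P2)" and v: "v \<in> set Y"
        have vS: "v \<in> ?S" using v YS by blast
        show "u \<noteq> v \<and> (E u v \<longleftrightarrow> u = last P2 \<and> v = last Y)"
        proof (cases "u = q")
          case True
          then show ?thesis using pS(2)[OF vS] nin vS PQ v Y mem by auto
        next
          case False
          then have "u \<in> set P2" using u by auto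
          then show ?thesis using X[of u v Y] RE[of u v] vS v Y e(3)[of u] by auto
        qed
      qed
    qed
    show "\<forall>u\<in>set (p # rev P1). \<forall>v\<in>set Q. u \<noteq> v \<and> (E u v \<longleftrightarrow> u = last (p # rev P1) \<and> v = hd Q)"
      by (rule Z(1)[OF disjI1[OF refl]])
    show "\<forall>u\<in>set (p # rev P1). \<forall>v\<in>set W. u \<noteq> v \<and> (E u v \<longleftrightarrow> u = last (p # rev P1) \<and> v = hd W)"
      by (rule Z(1)[OF disjI2[OF refl]])
    show "\<forall>u\<in>set (q # P2). \<forall>v\<in>set Q. u \<noteq> v \<and> (E u v \<longleftrightarrow> u = last (q # P2) \<and> v = last Q)"
      by (rule Z(2)[OF disjI1[OF refl]])
    show "\<forall>u\<in>set (q # P2). \<forall>v\<in>set W. u \<noteq> v \<and> (E u v \<longleftrightarrow> u = last (q # P2) \<and> v = last W)"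
      by (rule Z(2)[OF disjI2[OF refl]])
    show "rungs E Q W" using r(3) RE by (simp add: rungs_def)
  qed (use ia ib len in auto)
  from pr_quasi_prism[OF pq(1) this] show False using V pq' ne by auto
qed

lemma no_prism_through:
  assumes pr: "prism R P Q W" "x \<in> set P" and V: "set P \<union> set Q \<union> set W \<subseteq> V - {y}"
    and ex: "\<And>p q. pr p q \<Longrightarrow> \<exists>v\<in>set P \<union> set Q \<union> set W. v \<noteq> x \<and> E p v \<and> \<not> E q v"
  shows False
proof -
  have at_end: False if pr: "prism R (x # P2) Q W" and V: "set (x # P2) \<union> set Q \<union> set W \<subseteq> V - {y}"
    and ex: "\<And>p q. pr p q \<Longrightarrow> \<exists>v\<in>set (x # P2) \<union> set Q \<union> set W. v \<noteq> x \<and> E p v \<and> \<not> E q v" for P2 Q W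
  proof -
    have ip: "ipath R (x # P2)" "ipath R Q" "ipath R W" and len: "2 \<le> length (x # P2)" "2 \<le> length Q" "2 \<le> length W"
      and r: "rungs R (x # P2) Q" "rungs R (x # P2) W" "rungs R Q W"
      using pr by (auto simp: prism_def)
    have ne: "P2 \<noteq> []" using len(1) by auto
    have i2: "ipath R P2" "x \<notin> set P2" "\<And>v. v \<in> set P2 \<Longrightarrow> R x v \<longleftrightarrow> v = hd P2"
      using ip(1) ne by (auto simp: R.ipath_Cons)
    let ?S = "set P2 \<union> set Q \<union> set W"
    have X: "R u v \<longleftrightarrow> u = x \<and> v = hd Y \<or> u = last P2 \<and> v = last Y" "u \<noteq> v"
      if "u \<in> insert x (set P2)" "v \<in> set Y" "Y = Q \<or> Y = W" for u v Y
      using r(1,2) that ne unfolding rungs_def by auto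
    have xn: "x \<notin> ?S" using i2(2) X(2)[of x] by blast
    have RE: "R u v \<longleftrightarrow> E u v" if "u \<in> ?S" "v \<in> ?S" for u v
      using R_E[of u v] that xn by blast
    have ipE: "ipath E X \<longleftrightarrow> ipath R X" if "set X \<subseteq> ?S" for X
      using ipath_map[of id X E R] RE that by (auto simp: subset_iff)
    have mem: "last P2 \<in> set P2" "hd P2 \<in> set P2" "hd Q \<in> set Q" "hd W \<in> set W" using ne ip by auto
    have prx: "pr x y" by (simp add: pr_def)
    have "end_split x y P2 Q W"
      unfolding end_split_def
    proof (intro conjI)
      show "ipath E P2" "ipath E Q" "ipath E W" using ipE i2(1) ip by auto
      show "set P2 \<union> set Q \<union> set W \<subseteq> V - {x, y}" using V xn by auto
      show "rungs E Q W" using r(3) RE by (simp add: rungs_def)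
      have Z: "\<forall>u\<in>set P2. \<forall>v\<in>set Y. u \<noteq> v \<and> (E u v \<longleftrightarrow> u = last P2 \<and> v = last Y)" if "Y = Q \<or> Y = W" for Y
      proof (intro ballI)
        fix u v assume "u \<in> set P2" "v \<in> set Y"
        then show "u \<noteq> v \<and> (E u v \<longleftrightarrow> u = last P2 \<and> v = last Y)"
          using X[of u v Y] RE[of u v] that i2(2) by auto
      qed
      show "\<forall>u\<in>set P2. \<forall>v\<in>set Q. u \<noteq> v \<and> (E u v \<longleftrightarrow> u = last P2 \<and> v = last Q)"
        "\<forall>u\<in>set P2. \<forall>v\<in>set W. u \<noteq> v \<and> (E u v \<longleftrightarrow> u = last P2 \<and> v = last W)"
        using Z by blast+
      show "\<forall>v\<in>?S. E x v \<or> E y v \<longleftrightarrow> v = hd P2 \<or> v = hd Q \<or> v = hd W"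
      proof
        fix v assume v: "v \<in> ?S"
        have "R x v \<longleftrightarrow> v = hd P2 \<or> v = hd Q \<or> v = hd W"
        proof -
          have d: "\<And>u w. u \<in> set Q \<Longrightarrow> w \<in> set W \<Longrightarrow> u \<noteq> w" using r(3) by (auto simp: rungs_def)
          have xl: "x \<noteq> last P2" using i2(2) mem by auto
          consider "v \<in> set P2" | "v \<in> set Q" | "v \<in> set W" using v by blast
          then show ?thesis
          proof cases
            case 1
            then show ?thesis using i2(3) X(2)[of v "hd Q" Q] X(2)[of v "hd W" W] mem by auto
          next
            case 2
            then show ?thesis using X[of x v Q] X(2)[of "hd P2" v Q] d[of v "hd W"] xl mem by auto
          next
            case 3
            then show ?thesis using X[of x v W] X(2)[of "hd P2" v W] d[of "hd Q" v] xl mem by auto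
          qed
        qed
        moreover have "v \<noteq> x" "v \<noteq> y" using v xn V by auto
        ultimately show "E x v \<or> E y v \<longleftrightarrow> v = hd P2 \<or> v = hd Q \<or> v = hd W"
          using R_x[OF prx] by blast
      qed
    qed (use prx len in auto)
    moreover have "\<exists>v\<in>?S. E p v \<and> \<not> E q v" if "pr p q" for p q using ex[OF that] by auto
    ultimately show False using no_end_split by blast
  qed
  obtain P1 P2 where P: "P = P1 @ x # P2" using pr(2) by (meson split_list)
  consider "P1 = []" | "P2 = []" | "P1 \<noteq> []" "P2 \<noteq> []" by blast
  then show False
  proof cases
    case 1
    then show False using at_end[of P2 Q W] pr V ex P by simp
  next
    case 2
    then have "rev P = x # rev P1" using P by simp
    then show False
      using at_end[of "rev P1" "rev Q" "rev W"] R.prism_rev[OF pr(1)] V ex by (metis set_rev)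
  next
    case 3
    have "distinct P" using pr(1) R.ipath_distinct by (auto simp: prism_def)
    moreover have "u \<noteq> v" if "u \<in> set P" "v \<in> set Q \<union> set W" for u v
      using pr(1) that by (auto simp: prism_def rungs_def)
    ultimately have "x \<notin> set P1 \<union> set P2 \<union> set Q \<union> set W" using P by auto
    then have V': "set P1 \<union> set P2 \<union> set Q \<union> set W \<subseteq> V - {x, y}" using V P by auto
    have "\<exists>v\<in>set P1 \<union> set P2 \<union> set Q \<union> set W. E p v \<and> \<not> E q v" if "pr p q" for p q
      using ex[OF that] P by auto
    then show False using no_inner_split[OF pr(1)[unfolded P] 3 V'] by blast
  qed
qed

theorem artemis_contr: "artemis_graph R (V - {y})"
proof
  show "finite (V - {y})" using finite_V by simp
  show "\<And>d f. hole R d f \<Longrightarrow> d \<in> V - {y} \<Longrightarrow> set f \<subseteq> V - {y} \<Longrightarrow> odd (length f)"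
    by (rule contr_hole_odd)
  show "\<And>d f. hole (co R) d f \<Longrightarrow> d \<in> V - {y} \<Longrightarrow> set f \<subseteq> V - {y} \<Longrightarrow> length f \<le> 3"
    by (rule contr_antihole_short)
  show False if p: "prism R P Q W" "set P \<subseteq> V - {y}" "set Q \<subseteq> V - {y}" "set W \<subseteq> V - {y}" for P Q W
  proof -
    let ?S = "set P \<union> set Q \<union> set W"
    have S: "?S \<subseteq> V - {y}" using p by auto
    have "\<not> artemis_graph R ?S"
    proof
      assume "artemis_graph R ?S"
      then interpret a: artemis_graph R ?S .
      show False using a.no_prism[OF p(1)] by blast
    qed
    note m = mixed[OF S this]
    consider "x \<in> set P" | "x \<in> set Q" | "x \<in> set W" using m(1) by blast
    then show False
    proof cases
      case 1
      show False by (rule no_prism_through[OF p(1) 1 S m(2)])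
    next
      case 2
      have S': "set Q \<union> set P \<union> set W = ?S" by auto
      show False
        by (rule no_prism_through[OF R.prism_swap12[OF p(1)] 2]) (use S m(2) S' in \<open>simp_all add: Un_assoc\<close>)
    next
      case 3
      have S': "set W \<union> set P \<union> set Q = ?S" by auto
      show False
        by (rule no_prism_through[OF R.prism_swap12[OF R.prism_swap23[OF p(1)]] 3]) (use S m(2) in \<open>simp_all only: S'\<close>)
    qed
  qed
qed

end

section \<open>Translation from digraphs\<close>

abbreviation adj :: "'a pair_pre_digraph \<Rightarrow> 'a \<Rightarrow> 'a \<Rightarrow> bool" where
  "adj G u v \<equiv> (u, v) \<in> parcs G"

lemma in_symcl: "(u, v) \<in> symcl X \<longleftrightarrow> (u, v) \<in> X \<or> (v, u) \<in> X"
  by (auto simp: symcl_def)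

lemma path_edges_sub: "(u, v) \<in> path_edges xs \<Longrightarrow> u \<in> set xs \<and> v \<in> set xs"
proof -
  have "(u, v) \<in> set (zip xs (tl xs)) \<Longrightarrow> u \<in> set xs \<and> v \<in> set xs" for u v
    by (cases xs) (auto dest: set_zip_leftD set_zip_rightD)
  then show "(u, v) \<in> path_edges xs \<Longrightarrow> u \<in> set xs \<and> v \<in> set xs"
    by (auto simp: path_edges_def in_symcl)
qed

lemma path_edges_Cons:
  "xs \<noteq> [] \<Longrightarrow> (u, v) \<in> path_edges (x # xs) \<longleftrightarrow> u = x \<and> v = hd xs \<or> u = hd xs \<and> v = x \<or> (u, v) \<in> path_edges xs"
  by (cases xs) (auto simp: path_edges_def in_symcl)

lemma path_edges_irrefl: "distinct xs \<Longrightarrow> (u, u) \<notin> path_edges xs"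
proof (induction xs)
  case (Cons x xs)
  then show ?case by (cases "xs = []") (auto simp: path_edges_Cons, auto simp: path_edges_def in_symcl)
qed (simp add: path_edges_def in_symcl)

text \<open>The arcs that \<open>is_hole\<close> requires of the list \<open>d # f\<close>, arranged
  to match the distinguished vertex of \<open>hole\<close>.\<close>

definition cycle_edges :: "'a \<Rightarrow> 'a list \<Rightarrow> ('a \<times> 'a) set" where
  "cycle_edges d f = symcl (set (zip (d # f) (rotate1 (d # f))))"

lemma cycle_edges:
  assumes "f \<noteq> []"
  shows "(u, v) \<in> cycle_edges d f \<longleftrightarrow> (u, v) \<in> path_edges f \<or>
     u = d \<and> (v = hd f \<or> v = last f) \<or> v = d \<and> (u = hd f \<or> u = last f)"
proof -
  have z: "set (zip f (tl f @ [d])) = insert (last f, d) (set (zip f (tl f)))" if "f \<noteq> []" for f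
    using that
  proof (induction f)
    case (Cons x f)
    then show ?case by (cases f) auto
  qed simp
  have "zip (d # f) (f @ [d]) = (d, hd f) # zip f (tl f @ [d])" using assms by (cases f) auto
  then show ?thesis using z[OF assms] by (auto simp: cycle_edges_def path_edges_def in_symcl)
qed

context ugraph
begin

lemma ipath_iff_edges:
  "ipath E xs \<longleftrightarrow> xs \<noteq> [] \<and> distinct xs \<and> (\<forall>u\<in>set xs. \<forall>v\<in>set xs. E u v \<longleftrightarrow> (u, v) \<in> path_edges xs)"
proof (induction xs)
  case (Cons x xs)
  show ?case
  proof (cases "xs = []")
    case True
    then show ?thesis by (auto simp: path_edges_def in_symcl)
  next
    case False
    have "(x, v) \<notin> path_edges xs" "(v, x) \<notin> path_edges xs" if "x \<notin> set xs" for v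
      using path_edges_sub that by metis+
    moreover have "hd xs \<in> set xs" using False by simp
    ultimately show ?thesis
      using False Cons.IH E_commute[of _ x]
      by (auto simp: ipath_Cons path_edges_Cons[OF False])
  qed
qed simp

lemma hole_iff_edges:
  "hole E d f \<longleftrightarrow> 3 \<le> length f \<and> distinct (d # f) \<and>
     (\<forall>u\<in>set (d # f). \<forall>v\<in>set (d # f). E u v \<longleftrightarrow> (u, v) \<in> cycle_edges d f)"
proof (cases "f = []")
  case False
  have pd: "(d, v) \<notin> path_edges f" "(v, d) \<notin> path_edges f" if "d \<notin> set f" for v
    using path_edges_sub that by metis+
  have hl: "hd f \<in> set f" "last f \<in> set f" using False by auto
  show ?thesis
  proof (cases "d \<in> set f")
    case False
    then have ne: "d \<noteq> hd f" "d \<noteq> last f" using hl by auto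
    show ?thesis
    proof
      assume h: "hole E d f"
      then show "3 \<le> length f \<and> distinct (d # f) \<and>
        (\<forall>u\<in>set (d # f). \<forall>v\<in>set (d # f). E u v \<longleftrightarrow> (u, v) \<in> cycle_edges d f)"
        using ipath_iff_edges[of f] False ne pd E_commute[of _ d]
        unfolding hole_def cycle_edges[OF \<open>f \<noteq> []\<close>] by auto
    next
      assume c: "3 \<le> length f \<and> distinct (d # f) \<and>
        (\<forall>u\<in>set (d # f). \<forall>v\<in>set (d # f). E u v \<longleftrightarrow> (u, v) \<in> cycle_edges d f)"
      then have "\<forall>u\<in>set f. \<forall>v\<in>set f. E u v \<longleftrightarrow> (u, v) \<in> path_edges f"
        using False unfolding cycle_edges[OF \<open>f \<noteq> []\<close>] by auto
      then have "ipath E f" using c ipath_iff_edges[of f] \<open>f \<noteq> []\<close> by auto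
      moreover have "\<forall>v\<in>set f. E d v \<longleftrightarrow> v = hd f \<or> v = last f"
        using c False pd(1) ne unfolding cycle_edges[OF \<open>f \<noteq> []\<close>] by auto
      ultimately show "hole E d f" using c by (simp add: hole_def)
    qed
  qed (auto simp: hole_def)
qed (auto simp: hole_def)

end

lemma pair_graph_ugraph: "pair_graph G \<Longrightarrow> ugraph (adj G)"
proof
  assume "pair_graph G"
  then interpret pair_graph G .
  show "adj G v u" if "adj G u v" for u v
    using pair_sym_arcs that by (auto simp: symmetric_def sym_def)
  show "\<not> adj G u u" for u using pair_no_loops[of "(u, u)"] by auto
qed

lemma pair_graphI:
  assumes "finite (pverts G)" "parcs G \<subseteq> pverts G \<times> pverts G" "\<And>u v. adj G u v \<Longrightarrow> adj G v u" "\<And>u. \<not> adj G u u"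
  shows "pair_graph G"
proof -
  have "finite (parcs G)" using assms(1,2) by (meson finite_SigmaI finite_subset)
  then show ?thesis
    using assms by unfold_locales (auto simp: symmetric_def intro!: symI)
qed

lemma pair_graphD:
  assumes "pair_graph G"
  shows "finite (pverts G)" "adj G u v \<Longrightarrow> u \<in> pverts G \<and> v \<in> pverts G"
    "adj G u v \<Longrightarrow> adj G v u" "\<not> adj G u u"
proof -
  interpret pair_graph G by fact
  interpret ugraph "adj G" by (rule pair_graph_ugraph[OF assms])
  show "finite (pverts G)" by (rule pair_finite_verts)
  show "adj G u v \<Longrightarrow> u \<in> pverts G \<and> v \<in> pverts G" using in_arcsD1 in_arcsD2 by blast
  show "adj G u v \<Longrightarrow> adj G v u" "\<not> adj G u u" using sym irrefl by blast+
qed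

lemma induced_subgraph_pair:
  assumes "pair_graph G"
  shows "induced_subgraph (with_proj H) (with_proj G) \<longleftrightarrow>
    pverts H \<subseteq> pverts G \<and> parcs H = parcs G \<inter> pverts H \<times> pverts H"
proof -
  interpret pair_graph G by fact
  have "wf_digraph (with_proj G)" by unfold_locales
  moreover have "wf_digraph (with_proj H)" if "parcs H = parcs G \<inter> pverts H \<times> pverts H"
    using that by (auto simp: wf_digraph_def)
  moreover have "compatible (with_proj G) (with_proj H)" by auto
  ultimately show ?thesis
    by (auto simp: induced_subgraph_def subgraph_def)
qed

definition induce :: "'a pair_pre_digraph \<Rightarrow> 'a set \<Rightarrow> 'a pair_pre_digraph" where
  "induce G S = \<lparr>pverts = S, parcs = parcs G \<inter> S \<times> S\<rparr>"

lemma contains_iff: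
  assumes "pair_graph G"
  shows "contains G P \<longleftrightarrow> (\<exists>S\<subseteq>pverts G. P (induce G S))"
proof
  assume "contains G P"
  then obtain H where H: "pverts H \<subseteq> pverts G" "parcs H = parcs G \<inter> pverts H \<times> pverts H" "P H"
    unfolding contains_def induced_subgraph_pair[OF assms] by blast
  have "H = induce G (pverts H)" unfolding induce_def by (subst H(2)[symmetric]) simp
  then show "\<exists>S\<subseteq>pverts G. P (induce G S)" using H by auto
next
  assume "\<exists>S\<subseteq>pverts G. P (induce G S)"
  then obtain S where "S \<subseteq> pverts G" "P (induce G S)" by blast
  then show "contains G P"
    unfolding contains_def induced_subgraph_pair[OF assms]
    by (intro exI[of _ "induce G S"]) (simp add: induce_def)
qed

lemma induce_pair_graph:
  assumes "pair_graph G" "S \<subseteq> pverts G"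
  shows "pair_graph (induce G S)"
  using pair_graphD[OF assms(1)] assms(2)
  by (intro pair_graphI) (auto simp: induce_def finite_subset)

lemma is_path_iff:
  assumes "pair_graph G"
  shows "is_path G xs \<longleftrightarrow> ipath (adj G) xs \<and> set xs \<subseteq> pverts G"
proof -
  interpret ugraph "adj G" by (rule pair_graph_ugraph[OF assms])
  have "parcs G \<inter> (set xs \<times> set xs) = path_edges xs \<longleftrightarrow>
      (\<forall>u\<in>set xs. \<forall>v\<in>set xs. adj G u v \<longleftrightarrow> (u, v) \<in> path_edges xs)"
    using path_edges_sub[of _ _ xs] by fast
  then show ?thesis unfolding is_path_def ipath_iff_edges by blast
qed

lemma is_path_induce:
  assumes "pair_graph G" "S \<subseteq> pverts G"
  shows "is_path (induce G S) xs \<longleftrightarrow> ipath (adj G) xs \<and> set xs \<subseteq> S"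
proof -
  have "is_path (induce G S) xs \<longleftrightarrow> ipath (adj (induce G S)) xs \<and> set xs \<subseteq> S"
    using is_path_iff[OF induce_pair_graph[OF assms]] by (simp add: induce_def)
  moreover have "ipath (adj G) (map id xs) \<longleftrightarrow> ipath (adj (induce G S)) xs" if "set xs \<subseteq> S"
    by (rule ipath_map) (use that in \<open>auto simp: induce_def\<close>)
  ultimately show ?thesis by auto
qed

lemma is_hole_iff:
  "is_hole H \<longleftrightarrow> (\<exists>d f. distinct (d # f) \<and> 3 \<le> length f \<and> pverts H = set (d # f) \<and> parcs H = cycle_edges d f)"
proof
  assume "is_hole H"
  then obtain xs where xs: "distinct xs" "4 \<le> length xs" "pverts H = set xs" "parcs H = symcl (set (zip xs (rotate1 xs)))"
    unfolding is_hole_def by blast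
  then obtain d f where "xs = d # f" by (cases xs) auto
  then show "\<exists>d f. distinct (d # f) \<and> 3 \<le> length f \<and> pverts H = set (d # f) \<and> parcs H = cycle_edges d f"
    using xs unfolding cycle_edges_def by (intro exI[of _ d] exI[of _ f]) auto
next
  assume "\<exists>d f. distinct (d # f) \<and> 3 \<le> length f \<and> pverts H = set (d # f) \<and> parcs H = cycle_edges d f"
  then obtain d f where "distinct (d # f)" "3 \<le> length f" "pverts H = set (d # f)" "parcs H = cycle_edges d f" by blast
  then show "is_hole H" unfolding is_hole_def cycle_edges_def by (intro exI[of _ "d # f"]) auto
qed

lemma cycle_edges_sub:
  assumes "3 \<le> length f" "(u, v) \<in> cycle_edges d f"
  shows "u \<in> set (d # f)" "v \<in> set (d # f)"
proof -
  have "f \<noteq> []" using assms by auto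
  then show "u \<in> set (d # f)" "v \<in> set (d # f)"
    using assms(2) path_edges_sub[of u v f] unfolding cycle_edges[OF \<open>f \<noteq> []\<close>] by auto
qed

lemma cycle_edges_irrefl:
  assumes "3 \<le> length f" "distinct (d # f)"
  shows "(u, u) \<notin> cycle_edges d f"
proof -
  have "f \<noteq> []" using assms by auto
  then show ?thesis
    using assms(2) path_edges_irrefl[of f u] unfolding cycle_edges[OF \<open>f \<noteq> []\<close>] by auto
qed

section \<open>Forbidden subgraphs in relational form\<close>

lemma contains_odd_hole:
  assumes "pair_graph G"
  shows "contains G is_odd_hole \<longleftrightarrow> (\<exists>d f. hole (adj G) d f \<and> d \<in> pverts G \<and> set f \<subseteq> pverts G \<and> even (length f))"
proof -
  interpret ugraph "adj G" by (rule pair_graph_ugraph[OF assms])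
  have eq: "parcs (induce G (set (d # f))) = cycle_edges d f \<longleftrightarrow>
      (\<forall>u\<in>set (d # f). \<forall>v\<in>set (d # f). adj G u v \<longleftrightarrow> (u, v) \<in> cycle_edges d f)" if "3 \<le> length f" for d f
    using cycle_edges_sub[OF that, of _ _ d] unfolding induce_def by (auto simp del: list.set)
  \<comment> \<open>The hole has one vertex more than \<open>f\<close>, which flips the
    parity.\<close>
  have card: "odd (card (set (d # f))) \<longleftrightarrow> even (length f)" if "distinct (d # f)" for d f
    using distinct_card[OF that] by simp
  show ?thesis
  proof
    assume "contains G is_odd_hole"
    then obtain S d f where S: "S \<subseteq> pverts G" "distinct (d # f)" "3 \<le> length f" "S = set (d # f)"
      "parcs (induce G S) = cycle_edges d f" "odd (card S)"
      unfolding contains_iff[OF assms] is_odd_hole_def is_hole_iff by (auto simp: induce_def)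
    then have "hole (adj G) d f" unfolding hole_iff_edges using eq[OF S(3), of d] by blast
    then show "\<exists>d f. hole (adj G) d f \<and> d \<in> pverts G \<and> set f \<subseteq> pverts G \<and> even (length f)"
      using S card[OF S(2)] by (intro exI[of _ d] exI[of _ f]) auto
  next
    assume "\<exists>d f. hole (adj G) d f \<and> d \<in> pverts G \<and> set f \<subseteq> pverts G \<and> even (length f)"
    then obtain d f where h: "hole (adj G) d f" "set (d # f) \<subseteq> pverts G" "even (length f)" by auto
    have l: "3 \<le> length f" "distinct (d # f)" using h(1) unfolding hole_iff_edges by auto
    have "parcs (induce G (set (d # f))) = cycle_edges d f"
      using h(1) eq[OF l(1), of d] unfolding hole_iff_edges by blast
    then have "is_odd_hole (induce G (set (d # f)))"
      unfolding is_odd_hole_def is_hole_iff using l card[OF l(2)] h(3)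
      by (auto simp: induce_def simp del: list.set distinct.simps)
    then show "contains G is_odd_hole" unfolding contains_iff[OF assms] using h(2) by blast
  qed
qed

lemma contains_long_antihole:
  assumes "pair_graph G"
  shows "contains G is_long_antihole \<longleftrightarrow>
    (\<exists>d f. hole (co (adj G)) d f \<and> d \<in> pverts G \<and> set f \<subseteq> pverts G \<and> 4 \<le> length f)"
proof -
  interpret ugraph "adj G" by (rule pair_graph_ugraph[OF assms])
  interpret co: ugraph "co (adj G)" by (rule ugraph_co)
  have eq: "induce G (set (d # f)) = complement \<lparr>pverts = set (d # f), parcs = cycle_edges d f\<rparr> \<longleftrightarrow>
      (\<forall>u\<in>set (d # f). \<forall>v\<in>set (d # f). co (adj G) u v \<longleftrightarrow> (u, v) \<in> cycle_edges d f)"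
    if "3 \<le> length f" "distinct (d # f)" for d f
  proof -
    have "induce G (set (d # f)) = complement \<lparr>pverts = set (d # f), parcs = cycle_edges d f\<rparr> \<longleftrightarrow>
       (\<forall>u\<in>set (d # f). \<forall>v\<in>set (d # f). adj G u v \<longleftrightarrow> u \<noteq> v \<and> (u, v) \<notin> cycle_edges d f)"
      unfolding induce_def complement_def by (auto simp del: list.set)
    also have "\<dots> \<longleftrightarrow> (\<forall>u\<in>set (d # f). \<forall>v\<in>set (d # f). co (adj G) u v \<longleftrightarrow> (u, v) \<in> cycle_edges d f)"
      using cycle_edges_irrefl[OF that] irrefl unfolding co_def by blast
    finally show ?thesis .
  qed
  have card: "card (set (d # f)) = Suc (length f)" if "distinct (d # f)" for d f
    using distinct_card[OF that] by simp
  show ?thesis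
  proof
    assume "contains G is_long_antihole"
    then obtain S D where S: "S \<subseteq> pverts G" "is_hole D" "induce G S = complement D" "5 \<le> card S"
      unfolding contains_iff[OF assms] is_long_antihole_def is_antihole_def by (auto simp: induce_def)
    then obtain d f where D: "distinct (d # f)" "3 \<le> length f" "pverts D = set (d # f)" "parcs D = cycle_edges d f"
      unfolding is_hole_iff by blast
    have "S = set (d # f)" using S(3) D(3) by (simp add: induce_def complement_def)
    moreover have "D = \<lparr>pverts = set (d # f), parcs = cycle_edges d f\<rparr>" using D by simp
    ultimately have "hole (co (adj G)) d f"
      unfolding co.hole_iff_edges using D S(3) eq[OF D(2,1)] by blast
    then show "\<exists>d f. hole (co (adj G)) d f \<and> d \<in> pverts G \<and> set f \<subseteq> pverts G \<and> 4 \<le> length f"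
      using S card[OF D(1)] \<open>S = set (d # f)\<close> by (intro exI[of _ d] exI[of _ f]) auto
  next
    assume "\<exists>d f. hole (co (adj G)) d f \<and> d \<in> pverts G \<and> set f \<subseteq> pverts G \<and> 4 \<le> length f"
    then obtain d f where h: "hole (co (adj G)) d f" "set (d # f) \<subseteq> pverts G" "4 \<le> length f" by auto
    have l: "3 \<le> length f" "distinct (d # f)" using h(1) unfolding co.hole_iff_edges by auto
    let ?D = "\<lparr>pverts = set (d # f), parcs = cycle_edges d f\<rparr>"
    have "induce G (set (d # f)) = complement ?D"
      using h(1) eq[OF l] unfolding co.hole_iff_edges by blast
    moreover have "is_hole ?D" unfolding is_hole_iff using l by (intro exI[of _ d] exI[of _ f]) simp
    moreover have "5 \<le> card (pverts (induce G (set (d # f))))"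
      using card[OF l(2)] h(3) by (simp add: induce_def del: list.set)
    ultimately have "is_long_antihole (induce G (set (d # f)))"
      unfolding is_long_antihole_def is_antihole_def by blast
    then show "contains G is_long_antihole" unfolding contains_iff[OF assms] using h(2) by blast
  qed
qed

lemma triangle_edges_iff:
  "(u, v) \<in> triangle_edges x y z \<longleftrightarrow> (u, v) \<in> {(x, y), (x, z), (y, z), (y, x), (z, x), (z, y)}"
  by (auto simp: triangle_edges_def in_symcl)

lemma path_edges_sym: "(u, v) \<in> path_edges p \<longleftrightarrow> (v, u) \<in> path_edges p"
  by (auto simp: path_edges_def in_symcl)

definition prism_edges :: "'a list \<Rightarrow> 'a list \<Rightarrow> 'a list \<Rightarrow> ('a \<times> 'a) set" where
  "prism_edges P Q W = path_edges P \<union> path_edges Q \<union> path_edges W \<union>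
     triangle_edges (hd P) (hd Q) (hd W) \<union> triangle_edges (last P) (last Q) (last W)"

lemma triangle_edges_sym: "(u, v) \<in> triangle_edges x y z \<longleftrightarrow> (v, u) \<in> triangle_edges x y z"
  by (auto simp: triangle_edges_def in_symcl)

lemma prism_edges_sym: "(u, v) \<in> prism_edges P Q W \<longleftrightarrow> (v, u) \<in> prism_edges P Q W"
  using path_edges_sym[of u v P] path_edges_sym[of u v Q] path_edges_sym[of u v W]
    triangle_edges_sym[of u v "hd P" "hd Q" "hd W"] triangle_edges_sym[of u v "last P" "last Q" "last W"]
  unfolding prism_edges_def Un_iff by blast

lemma prism_edges_cases:
  assumes d: "distinct (P @ Q @ W)" and ne: "P \<noteq> []" "Q \<noteq> []" "W \<noteq> []"
  shows "u \<in> set P \<Longrightarrow> v \<in> set P \<Longrightarrow> (u, v) \<in> prism_edges P Q W \<longleftrightarrow> (u, v) \<in> path_edges P"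
    "u \<in> set Q \<Longrightarrow> v \<in> set Q \<Longrightarrow> (u, v) \<in> prism_edges P Q W \<longleftrightarrow> (u, v) \<in> path_edges Q"
    "u \<in> set W \<Longrightarrow> v \<in> set W \<Longrightarrow> (u, v) \<in> prism_edges P Q W \<longleftrightarrow> (u, v) \<in> path_edges W"
    "u \<in> set P \<Longrightarrow> v \<in> set Q \<Longrightarrow> (u, v) \<in> prism_edges P Q W \<longleftrightarrow> u = hd P \<and> v = hd Q \<or> u = last P \<and> v = last Q"
    "u \<in> set P \<Longrightarrow> v \<in> set W \<Longrightarrow> (u, v) \<in> prism_edges P Q W \<longleftrightarrow> u = hd P \<and> v = hd W \<or> u = last P \<and> v = last W"
    "u \<in> set Q \<Longrightarrow> v \<in> set W \<Longrightarrow> (u, v) \<in> prism_edges P Q W \<longleftrightarrow> u = hd Q \<and> v = hd W \<or> u = last Q \<and> v = last W"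
proof -
  have dj: "\<And>x. x \<in> set P \<Longrightarrow> x \<notin> set Q \<and> x \<notin> set W" "\<And>x. x \<in> set Q \<Longrightarrow> x \<notin> set P \<and> x \<notin> set W"
     "\<And>x. x \<in> set W \<Longrightarrow> x \<notin> set P \<and> x \<notin> set Q" using d by auto
  have m: "hd P \<in> set P" "hd Q \<in> set Q" "hd W \<in> set W" "last P \<in> set P" "last Q \<in> set Q" "last W \<in> set W"
    using ne by auto
  note dm = dj(1)[OF m(1)] dj(2)[OF m(2)] dj(3)[OF m(3)] dj(1)[OF m(4)] dj(2)[OF m(5)] dj(3)[OF m(6)]
  note pe = path_edges_sub[of u v P] path_edges_sub[of u v Q] path_edges_sub[of u v W]
  show "u \<in> set P \<Longrightarrow> v \<in> set P \<Longrightarrow> (u, v) \<in> prism_edges P Q W \<longleftrightarrow> (u, v) \<in> path_edges P"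
    using pe dj(1)[of u] dj(1)[of v] dm unfolding prism_edges_def Un_iff triangle_edges_iff by auto
  show "u \<in> set Q \<Longrightarrow> v \<in> set Q \<Longrightarrow> (u, v) \<in> prism_edges P Q W \<longleftrightarrow> (u, v) \<in> path_edges Q"
    using pe dj(2)[of u] dj(2)[of v] dm unfolding prism_edges_def Un_iff triangle_edges_iff by auto
  show "u \<in> set W \<Longrightarrow> v \<in> set W \<Longrightarrow> (u, v) \<in> prism_edges P Q W \<longleftrightarrow> (u, v) \<in> path_edges W"
    using pe dj(3)[of u] dj(3)[of v] dm unfolding prism_edges_def Un_iff triangle_edges_iff by auto
  show "u \<in> set P \<Longrightarrow> v \<in> set Q \<Longrightarrow> (u, v) \<in> prism_edges P Q W \<longleftrightarrow> u = hd P \<and> v = hd Q \<or> u = last P \<and> v = last Q"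
    using pe dj(1)[of u] dj(2)[of v] dm unfolding prism_edges_def Un_iff triangle_edges_iff by auto
  show "u \<in> set P \<Longrightarrow> v \<in> set W \<Longrightarrow> (u, v) \<in> prism_edges P Q W \<longleftrightarrow> u = hd P \<and> v = hd W \<or> u = last P \<and> v = last W"
    using pe dj(1)[of u] dj(3)[of v] dm unfolding prism_edges_def Un_iff triangle_edges_iff by auto
  show "u \<in> set Q \<Longrightarrow> v \<in> set W \<Longrightarrow> (u, v) \<in> prism_edges P Q W \<longleftrightarrow> u = hd Q \<and> v = hd W \<or> u = last Q \<and> v = last W"
    using pe dj(2)[of u] dj(3)[of v] dm unfolding prism_edges_def Un_iff triangle_edges_iff by auto
qed

lemma contains_prism:
  assumes G: "pair_graph G"
  shows "contains G is_prism \<longleftrightarrow>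
    (\<exists>P Q W. prism (adj G) P Q W \<and> set P \<subseteq> pverts G \<and> set Q \<subseteq> pverts G \<and> set W \<subseteq> pverts G)"
proof
  interpret ugraph "adj G" by (rule pair_graph_ugraph[OF G])
  assume "contains G is_prism"
  then obtain S P Q W where S: "S \<subseteq> pverts G" "distinct (P @ Q @ W)" "S = set (P @ Q @ W)"
    "is_path (induce G S) P" "is_path (induce G S) Q" "is_path (induce G S) W"
    "1 \<le> path_length P" "1 \<le> path_length Q" "1 \<le> path_length W"
    "parcs (induce G S) = prism_edges P Q W"
    unfolding contains_iff[OF G] is_prism_def prism_edges_def by (auto simp: induce_def)
  have ip: "ipath (adj G) P" "ipath (adj G) Q" "ipath (adj G) W"
    using S(4-6) unfolding is_path_induce[OF G S(1)] by auto
  have ne: "P \<noteq> []" "Q \<noteq> []" "W \<noteq> []" using ip by auto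
  have e: "adj G u v \<longleftrightarrow> (u, v) \<in> prism_edges P Q W" if "u \<in> S" "v \<in> S" for u v
    using S(10) that unfolding induce_def by auto
  have "rungs (adj G) P Q" "rungs (adj G) P W" "rungs (adj G) Q W"
    unfolding rungs_def using S(2,3) e prism_edges_cases(4-6)[OF S(2) ne] by auto
  moreover have "2 \<le> length P" "2 \<le> length Q" "2 \<le> length W"
    using S(7-9) unfolding path_length_def by linarith+
  ultimately have "prism (adj G) P Q W"
    using ip by (simp add: prism_def)
  then show "\<exists>P Q W. prism (adj G) P Q W \<and> set P \<subseteq> pverts G \<and> set Q \<subseteq> pverts G \<and> set W \<subseteq> pverts G"
    using S(1,3) by (intro exI[of _ P] exI[of _ Q] exI[of _ W]) auto
next
  interpret ugraph "adj G" by (rule pair_graph_ugraph[OF G])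
  assume "\<exists>P Q W. prism (adj G) P Q W \<and> set P \<subseteq> pverts G \<and> set Q \<subseteq> pverts G \<and> set W \<subseteq> pverts G"
  then obtain P Q W where p: "prism (adj G) P Q W" and V: "set P \<subseteq> pverts G" "set Q \<subseteq> pverts G" "set W \<subseteq> pverts G"
    by blast
  define S where "S = set (P @ Q @ W)"
  have SV: "S \<subseteq> pverts G" using V by (simp add: S_def)
  have ip: "ipath (adj G) P" "ipath (adj G) Q" "ipath (adj G) W" and len: "2 \<le> length P" "2 \<le> length Q" "2 \<le> length W"
    and r: "rungs (adj G) P Q" "rungs (adj G) P W" "rungs (adj G) Q W"
    using p by (auto simp: prism_def)
  have ne: "P \<noteq> []" "Q \<noteq> []" "W \<noteq> []" using ip by auto
  have d: "distinct (P @ Q @ W)"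
    using ipath_distinct[OF ip(1)] ipath_distinct[OF ip(2)] ipath_distinct[OF ip(3)] r
    unfolding rungs_def by auto
  note c = prism_edges_cases[OF d ne]
  have within: "\<And>u v. u \<in> set P \<Longrightarrow> v \<in> set P \<Longrightarrow> adj G u v \<longleftrightarrow> (u, v) \<in> path_edges P"
    "\<And>u v. u \<in> set Q \<Longrightarrow> v \<in> set Q \<Longrightarrow> adj G u v \<longleftrightarrow> (u, v) \<in> path_edges Q"
    "\<And>u v. u \<in> set W \<Longrightarrow> v \<in> set W \<Longrightarrow> adj G u v \<longleftrightarrow> (u, v) \<in> path_edges W"
    using ip unfolding ipath_iff_edges by blast+
  have cross: "\<And>u v. u \<in> set P \<Longrightarrow> v \<in> set Q \<Longrightarrow> adj G u v \<longleftrightarrow> (u, v) \<in> prism_edges P Q W"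
    "\<And>u v. u \<in> set P \<Longrightarrow> v \<in> set W \<Longrightarrow> adj G u v \<longleftrightarrow> (u, v) \<in> prism_edges P Q W"
    "\<And>u v. u \<in> set Q \<Longrightarrow> v \<in> set W \<Longrightarrow> adj G u v \<longleftrightarrow> (u, v) \<in> prism_edges P Q W"
    using r c(4-6) unfolding rungs_def by simp_all
  have e: "adj G u v \<longleftrightarrow> (u, v) \<in> prism_edges P Q W" if uv: "u \<in> S" "v \<in> S" for u v
  proof -
    have s: "adj G u v \<longleftrightarrow> adj G v u" by (rule E_commute)
    note s = s prism_edges_sym[of u v P Q W]
    consider "u \<in> set P" "v \<in> set P" | "u \<in> set Q" "v \<in> set Q" | "u \<in> set W" "v \<in> set W"
      | "u \<in> set P" "v \<in> set Q" | "u \<in> set P" "v \<in> set W" | "u \<in> set Q" "v \<in> set W"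
      | "u \<in> set Q" "v \<in> set P" | "u \<in> set W" "v \<in> set P" | "u \<in> set W" "v \<in> set Q"
      using uv unfolding S_def set_append by blast
    then show ?thesis
    proof cases
      case 1
      then show ?thesis using within(1)[OF 1] c(1)[OF 1] by simp
    next
      case 2
      then show ?thesis using within(2)[OF 2] c(2)[OF 2] by simp
    next
      case 3
      then show ?thesis using within(3)[OF 3] c(3)[OF 3] by simp
    next
      case 4
      then show ?thesis using cross(1)[OF 4] by simp
    next
      case 5
      then show ?thesis using cross(2)[OF 5] by simp
    next
      case 6
      then show ?thesis using cross(3)[OF 6] by simp
    next
      case 7
      then show ?thesis using cross(1)[OF 7(2,1)] s by simp
    next
      case 8
      then show ?thesis using cross(2)[OF 8(2,1)] s by simp
    next
      case 9
      then show ?thesis using cross(3)[OF 9(2,1)] s by simp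
    qed
  qed
  have sub: "(u, v) \<in> prism_edges P Q W \<Longrightarrow> u \<in> S \<and> v \<in> S" for u v
    using path_edges_sub[of u v] ne unfolding prism_edges_def triangle_edges_iff Un_iff S_def by auto
  have "is_prism (induce G S)"
    unfolding is_prism_def
  proof (intro exI conjI)
    show "pverts (induce G S) = set (P @ Q @ W)" by (simp add: induce_def S_def)
    show "is_path (induce G S) P" "is_path (induce G S) Q" "is_path (induce G S) W"
      using ip unfolding is_path_induce[OF G SV] by (auto simp: S_def)
    show "1 \<le> path_length P" "1 \<le> path_length Q" "1 \<le> path_length W"
      using len unfolding path_length_def by linarith+
    show "parcs (induce G S) = path_edges P \<union> path_edges Q \<union> path_edges W \<union>
        triangle_edges (hd P) (hd Q) (hd W) \<union> triangle_edges (last P) (last Q) (last W)"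
      unfolding prism_edges_def[symmetric] using e sub unfolding induce_def by auto
  qed (rule d)
  then show "contains G is_prism" unfolding contains_iff[OF G] using SV by blast
qed

lemma artemis_iff: "artemis G \<longleftrightarrow> pair_graph G \<and> artemis_graph (adj G) (pverts G)"
proof (cases "pair_graph G")
  case True
  note c = contains_odd_hole[OF True] contains_long_antihole[OF True] contains_prism[OF True]
  have "artemis_graph (adj G) (pverts G) \<longleftrightarrow>
     \<not> contains G is_odd_hole \<and> \<not> contains G is_long_antihole \<and> \<not> contains G is_prism"
  proof
    assume "artemis_graph (adj G) (pverts G)"
    then interpret artemis_graph "adj G" "pverts G" .
    show "\<not> contains G is_odd_hole \<and> \<not> contains G is_long_antihole \<and> \<not> contains G is_prism"
      unfolding c using hole_odd antihole_short no_prism by fastforce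
  next
    assume n: "\<not> contains G is_odd_hole \<and> \<not> contains G is_long_antihole \<and> \<not> contains G is_prism"
    interpret ugraph "adj G" by (rule pair_graph_ugraph[OF True])
    show "artemis_graph (adj G) (pverts G)"
    proof
      show "finite (pverts G)" by (rule pair_graphD(1)[OF True])
      show "\<And>d f. hole (adj G) d f \<Longrightarrow> d \<in> pverts G \<Longrightarrow> set f \<subseteq> pverts G \<Longrightarrow> odd (length f)"
        using n unfolding c by blast
      show "length f \<le> 3" if "hole (co (adj G)) d f" "d \<in> pverts G" "set f \<subseteq> pverts G" for d f
      proof (rule ccontr)
        assume "\<not> length f \<le> 3"
        then have "4 \<le> length f" by simp
        then show False using n that unfolding c by blast
      qed
      show "\<And>P Q R. prism (adj G) P Q R \<Longrightarrow> set P \<subseteq> pverts G \<Longrightarrow> set Q \<subseteq> pverts G \<Longrightarrow> set R \<subseteq> pverts G \<Longrightarrow> False"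
        using n unfolding c by blast
    qed
  qed
  then show ?thesis using True by (auto simp: artemis_def)
qed (simp add: artemis_def)

lemma even_pair_if_special:
  assumes G: "pair_graph G" and sp: "special (adj G) (pverts G) a b"
  shows "even_pair G a b"
  unfolding even_pair_def
proof (intro conjI allI impI)
  fix p assume p: "is_path G p \<and> hd p = a \<and> last p = b"
  then have "odd (length p)" using sp unfolding special_def is_path_iff[OF G] by blast
  then show "even (path_length p)" by (simp add: path_length_def)
qed (use sp in \<open>auto simp: special_def\<close>)

lemma special_even_pair_if_special:
  assumes G: "pair_graph G" and sp: "special (adj G) (pverts G) a b"
  shows "special_even_pair G a b"
proof -
  have "\<not> contains G (is_strict_quasi_prism a b)"
  proof
    assume "contains G (is_strict_quasi_prism a b)"
    then obtain S where SV: "S \<subseteq> pverts G" and "is_strict_quasi_prism a b (induce G S)"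
      unfolding contains_iff[OF G] by blast
    then obtain S1 S2 S3 S4 a' b' c c' d d' where
      dist: "distinct (S1 @ S2 @ S3 @ S4)" and S: "S = set (S1 @ S2 @ S3 @ S4)"
      and p1: "is_path (induce G S) S1" "hd S1 = a" "last S1 = a'"
      and p2: "is_path (induce G S) S2" "hd S2 = b" "last S2 = b'"
      and p3: "is_path (induce G S) S3" "hd S3 = c" "last S3 = c'" "1 \<le> path_length S3"
      and p4: "is_path (induce G S) S4" "hd S4 = d" "last S4 = d'" "1 \<le> path_length S4"
      and arcs: "parcs (induce G S) = path_edges S1 \<union> path_edges S2 \<union> path_edges S3 \<union> path_edges S4 \<union>
         symcl {(a', c), (a', d), (c, d), (b', c'), (b', d'), (c', d')}"
      and strict: "1 \<le> path_length S1 \<or> 1 \<le> path_length S2"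
      unfolding is_strict_quasi_prism_def by (auto simp: induce_def)
    have ip: "ipath (adj G) S1" "ipath (adj G) S2" "ipath (adj G) S3" "ipath (adj G) S4"
      using p1 p2 p3 p4 unfolding is_path_induce[OF G SV] by auto
    then have ne: "S1 \<noteq> []" "S2 \<noteq> []" "S3 \<noteq> []" "S4 \<noteq> []" by auto
    have m: "a' \<in> set S1" "b' \<in> set S2" "c \<in> set S3" "c' \<in> set S3" "d \<in> set S4" "d' \<in> set S4"
      using ne p1 p2 p3 p4 by auto
    define X where "X = {(a', c), (a', d), (c, d), (b', c'), (b', d'), (c', d')}"
    have e: "adj G u v \<longleftrightarrow> (u, v) \<in> path_edges S1 \<union> path_edges S2 \<union> path_edges S3 \<union> path_edges S4 \<union> symcl X"
      if "u \<in> S" "v \<in> S" for u v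
      using arcs that unfolding induce_def X_def[symmetric] by auto
    have dj: "\<And>x. x \<in> set S1 \<Longrightarrow> x \<notin> set S2 \<and> x \<notin> set S3 \<and> x \<notin> set S4"
      "\<And>x. x \<in> set S2 \<Longrightarrow> x \<notin> set S1 \<and> x \<notin> set S3 \<and> x \<notin> set S4"
      "\<And>x. x \<in> set S3 \<Longrightarrow> x \<notin> set S1 \<and> x \<notin> set S2 \<and> x \<notin> set S4"
      "\<And>x. x \<in> set S4 \<Longrightarrow> x \<notin> set S1 \<and> x \<notin> set S2 \<and> x \<notin> set S3"
      using dist by auto
    note dm = dj(1)[OF m(1)] dj(2)[OF m(2)] dj(3)[OF m(3)] dj(3)[OF m(4)] dj(4)[OF m(5)] dj(4)[OF m(6)]
    \<comment> \<open>All six pairs of paths are treated at once; disjointness later discards the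
      terms that belong to other pairs.\<close>
    have x: "u \<noteq> v \<and> (adj G u v \<longleftrightarrow> u = a' \<and> (v = c \<or> v = d) \<or> u = b' \<and> (v = c' \<or> v = d') \<or>
          u = c \<and> v = d \<or> u = c' \<and> v = d')"
      if uv: "u \<in> set S1 \<and> v \<in> set S2 \<or> u \<in> set S1 \<and> v \<in> set S3 \<or> u \<in> set S1 \<and> v \<in> set S4 \<or>
        u \<in> set S2 \<and> v \<in> set S3 \<or> u \<in> set S2 \<and> v \<in> set S4 \<or> u \<in> set S3 \<and> v \<in> set S4" for u v
    proof -
      have in_S: "u \<in> S" "v \<in> S" using uv S by auto
      have "u \<noteq> v" using uv dj by blast
      moreover have "(u, v) \<notin> path_edges S1 \<union> path_edges S2 \<union> path_edges S3 \<union> path_edges S4"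
        using uv dj path_edges_sub[of u v] by blast
      moreover have "(v, u) \<notin> X"
        using uv dj m unfolding X_def by blast
      ultimately have "adj G u v \<longleftrightarrow> (u, v) \<in> X"
        using e[OF in_S] unfolding in_symcl Un_iff by blast
      with \<open>u \<noteq> v\<close> show ?thesis unfolding X_def by auto
    qed
    have x12: "\<forall>u\<in>set S1. \<forall>v\<in>set S2. u \<noteq> v \<and> \<not> adj G u v"
    proof (intro ballI)
      fix u v assume "u \<in> set S1" "v \<in> set S2"
      then show "u \<noteq> v \<and> \<not> adj G u v" using x[of u v] dj(1)[of u] dj(2)[of v] m by auto
    qed
    have x13: "\<forall>u\<in>set S1. \<forall>v\<in>set S3. u \<noteq> v \<and> (adj G u v \<longleftrightarrow> u = a' \<and> v = c)"
    proof (intro ballI)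
      fix u v assume "u \<in> set S1" "v \<in> set S3"
      then show "u \<noteq> v \<and> (adj G u v \<longleftrightarrow> u = a' \<and> v = c)" using x[of u v] dj(1)[of u] dj(3)[of v] m by auto
    qed
    have x14: "\<forall>u\<in>set S1. \<forall>v\<in>set S4. u \<noteq> v \<and> (adj G u v \<longleftrightarrow> u = a' \<and> v = d)"
    proof (intro ballI)
      fix u v assume "u \<in> set S1" "v \<in> set S4"
      then show "u \<noteq> v \<and> (adj G u v \<longleftrightarrow> u = a' \<and> v = d)" using x[of u v] dj(1)[of u] dj(4)[of v] m by auto
    qed
    have x23: "\<forall>u\<in>set S2. \<forall>v\<in>set S3. u \<noteq> v \<and> (adj G u v \<longleftrightarrow> u = b' \<and> v = c')"
    proof (intro ballI)
      fix u v assume "u \<in> set S2" "v \<in> set S3"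
      then show "u \<noteq> v \<and> (adj G u v \<longleftrightarrow> u = b' \<and> v = c')" using x[of u v] dj(2)[of u] dj(3)[of v] m by auto
    qed
    have x24: "\<forall>u\<in>set S2. \<forall>v\<in>set S4. u \<noteq> v \<and> (adj G u v \<longleftrightarrow> u = b' \<and> v = d')"
    proof (intro ballI)
      fix u v assume "u \<in> set S2" "v \<in> set S4"
      then show "u \<noteq> v \<and> (adj G u v \<longleftrightarrow> u = b' \<and> v = d')" using x[of u v] dj(2)[of u] dj(4)[of v] m by auto
    qed
    have x34: "\<forall>u\<in>set S3. \<forall>v\<in>set S4. u \<noteq> v \<and> (adj G u v \<longleftrightarrow> u = c \<and> v = d \<or> u = c' \<and> v = d')"
    proof (intro ballI)
      fix u v assume "u \<in> set S3" "v \<in> set S4"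
      then show "u \<noteq> v \<and> (adj G u v \<longleftrightarrow> u = c \<and> v = d \<or> u = c' \<and> v = d')"
        using x[of u v] dj(3)[of u] dj(4)[of v] m by auto
    qed
    have len: "2 \<le> length S3" "2 \<le> length S4"
      using p3(4) p4(4) unfolding path_length_def by linarith+
    have "quasi_prism (adj G) S1 S2 S3 S4"
      unfolding quasi_prism_def rungs_def p1(3) p2(3) p3(2,3) p4(2,3)
      using ip x12 x13 x14 x23 x24 x34 len by simp
    moreover have "set S1 \<union> set S2 \<union> set S3 \<union> set S4 \<subseteq> pverts G" using S SV by auto
    ultimately have "length S1 < 2 \<and> length S2 < 2" using sp p1 p2 unfolding special_def by blast
    then show False using strict by (auto simp: path_length_def)
  qed
  then show ?thesis using even_pair_if_special[OF G sp] by (simp add: special_even_pair_def)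
qed

section \<open>From special pairs to perfect contractility\<close>

lemma is_clique_iff:
  "is_clique G \<longleftrightarrow> finite (pverts G) \<and> parcs G = {(u, v). u \<in> pverts G \<and> v \<in> pverts G \<and> u \<noteq> v}"
  unfolding is_clique_def complete_digraph_pair_def by auto

lemma special_pair_of_artemis:
  assumes "artemis G" "\<not> is_clique G"
  shows "\<exists>a b. special (adj G) (pverts G) a b"
proof -
  have G: "pair_graph G" "artemis_graph (adj G) (pverts G)" using assms(1) artemis_iff by auto
  have "\<exists>u\<in>pverts G. \<exists>v\<in>pverts G. u \<noteq> v \<and> \<not> adj G u v"
    using assms(2) pair_graphD[OF G(1)] unfolding is_clique_iff by blast
  then show ?thesis using special_pair_exists[OF G(2)] by blast
qed

lemma artemis_contract:
  assumes "artemis G" "special (adj G) (pverts G) x y"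
  shows "artemis (contract G x y)" "card (pverts (contract G x y)) < card (pverts G)"
proof -
  have G: "pair_graph G" "artemis_graph (adj G) (pverts G)" using assms(1) artemis_iff by auto
  note Gd = pair_graphD[OF G(1)]
  have xy: "x \<in> pverts G" "y \<in> pverts G" "x \<noteq> y" using assms(2) by (auto simp: special_def)
  interpret artemis_graph "adj G" "pverts G" by (rule G(2))
  interpret special_contraction "adj G" "pverts G" x y
    by unfold_locales (rule assms(2))
  have v: "pverts (contract G x y) = pverts G - {y}"
    using xy by (auto simp: contract_def Let_def)
  have a: "adj (contract G x y) u v \<longleftrightarrow> contr (adj G) x y u v" if "u \<in> pverts G - {y}" "v \<in> pverts G - {y}" for u v
    using that Gd(3) xy unfolding contract_def Let_def contr_def by (auto simp: in_symcl)
  have sub: "parcs (contract G x y) \<subseteq> pverts (contract G x y) \<times> pverts (contract G x y)"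
    by (auto simp: contract_def Let_def in_symcl)
  have g: "pair_graph (contract G x y)"
  proof (rule pair_graphI)
    show "finite (pverts (contract G x y))" unfolding v using Gd(1) by simp
    show "adj (contract G x y) v u" if "adj (contract G x y) u v" for u v
    proof -
      have "u \<in> pverts G - {y}" "v \<in> pverts G - {y}" using that sub v by auto
      then show ?thesis using a[of u v] a[of v u] that R.sym by blast
    qed
    show "\<not> adj (contract G x y) u u" for u
    proof
      assume h: "adj (contract G x y) u u"
      then have "u \<in> pverts G - {y}" using sub v by auto
      then show False using a[of u u] h R.irrefl by blast
    qed
  qed (rule sub)
  interpret c: artemis_graph "contr (adj G) x y" "pverts G - {y}" by (rule artemis_contr)
  have "artemis_graph (adj (contract G x y)) (pverts (contract G x y))"
    unfolding v
    by (rule c.artemis_map[where \<phi> = id]) (use pair_graph_ugraph[OF g] a in auto)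
  then show "artemis (contract G x y)" using g artemis_iff by blast
  show "card (pverts (contract G x y)) < card (pverts G)"
    unfolding v using xy(2) Gd(1) by (rule card_Diff1_less[rotated])
qed

text \<open>Prepends \<open>G\<close> to a contraction sequence, shifting the indices by
  one.\<close>

lemma contractile_step:
  assumes "even_pair G x y" "contractile (contract G x y)"
  shows "contractile G"
proof -
  obtain k and Gs :: "nat \<Rightarrow> 'a pair_pre_digraph" where k: "Gs 0 = contract G x y"
    "\<forall>i<k. \<exists>x y. even_pair (Gs i) x y \<and> Gs (Suc i) = contract (Gs i) x y" "is_clique (Gs k)"
  proof (cases "is_clique (contract G x y)")
    case True
    \<comment> \<open>A clique needs no contraction: a constant sequence with
      \<open>k = 0\<close>.\<close>
    then show thesis using that[of "\<lambda>_. contract G x y" 0] by auto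
  next
    case False
    then show thesis using assms(2) that unfolding contractile_def by blast
  qed
  let ?H = "\<lambda>i. case i of 0 \<Rightarrow> G | Suc j \<Rightarrow> Gs j"
  have "\<forall>i<Suc k. \<exists>x y. even_pair (?H i) x y \<and> ?H (Suc i) = contract (?H i) x y"
    using k(1,2) assms(1) by (auto split: nat.split)
  then have "?H 0 = G \<and> (\<forall>i<Suc k. \<exists>x y. even_pair (?H i) x y \<and> ?H (Suc i) = contract (?H i) x y) \<and> is_clique (?H (Suc k))"
    using k(3) by simp
  then show ?thesis unfolding contractile_def by blast
qed

text \<open>Each contraction of a special pair stays in the class and loses a vertex, so the process
  ends in a clique.\<close>

lemma artemis_contractile: "artemis G \<Longrightarrow> contractile G"
proof (induction "card (pverts G)" arbitrary: G rule: less_induct)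
  case less
  show ?case
  proof (cases "is_clique G")
    case True
    then show ?thesis by (simp add: contractile_def)
  next
    case False
    then obtain x y where sp: "special (adj G) (pverts G) x y" using special_pair_of_artemis less.prems by blast
    have "contractile (contract G x y)"
      by (rule less.hyps[OF artemis_contract(2,1)[OF less.prems sp]])
    moreover have "even_pair G x y"
      using even_pair_if_special[OF _ sp] less.prems by (simp add: artemis_def)
    ultimately show ?thesis by (rule contractile_step[rotated])
  qed
qed

lemma artemis_induced:
  assumes "artemis G" "induced_subgraph (with_proj H) (with_proj G)"
  shows "artemis H"
proof -
  have G: "pair_graph G" "artemis_graph (adj G) (pverts G)" using assms(1) artemis_iff by auto
  have H: "pverts H \<subseteq> pverts G" "parcs H = parcs G \<inter> pverts H \<times> pverts H"
    using assms(2) induced_subgraph_pair[OF G(1)] by auto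
  have "H = induce G (pverts H)" unfolding induce_def by (subst H(2)[symmetric]) simp
  then have g: "pair_graph H" using induce_pair_graph[OF G(1) H(1)] by simp
  interpret artemis_graph "adj G" "pverts G" by (rule G(2))
  have "artemis_graph (adj H) (pverts H)"
    by (rule artemis_map[where \<phi> = id]) (use pair_graph_ugraph[OF g] H in auto)
  then show ?thesis using g artemis_iff by blast
qed

theorem mainTheorem2:
  fixes G :: "'a pair_pre_digraph"
  assumes "artemis G"
  shows "(\<not> is_clique G \<longrightarrow> (\<exists>a b. special_even_pair G a b)) \<and> perfectly_contractile G"
proof
  show "\<not> is_clique G \<longrightarrow> (\<exists>a b. special_even_pair G a b)"
  proof
    assume "\<not> is_clique G"
    then obtain a b where "special (adj G) (pverts G) a b" using special_pair_of_artemis[OF assms] by blast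
    moreover have "pair_graph G" using assms by (simp add: artemis_def)
    ultimately show "\<exists>a b. special_even_pair G a b" using special_even_pair_if_special[of G a b] by blast
  qed
  show "perfectly_contractile G"
    unfolding perfectly_contractile_def using artemis_induced[OF assms] artemis_contractile by blast
qed

end
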